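(* Let $K$ be a commutative ring, let $\mathcal{T}$, $\mathcal{U}$ be small dg-categories over $K$ and $M\in\mathrm{DgMod}(\mathcal{U}\otimes\mathcal{T}^{op})$. For $T,T'\in\mathcal{T}$ and $U,U'\in\mathcal{U}$, $$\mathrm{Hom}_\Lambda\Big(\left[\begin{smallmatrix}T&0\\ M&U\end{smallmatrix}\right],\left[\begin{smallmatrix}T'&0\\ M&U'\end{smallmatrix}\right]\Big)=\left[\begin{smallmatrix}\mathrm{Hom}_{\mathcal{T}}(T,T')&0\\ M(U',T)&\mathrm{Hom}_{\mathcal{U}}(U,U')\end{smallmatrix}\right]$$ has a differential graded $K$-module structure (with entrywise grading and entrywise differential), and for all $T,T',T''\in\mathcal{T}$, $U,U',U''\in\mathcal{U}$ the composition $$\left[\begin{smallmatrix}\mathcal{T}(T',T'')&0\\ M(U'',T')&\mathcal{U}(U',U'')\end{smallmatrix}\right]\otimes\left[\begin{smallmatrix}\mathcal{T}(T,T')&0\\ M(U',T)&\mathcal{U}(U,U')\end{smallmatrix}\right]\longrightarrow\left[\begin{smallmatrix}\mathcal{T}(T,T'')&0\\ M(U'',T)&\mathcal{U}(U,U'')\end{smallmatrix}\right],$$ $$\left[\begin{smallmatrix}t_2&0\\ m_2&u_2\end{smallmatrix}\right]\otimes\left[\begin{smallmatrix}t_1&0\\ m_1&u_1\end{smallmatrix}\right]\longmapsto\left[\begin{smallmatrix}t_2\circ t_1&0\\ m_2\bullet t_1+u_2\bullet m_1&u_2\circ u_1\end{smallmatrix}\right]$$ is a morphism of dg $K$-modules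 of degree zero (commuting with the differentials). In particular, $\Lambda=\left[\begin{smallmatrix}\mathcal{T}&0\\ M&\mathcal{U}\end{smallmatrix}\right]$ is a dg-category over $K$.
   Context: $\otimes=\otimes_K$. A dg $K$-module is a graded $K$-module $M=\bigoplus_{n\in\mathbb{Z}}M^n$ with a $K$-linear $d_M$ of degree $+1$, $d_M^2=0$; $|\cdot|$ denotes degree. $\mathrm{DgMod}(K)$ has as objects the dg $K$-modules, $\mathrm{Hom}(M,N)=\bigoplus_n\mathrm{Hom}^n(M,N)$ ($\mathrm{Hom}^n$ = graded $K$-linear maps of degree $n$) with differential $d(\alpha)=d_N\alpha-(-1)^{|\alpha|}\alpha d_M$. On $M\otimes N$: $d(m\otimes n)=d_M(m)\otimes n+(-1)^{|m|}m\otimes d_N(n)$. A dg-category is a $K$-category whose Hom's are dg $K$-modules and whose composition $\mathrm{Hom}(Y,Z)\otimes\mathrm{Hom}(X,Y)\to\mathrm{Hom}(X,Z)$ has degree zero and commutes with differentials. $\mathcal{A}^{op}$ has the same differentials and composition $\beta^{op}\circ\alpha^{op}=(-1)^{|\alpha||\beta|}(\alpha\circ\beta)^{op}$. $\mathcal{A}\otimes\mathcal{B}$ has objects pairs, $\mathrm{Hom}((X,Y),(X',Y'))=\mathcal{A}(X,X')\otimes\mathcal{B}(Y,Y')$, and $(\alpha_2\otimes\beta_2)\circ(\alpha_1\otimes\beta_1)=(-1)^{|\beta_2||\alpha_1|}\alpha_2\alpha_1\otimes\beta_2\beta_1$. A dg-functor is a $K$-linear functor preserving degrees of morphisms and commuting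 with differentials. $M\in\mathrm{DgMod}(\mathcal{U}\otimes\mathcal{T}^{op})$ means that $M:\mathcal{U}\otimes\mathcal{T}^{op}\to\mathrm{DgMod}(K)$ is a dg-functor. $\Lambda$ has as objects the matrices $\left[\begin{smallmatrix}T&0\\ M&U\end{smallmatrix}\right]$ with $T\in\mathcal{T}$, $U\in\mathcal{U}$ (i.e. pairs $(T,U)$), morphisms the matrices $\left[\begin{smallmatrix}t&0\\ m&u\end{smallmatrix}\right]$ with $t\in\mathcal{T}(T,T')$, $m\in M(U',T)$, $u\in\mathcal{U}(U,U')$, and the displayed composition, where for homogeneous elements $m\in M(U,T')$, $t\in\mathcal{T}(T,T')$: $m\bullet t=(-1)^{|m||t|}M(1_U\otimes t^{op})(m)\in M(U,T)$, and for $u\in\mathcal{U}(U,U')$, $m\in M(U,T)$: $u\bullet m=M(u\otimes 1_T^{op})(m)\in M(U',T)$; both are extended bilinearly. Degree $n$ morphisms are the matrices with all entries of degree $n$; the differential is $\left[\begin{smallmatrix}t&0\\ m&u\end{smallmatrix}\right]\mapsto\left[\begin{smallmatrix}d(t)&0\\ d_{M(U',T)}(m)&d(u)\end{smallmatrix}\right]$. *)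

theory Defs
  imports "HOL-Algebra.Module" "HOL-Algebra.AbelCoset"
begin

section \<open>Modules\<close>

definition linear_maps ::
  "('k, 'c) ring_scheme \<Rightarrow> ('k, 'm, 'a) module_scheme \<Rightarrow> ('k, 'n, 'b) module_scheme \<Rightarrow> ('m \<Rightarrow> 'n) set"
  where "linear_maps K M N =
    {f \<in> carrier M \<rightarrow> carrier N.
       (\<forall>x\<in>carrier M. \<forall>y\<in>carrier M. f (x \<oplus>\<^bsub>M\<^esub> y) = f x \<oplus>\<^bsub>N\<^esub> f y) \<and>
       (\<forall>k\<in>carrier K. \<forall>x\<in>carrier M. f (k \<odot>\<^bsub>M\<^esub> x) = k \<odot>\<^bsub>N\<^esub> f x)}"

definition bilinear_map ::
  "('k, 'c) ring_scheme \<Rightarrow> ('k, 'm, 'a) module_scheme \<Rightarrow> ('k, 'n, 'b) module_scheme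
    \<Rightarrow> ('k, 'p, 'd) module_scheme \<Rightarrow> ('m \<Rightarrow> 'n \<Rightarrow> 'p) \<Rightarrow> bool"
  where "bilinear_map K M N P b \<longleftrightarrow>
    (\<forall>x\<in>carrier M. b x \<in> linear_maps K N P) \<and>
    (\<forall>y\<in>carrier N. (\<lambda>x. b x y) \<in> linear_maps K M P)"

definition module_span ::
  "('k, 'c) ring_scheme \<Rightarrow> ('k, 'm, 'a) module_scheme \<Rightarrow> 'm set \<Rightarrow> 'm set"
  where "module_span K M S = \<Inter>{H. submodule H K M \<and> S \<subseteq> H}"

text \<open>Module records inherit the fields \<open>mult\<close> and \<open>one\<close> from rings; they play no role for
  modules and are left undefined in the constructions below.\<close>

definition quotient_module :: "('k, 'm, 'a) module_scheme \<Rightarrow> 'm set \<Rightarrow> ('k, 'm set) module"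
  where "quotient_module M H =
    \<lparr>carrier = a_rcosets\<^bsub>M\<^esub> H, mult = undefined, one = undefined,
     zero = H, add = (\<lambda>X Y. X <+>\<^bsub>M\<^esub> Y),
     smult = (\<lambda>k X. H <+>\<^bsub>M\<^esub> ((\<lambda>x. k \<odot>\<^bsub>M\<^esub> x) ` X))\<rparr>"

definition free_module :: "('k, 'c) ring_scheme \<Rightarrow> 's set \<Rightarrow> ('k, 's \<Rightarrow> 'k) module"
  where "free_module K S =
    \<lparr>carrier = {f. f ` S \<subseteq> carrier K \<and> (\<forall>s. s \<notin> S \<longrightarrow> f s = \<zero>\<^bsub>K\<^esub>) \<and> finite {s. f s \<noteq> \<zero>\<^bsub>K\<^esub>}},
     mult = undefined, one = undefined,
     zero = (\<lambda>s. \<zero>\<^bsub>K\<^esub>), add = (\<lambda>f g s. f s \<oplus>\<^bsub>K\<^esub> g s),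
     smult = (\<lambda>k f s. k \<otimes>\<^bsub>K\<^esub> f s)\<rparr>"

definition free_gen :: "('k, 'c) ring_scheme \<Rightarrow> 's \<Rightarrow> 's \<Rightarrow> 'k"
  where "free_gen K s = (\<lambda>s'. if s' = s then \<one>\<^bsub>K\<^esub> else \<zero>\<^bsub>K\<^esub>)"


section \<open>Tensor products over \<open>K\<close>\<close>

text \<open>The tensor product is the free module on the Cartesian product of the carriers, modulo the
  submodule generated by the bilinearity relations.\<close>

definition tensor_relations ::
  "('k, 'c) ring_scheme \<Rightarrow> ('k, 'm, 'a) module_scheme \<Rightarrow> ('k, 'n, 'b) module_scheme
    \<Rightarrow> ('m \<times> 'n \<Rightarrow> 'k) set"
  where "tensor_relations K M N =
    (let F = free_module K (carrier M \<times> carrier N); e = (\<lambda>x y. free_gen K (x, y)) in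
     module_span K F
       ({e (x \<oplus>\<^bsub>M\<^esub> x') y \<ominus>\<^bsub>F\<^esub> (e x y \<oplus>\<^bsub>F\<^esub> e x' y) | x x' y.
            x \<in> carrier M \<and> x' \<in> carrier M \<and> y \<in> carrier N}
        \<union> {e x (y \<oplus>\<^bsub>N\<^esub> y') \<ominus>\<^bsub>F\<^esub> (e x y \<oplus>\<^bsub>F\<^esub> e x y') | x y y'.
            x \<in> carrier M \<and> y \<in> carrier N \<and> y' \<in> carrier N}
        \<union> {e (k \<odot>\<^bsub>M\<^esub> x) y \<ominus>\<^bsub>F\<^esub> k \<odot>\<^bsub>F\<^esub> e x y | k x y.
            k \<in> carrier K \<and> x \<in> carrier M \<and> y \<in> carrier N}
        \<union> {e x (k \<odot>\<^bsub>N\<^esub> y) \<ominus>\<^bsub>F\<^esub> k \<odot>\<^bsub>F\<^esub> e x y | k x y.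
            k \<in> carrier K \<and> x \<in> carrier M \<and> y \<in> carrier N}))"

definition tensor_module ::
  "('k, 'c) ring_scheme \<Rightarrow> ('k, 'm, 'a) module_scheme \<Rightarrow> ('k, 'n, 'b) module_scheme
    \<Rightarrow> ('k, ('m \<times> 'n \<Rightarrow> 'k) set) module"
  where "tensor_module K M N =
    quotient_module (free_module K (carrier M \<times> carrier N)) (tensor_relations K M N)"

definition pure_tensor ::
  "('k, 'c) ring_scheme \<Rightarrow> ('k, 'm, 'a) module_scheme \<Rightarrow> ('k, 'n, 'b) module_scheme
    \<Rightarrow> 'm \<Rightarrow> 'n \<Rightarrow> ('m \<times> 'n \<Rightarrow> 'k) set"
  where "pure_tensor K M N x y =
    tensor_relations K M N +>\<^bsub>free_module K (carrier M \<times> carrier N)\<^esub> free_gen K (x, y)"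

text \<open>The linear map on a tensor product induced by a bilinear map \<open>b\<close> with values in \<open>P\<close>,
  evaluated on a representative of the coset; for bilinear \<open>b\<close> the choice is irrelevant.\<close>

definition tensor_lift ::
  "('k, 'c) ring_scheme \<Rightarrow> ('k, 'p, 'd) module_scheme \<Rightarrow> ('m \<Rightarrow> 'n \<Rightarrow> 'p)
    \<Rightarrow> ('m \<times> 'n \<Rightarrow> 'k) set \<Rightarrow> 'p"
  where "tensor_lift K P b X =
    (let f = (SOME f. f \<in> X) in
     \<Oplus>\<^bsub>P\<^esub>p\<in>{p. f p \<noteq> \<zero>\<^bsub>K\<^esub>}. f p \<odot>\<^bsub>P\<^esub> b (fst p) (snd p))"


section \<open>Graded and dg modules\<close>

record ('k, 'm) gr_module = "('k, 'm) module" +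
  grade :: "int \<Rightarrow> 'm set"

record ('k, 'm) dg_module = "('k, 'm) gr_module" +
  dif :: "'m \<Rightarrow> 'm"

definition decomposes ::
  "('k, 'm, 'a) gr_module_scheme \<Rightarrow> 'm \<Rightarrow> (int \<Rightarrow> 'm) \<Rightarrow> bool"
  where "decomposes M x c \<longleftrightarrow>
    (\<forall>n. c n \<in> grade M n) \<and> finite {n. c n \<noteq> \<zero>\<^bsub>M\<^esub>} \<and>
    x = (\<Oplus>\<^bsub>M\<^esub>n\<in>{n. c n \<noteq> \<zero>\<^bsub>M\<^esub>}. c n)"

locale gr_module = module K M
  for K :: "('k, 'c) ring_scheme" and M :: "('k, 'm, 'a) gr_module_scheme" +
  assumes grade_submodule: "submodule (grade M n) K M"
    and direct_sum: "x \<in> carrier M \<Longrightarrow> \<exists>!c. decomposes M x c"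

locale dg_module = gr_module K M
  for K :: "('k, 'c) ring_scheme" and M :: "('k, 'm, 'a) dg_module_scheme" +
  assumes dif_linear: "dif M \<in> linear_maps K M M"
    and dif_degree: "x \<in> grade M n \<Longrightarrow> dif M x \<in> grade M (n + 1)"
    and dif_dif: "x \<in> carrier M \<Longrightarrow> dif M (dif M x) = \<zero>\<^bsub>M\<^esub>"

definition dg_morphism ::
  "('k, 'c) ring_scheme \<Rightarrow> ('k, 'm, 'a) dg_module_scheme \<Rightarrow> ('k, 'n, 'b) dg_module_scheme
    \<Rightarrow> ('m \<Rightarrow> 'n) \<Rightarrow> bool"
  where "dg_morphism K M N f \<longleftrightarrow>
    f \<in> linear_maps K M N \<and>
    (\<forall>n. \<forall>x\<in>grade M n. f x \<in> grade N n) \<and>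
    (\<forall>x\<in>carrier M. f (dif M x) = dif N (f x))"

definition gr_component :: "('k, 'm, 'a) gr_module_scheme \<Rightarrow> 'm \<Rightarrow> int \<Rightarrow> 'm"
  where "gr_component M x = (THE c. decomposes M x c)"

text \<open>Extension by (bi)linearity of a formula given on homogeneous elements; the extra integer
  arguments of \<open>f\<close> are the degrees of the homogeneous arguments.\<close>

definition linear_ext ::
  "('k, 'm, 'a) gr_module_scheme \<Rightarrow> ('k, 'p, 'd) module_scheme \<Rightarrow> (int \<Rightarrow> 'm \<Rightarrow> 'p) \<Rightarrow> 'm \<Rightarrow> 'p"
  where "linear_ext M P f x =
    (\<Oplus>\<^bsub>P\<^esub>i\<in>{i. gr_component M x i \<noteq> \<zero>\<^bsub>M\<^esub>}. f i (gr_component M x i))"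

definition bilinear_ext ::
  "('k, 'm, 'a) gr_module_scheme \<Rightarrow> ('k, 'n, 'b) gr_module_scheme \<Rightarrow> ('k, 'p, 'd) module_scheme
    \<Rightarrow> (int \<Rightarrow> int \<Rightarrow> 'm \<Rightarrow> 'n \<Rightarrow> 'p) \<Rightarrow> 'm \<Rightarrow> 'n \<Rightarrow> 'p"
  where "bilinear_ext M N P f x y =
    linear_ext M P (\<lambda>i x'. linear_ext N P (\<lambda>j y'. f i j x' y') y) x"

text \<open>\<open>sgn_pow M n x\<close> is \<open>(-1)\<^sup>n x\<close>.\<close>

definition sgn_pow :: "('k, 'm, 'a) module_scheme \<Rightarrow> int \<Rightarrow> 'm \<Rightarrow> 'm"
  where "sgn_pow M n x = (if even n then x else \<ominus>\<^bsub>M\<^esub> x)"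

definition add_grading :: "('k, 'm) module \<Rightarrow> (int \<Rightarrow> 'm set) \<Rightarrow> ('k, 'm) gr_module"
  where "add_grading A g =
    \<lparr>carrier = carrier A, mult = mult A, one = one A, zero = zero A, add = add A,
     smult = smult A, grade = g\<rparr>"

definition add_dif :: "('k, 'm) gr_module \<Rightarrow> ('m \<Rightarrow> 'm) \<Rightarrow> ('k, 'm) dg_module"
  where "add_dif A d =
    \<lparr>carrier = carrier A, mult = mult A, one = one A, zero = zero A, add = add A,
     smult = smult A, grade = grade A, dif = d\<rparr>"

definition tensor ::
  "('k, 'c) ring_scheme \<Rightarrow> ('k, 'm, 'a) dg_module_scheme \<Rightarrow> ('k, 'n, 'b) dg_module_scheme
    \<Rightarrow> ('k, ('m \<times> 'n \<Rightarrow> 'k) set) dg_module"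
  where "tensor K M N =
    (let P = tensor_module K M N; pt = pure_tensor K M N in
     add_dif
       (add_grading P
         (\<lambda>n. module_span K P
            {pt x y | x y i j. x \<in> grade M i \<and> y \<in> grade N j \<and> i + j = n}))
       (tensor_lift K P (\<lambda>x y.
          linear_ext M P (\<lambda>i x'. pt (dif M x') y \<oplus>\<^bsub>P\<^esub> sgn_pow P i (pt x' (dif N y))) x)))"


section \<open>The dg modules \<open>Hom(M, N)\<close>\<close>

definition hom_degree ::
  "('k, 'c) ring_scheme \<Rightarrow> ('k, 'm, 'a) gr_module_scheme \<Rightarrow> ('k, 'n, 'b) gr_module_scheme
    \<Rightarrow> int \<Rightarrow> ('m \<Rightarrow> 'n) set"
  where "hom_degree K M N n =
    {f \<in> linear_maps K M N \<inter> extensional (carrier M). \<forall>i. f ` grade M i \<subseteq> grade N (i + n)}"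

text \<open>The sum of the \<open>hom_degree K M N n\<close> inside all linear maps is direct, so
  \<open>Hom(M, N)\<close> is realised as the set of finite sums of homogeneous linear maps.\<close>

definition hom_gr_module ::
  "('k, 'c) ring_scheme \<Rightarrow> ('k, 'm, 'a) gr_module_scheme \<Rightarrow> ('k, 'n, 'b) gr_module_scheme
    \<Rightarrow> ('k, 'm \<Rightarrow> 'n) gr_module"
  where "hom_gr_module K M N =
    \<lparr>carrier = {\<lambda>x\<in>carrier M. \<Oplus>\<^bsub>N\<^esub>n\<in>D. g n x | D g.
                  finite D \<and> (\<forall>n\<in>D. g n \<in> hom_degree K M N n)},
     mult = undefined, one = undefined,
     zero = (\<lambda>x\<in>carrier M. \<zero>\<^bsub>N\<^esub>),
     add = (\<lambda>f g. \<lambda>x\<in>carrier M. f x \<oplus>\<^bsub>N\<^esub> g x),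
     smult = (\<lambda>k f. \<lambda>x\<in>carrier M. k \<odot>\<^bsub>N\<^esub> f x),
     grade = hom_degree K M N\<rparr>"

definition hom_dg_module ::
  "('k, 'c) ring_scheme \<Rightarrow> ('k, 'm, 'a) dg_module_scheme \<Rightarrow> ('k, 'n, 'b) dg_module_scheme
    \<Rightarrow> ('k, 'm \<Rightarrow> 'n) dg_module"
  where "hom_dg_module K M N =
    (let H = hom_gr_module K M N in
     add_dif H (linear_ext H H (\<lambda>n f. \<lambda>x\<in>carrier M.
        dif N (f x) \<ominus>\<^bsub>N\<^esub> sgn_pow N n (f (dif M x)))))"


section \<open>dg categories\<close>

text \<open>\<open>Comp C X Y Z g f\<close> is the composite of \<open>f \<in> Hom C X Y\<close> and \<open>g \<in> Hom C Y Z\<close>.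
  The object indices are needed because the carriers of distinct Hom modules may overlap.\<close>

record ('k, 'o, 'm) dg_category =
  Obj :: "'o set"
  Hom :: "'o \<Rightarrow> 'o \<Rightarrow> ('k, 'm) dg_module"
  Comp :: "'o \<Rightarrow> 'o \<Rightarrow> 'o \<Rightarrow> 'm \<Rightarrow> 'm \<Rightarrow> 'm"
  Ide :: "'o \<Rightarrow> 'm"

locale K_category =
  fixes K :: "('k, 'c) ring_scheme" and C :: "('k, 'o, 'm) dg_category"
  assumes cring_K: "cring K"
    and Hom_module: "\<lbrakk>X \<in> Obj C; Y \<in> Obj C\<rbrakk> \<Longrightarrow> module K (Hom C X Y)"
    and Comp_bilinear: "\<lbrakk>X \<in> Obj C; Y \<in> Obj C; Z \<in> Obj C\<rbrakk> \<Longrightarrow>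
      bilinear_map K (Hom C Y Z) (Hom C X Y) (Hom C X Z) (Comp C X Y Z)"
    and Comp_assoc: "\<lbrakk>W \<in> Obj C; X \<in> Obj C; Y \<in> Obj C; Z \<in> Obj C;
        f \<in> carrier (Hom C W X); g \<in> carrier (Hom C X Y); h \<in> carrier (Hom C Y Z)\<rbrakk> \<Longrightarrow>
      Comp C W X Z (Comp C X Y Z h g) f = Comp C W Y Z h (Comp C W X Y g f)"
    and Ide_closed: "X \<in> Obj C \<Longrightarrow> Ide C X \<in> carrier (Hom C X X)"
    and Ide_left: "\<lbrakk>X \<in> Obj C; Y \<in> Obj C; f \<in> carrier (Hom C X Y)\<rbrakk> \<Longrightarrow>
      Comp C X Y Y (Ide C Y) f = f"
    and Ide_right: "\<lbrakk>X \<in> Obj C; Y \<in> Obj C; f \<in> carrier (Hom C X Y)\<rbrakk> \<Longrightarrow>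
      Comp C X X Y f (Ide C X) = f"

locale dg_category = K_category K C
  for K :: "('k, 'c) ring_scheme" and C :: "('k, 'o, 'm) dg_category" +
  assumes Hom_dg_module: "\<lbrakk>X \<in> Obj C; Y \<in> Obj C\<rbrakk> \<Longrightarrow> dg_module K (Hom C X Y)"
    and Comp_dg_morphism: "\<lbrakk>X \<in> Obj C; Y \<in> Obj C; Z \<in> Obj C\<rbrakk> \<Longrightarrow>
      \<exists>c. dg_morphism K (tensor K (Hom C Y Z) (Hom C X Y)) (Hom C X Z) c \<and>
          (\<forall>g\<in>carrier (Hom C Y Z). \<forall>f\<in>carrier (Hom C X Y).
             c (pure_tensor K (Hom C Y Z) (Hom C X Y) g f) = Comp C X Y Z g f)"

text \<open>The dg modules whose elements are drawn from the type \<open>'v\<close>.\<close>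

definition DgMod :: "('k, 'c) ring_scheme \<Rightarrow> ('k, ('k, 'v) dg_module, 'v \<Rightarrow> 'v) dg_category"
  where "DgMod K =
    \<lparr>Obj = {M. dg_module K M},
     Hom = hom_dg_module K,
     Comp = (\<lambda>X Y Z g f. compose (carrier X) g f),
     Ide = (\<lambda>X. \<lambda>x\<in>carrier X. x)\<rparr>"

definition opposite :: "('k, 'o, 'm) dg_category \<Rightarrow> ('k, 'o, 'm) dg_category"
  where "opposite C =
    \<lparr>Obj = Obj C,
     Hom = (\<lambda>X Y. Hom C Y X),
     Comp = (\<lambda>X Y Z. bilinear_ext (Hom C Z Y) (Hom C Y X) (Hom C Z X)
        (\<lambda>i j g f. sgn_pow (Hom C Z X) (i * j) (Comp C Z Y X f g))),
     Ide = Ide C\<rparr>"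

text \<open>In the composition, \<open>q = \<Sum> a\<^sub>2 \<otimes> b\<^sub>2\<close> is composed with \<open>p = \<Sum> a\<^sub>1 \<otimes> b\<^sub>1\<close>, with
  sign \<open>(-1)\<close> to the power \<open>|b\<^sub>2| |a\<^sub>1|\<close>.\<close>

definition tensor_category ::
  "('k, 'c) ring_scheme \<Rightarrow> ('k, 'o, 'm) dg_category \<Rightarrow> ('k, 'p, 'n) dg_category
    \<Rightarrow> ('k, 'o \<times> 'p, ('m \<times> 'n \<Rightarrow> 'k) set) dg_category"
  where "tensor_category K A B =
    \<lparr>Obj = Obj A \<times> Obj B,
     Hom = (\<lambda>(X, Y) (X', Y'). tensor K (Hom A X X') (Hom B Y Y')),
     Comp = (\<lambda>(X, Y) (X', Y') (X'', Y'') q p.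
        let P = tensor K (Hom A X X'') (Hom B Y Y'') in
        tensor_lift K P (\<lambda>a\<^sub>2 b\<^sub>2.
          tensor_lift K P (\<lambda>a\<^sub>1 b\<^sub>1.
            bilinear_ext (Hom B Y' Y'') (Hom A X X') P
              (\<lambda>i j b\<^sub>2' a\<^sub>1'. sgn_pow P (i * j)
                 (pure_tensor K (Hom A X X'') (Hom B Y Y'')
                   (Comp A X X' X'' a\<^sub>2 a\<^sub>1') (Comp B Y Y' Y'' b\<^sub>2' b\<^sub>1)))
              b\<^sub>2 a\<^sub>1) p) q),
     Ide = (\<lambda>(X, Y). pure_tensor K (Hom A X X) (Hom B Y Y) (Ide A X) (Ide B Y))\<rparr>"

record ('o, 'm, 'p, 'n) dg_functor =
  onObj :: "'o \<Rightarrow> 'p"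
  onHom :: "'o \<Rightarrow> 'o \<Rightarrow> 'm \<Rightarrow> 'n"

locale dg_functor =
  fixes K :: "('k, 'c) ring_scheme" and A :: "('k, 'o, 'm) dg_category"
    and B :: "('k, 'p, 'n) dg_category" and F :: "('o, 'm, 'p, 'n) dg_functor"
  assumes onObj_closed: "X \<in> Obj A \<Longrightarrow> onObj F X \<in> Obj B"
    and onHom_dg_morphism: "\<lbrakk>X \<in> Obj A; Y \<in> Obj A\<rbrakk> \<Longrightarrow>
      dg_morphism K (Hom A X Y) (Hom B (onObj F X) (onObj F Y)) (onHom F X Y)"
    and onHom_Comp: "\<lbrakk>X \<in> Obj A; Y \<in> Obj A; Z \<in> Obj A;
        f \<in> carrier (Hom A X Y); g \<in> carrier (Hom A Y Z)\<rbrakk> \<Longrightarrow>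
      onHom F X Z (Comp A X Y Z g f) =
        Comp B (onObj F X) (onObj F Y) (onObj F Z) (onHom F Y Z g) (onHom F X Y f)"
    and onHom_Ide: "X \<in> Obj A \<Longrightarrow> onHom F X X (Ide A X) = Ide B (onObj F X)"


section \<open>The triangular matrix category\<close>

type_synonym ('k, 'u, 'mu, 't, 'mt, 'v) bimodule =
  "('u \<times> 't, ('mu \<times> 'mt \<Rightarrow> 'k) set, ('k, 'v) dg_module, 'v \<Rightarrow> 'v) dg_functor"

text \<open>The left action \<open>u \<bullet> m\<close> of \<open>u : U \<rightarrow> U'\<close> on \<open>m \<in> M(U, T)\<close>.\<close>

definition left_act ::
  "('k, 'c) ring_scheme \<Rightarrow> ('k, 't, 'mt) dg_category \<Rightarrow> ('k, 'u, 'mu) dg_category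
    \<Rightarrow> ('k, 'u, 'mu, 't, 'mt, 'v) bimodule \<Rightarrow> 'u \<Rightarrow> 'u \<Rightarrow> 't \<Rightarrow> 'mu \<Rightarrow> 'v \<Rightarrow> 'v"
  where "left_act K \<T> \<U> M U U' T u m =
    onHom M (U, T) (U', T)
      (pure_tensor K (Hom \<U> U U') (Hom (opposite \<T>) T T) u (Ide (opposite \<T>) T)) m"

text \<open>The right action \<open>m \<bullet> t\<close> of \<open>t : T \<rightarrow> T'\<close> on \<open>m \<in> M(U, T')\<close>.\<close>

definition right_act ::
  "('k, 'c) ring_scheme \<Rightarrow> ('k, 't, 'mt) dg_category \<Rightarrow> ('k, 'u, 'mu) dg_category
    \<Rightarrow> ('k, 'u, 'mu, 't, 'mt, 'v) bimodule \<Rightarrow> 'u \<Rightarrow> 't \<Rightarrow> 't \<Rightarrow> 'v \<Rightarrow> 'mt \<Rightarrow> 'v"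
  where "right_act K \<T> \<U> M U T T' =
    bilinear_ext (onObj M (U, T')) (Hom \<T> T T') (onObj M (U, T))
      (\<lambda>i j m t. sgn_pow (onObj M (U, T)) (i * j)
         (onHom M (U, T') (U, T)
           (pure_tensor K (Hom \<U> U U) (Hom (opposite \<T>) T' T) (Ide \<U> U) t) m))"

text \<open>The object with diagonal entries \<open>T\<close>, \<open>U\<close> is the pair \<open>(T, U)\<close>, and the lower
  triangular matrix with diagonal entries \<open>t\<close>, \<open>u\<close> and off-diagonal entry \<open>m\<close> is the
  triple \<open>(t, m, u)\<close>.\<close>

definition triangular_Hom ::
  "('k, 't, 'mt) dg_category \<Rightarrow> ('k, 'u, 'mu) dg_category
    \<Rightarrow> ('k, 'u, 'mu, 't, 'mt, 'v) bimodule \<Rightarrow> 't \<times> 'u \<Rightarrow> 't \<times> 'u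
    \<Rightarrow> ('k, 'mt \<times> 'v \<times> 'mu) dg_module"
  where "triangular_Hom \<T> \<U> M = (\<lambda>(T, U) (T', U').
    let A = Hom \<T> T T'; B = onObj M (U', T); D = Hom \<U> U U' in
    \<lparr>carrier = carrier A \<times> carrier B \<times> carrier D, mult = undefined, one = undefined,
     zero = (\<zero>\<^bsub>A\<^esub>, \<zero>\<^bsub>B\<^esub>, \<zero>\<^bsub>D\<^esub>),
     add = (\<lambda>(t, m, u) (t', m', u'). (t \<oplus>\<^bsub>A\<^esub> t', m \<oplus>\<^bsub>B\<^esub> m', u \<oplus>\<^bsub>D\<^esub> u')),
     smult = (\<lambda>k (t, m, u). (k \<odot>\<^bsub>A\<^esub> t, k \<odot>\<^bsub>B\<^esub> m, k \<odot>\<^bsub>D\<^esub> u)),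
     grade = (\<lambda>n. grade A n \<times> grade B n \<times> grade D n),
     dif = (\<lambda>(t, m, u). (dif A t, dif B m, dif D u))\<rparr>)"

definition triangular_category ::
  "('k, 'c) ring_scheme \<Rightarrow> ('k, 't, 'mt) dg_category \<Rightarrow> ('k, 'u, 'mu) dg_category
    \<Rightarrow> ('k, 'u, 'mu, 't, 'mt, 'v) bimodule \<Rightarrow> ('k, 't \<times> 'u, 'mt \<times> 'v \<times> 'mu) dg_category"
  where "triangular_category K \<T> \<U> M =
    \<lparr>Obj = Obj \<T> \<times> Obj \<U>,
     Hom = triangular_Hom \<T> \<U> M,
     Comp = (\<lambda>(T, U) (T', U') (T'', U'') (t\<^sub>2, m\<^sub>2, u\<^sub>2) (t\<^sub>1, m\<^sub>1, u\<^sub>1).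
        (Comp \<T> T T' T'' t\<^sub>2 t\<^sub>1,
         right_act K \<T> \<U> M U'' T T' m\<^sub>2 t\<^sub>1
           \<oplus>\<^bsub>onObj M (U'', T)\<^esub> left_act K \<T> \<U> M U' U'' T u\<^sub>2 m\<^sub>1,
         Comp \<U> U U' U'' u\<^sub>2 u\<^sub>1)),
     Ide = (\<lambda>(T, U). (Ide \<T> T, \<zero>\<^bsub>onObj M (U, T)\<^esub>, Ide \<U> U))\<rparr>"

end

theory Submission
  imports Defs
begin

text \<open>Write \<open>a(u, t)\<close> for the map \<open>M(u \<otimes> t\<^sup>o\<^sup>p)\<close>. Functoriality of \<open>M\<close> together with the signs in the
  opposite and in the tensor product category gives
  \<open>a(u\<^sub>2, t\<^sub>2) a(u\<^sub>1, t\<^sub>1) = (-1)\<^bsup>|t\<^sub>2| (|u\<^sub>1| + |t\<^sub>1|)\<^esup> a(u\<^sub>2 u\<^sub>1, t\<^sub>1 t\<^sub>2)\<close>,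
  and the sign in \<open>m \<bullet> t = (-1)\<^bsup>|m| |t|\<^esup> a(1, t)(m)\<close> is exactly the one turning \<open>M\<close> into an associative
  bimodule over \<open>\<U>\<close> on the left and \<open>\<T>\<close> on the right. Compatibility of \<open>M\<close> with the
  differential of \<open>Hom(M(U, T'), M(U', T))\<close> becomes the Leibniz rule for both actions, because identities
  are closed of degree zero. All axioms for triangular matrices then hold entrywise. Each identity
  is multilinear, so it suffices to check it on homogeneous elements; likewise a bilinear map induces a
  morphism of dg modules on the tensor product as soon as it is additive on degrees and satisfies the Leibniz
  rule on homogeneous elements.\<close>

section \<open>Linear maps, submodules and quotients\<close>

text \<open>Identities are only assumed to be two-sided units in the underlying module. That they
  have degree zero comes from comparing degrees in \<open>f = f \<circ> 1\<close>; that they are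
  closed comes from the Leibniz rule for \<open>1 = 1 \<circ> 1\<close>, which reads d(1) = d(1) +
  d(1). These two facts keep u \<bullet> m = a(u, 1)(m) and m \<bullet> t, which is a(1, t)(m) up to
  sign, free of extra terms under d and of extra signs.

  The obstacle lies in the concrete constructions. The differential of a tensor product, that of
  Hom(M, N), and composition in the opposite and in the tensor product category are all given by
  extension from homogeneous components, and maps out of a tensor product by a chosen representative
  of a coset. Each of them is first turned into a rule that can be calculated with: linearity in
  every argument, and a value on pure tensors or on homogeneous elements.

  A matrix has one sign in the Leibniz rule although its entries are multiplied by four different
  products. This works because all entries of a homogeneous matrix have the same degree.\<close>

lemma linear_mapsI:
  assumes "\<And>x. x \<in> carrier M \<Longrightarrow> f x \<in> carrier N"
    and "\<And>x y. \<lbrakk>x \<in> carrier M; y \<in> carrier M\<rbrakk> \<Longrightarrow> f (x \<oplus>\<^bsub>M\<^esub> y) = f x \<oplus>\<^bsub>N\<^esub> f y"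
    and "\<And>k x. \<lbrakk>k \<in> carrier K; x \<in> carrier M\<rbrakk> \<Longrightarrow> f (k \<odot>\<^bsub>M\<^esub> x) = k \<odot>\<^bsub>N\<^esub> f x"
  shows "f \<in> linear_maps K M N"
  using assms unfolding linear_maps_def by blast

lemma linear_maps_closed: "\<lbrakk>f \<in> linear_maps K M N; x \<in> carrier M\<rbrakk> \<Longrightarrow> f x \<in> carrier N"
  unfolding linear_maps_def by blast

lemma linear_maps_add:
  "\<lbrakk>f \<in> linear_maps K M N; x \<in> carrier M; y \<in> carrier M\<rbrakk> \<Longrightarrow> f (x \<oplus>\<^bsub>M\<^esub> y) = f x \<oplus>\<^bsub>N\<^esub> f y"
  unfolding linear_maps_def by blast

lemma linear_maps_smult:
  "\<lbrakk>f \<in> linear_maps K M N; k \<in> carrier K; x \<in> carrier M\<rbrakk> \<Longrightarrow> f (k \<odot>\<^bsub>M\<^esub> x) = k \<odot>\<^bsub>N\<^esub> f x"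
  unfolding linear_maps_def by blast

lemma linear_maps_zero:
  assumes "module K M" "module K N" "f \<in> linear_maps K M N"
  shows "f \<zero>\<^bsub>M\<^esub> = \<zero>\<^bsub>N\<^esub>"
proof -
  interpret M: module K M by fact
  interpret N: module K N by fact
  have "f (\<zero>\<^bsub>K\<^esub> \<odot>\<^bsub>M\<^esub> \<zero>\<^bsub>M\<^esub>) = \<zero>\<^bsub>K\<^esub> \<odot>\<^bsub>N\<^esub> f \<zero>\<^bsub>M\<^esub>"
    by (rule linear_maps_smult[OF assms(3)]) simp_all
  then show ?thesis
    by (simp add: linear_maps_closed[OF assms(3)])
qed

lemma linear_maps_uminus:
  assumes "module K M" "module K N" "f \<in> linear_maps K M N" "x \<in> carrier M"
  shows "f (\<ominus>\<^bsub>M\<^esub> x) = \<ominus>\<^bsub>N\<^esub> f x"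
proof -
  interpret M: module K M by fact
  interpret N: module K N by fact
  have "f (\<ominus>\<^bsub>M\<^esub> x \<oplus>\<^bsub>M\<^esub> x) = f (\<ominus>\<^bsub>M\<^esub> x) \<oplus>\<^bsub>N\<^esub> f x"
    by (rule linear_maps_add[OF assms(3)]) (simp_all add: assms)
  then have "f (\<ominus>\<^bsub>M\<^esub> x) \<oplus>\<^bsub>N\<^esub> f x = \<zero>\<^bsub>N\<^esub>"
    by (simp add: assms M.l_neg linear_maps_zero[OF assms(1-3)])
  then show ?thesis
    using N.minus_equality linear_maps_closed[OF assms(3)] assms(4) by (metis M.a_inv_closed)
qed

lemma linear_maps_sgn_pow:
  assumes "module K M" "module K N" "f \<in> linear_maps K M N" "x \<in> carrier M"
  shows "f (sgn_pow M n x) = sgn_pow N n (f x)"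
  by (simp add: sgn_pow_def linear_maps_uminus[OF assms])

lemma linear_maps_finsum:
  assumes "module K M" "module K N" "f \<in> linear_maps K M N" "g \<in> A \<rightarrow> carrier M"
  shows "f (finsum M g A) = finsum N (\<lambda>i. f (g i)) A"
proof -
  interpret M: module K M by fact
  interpret N: module K N by fact
  show ?thesis
    using assms(4)
  proof (induction A rule: infinite_finite_induct)
    case (insert a A)
    have "(\<lambda>i. f (g i)) \<in> A \<rightarrow> carrier N" "f (g a) \<in> carrier N"
      using insert.prems linear_maps_closed[OF assms(3)] by auto
    moreover have "f (g a \<oplus>\<^bsub>M\<^esub> finsum M g A) = f (g a) \<oplus>\<^bsub>N\<^esub> f (finsum M g A)"
      by (rule linear_maps_add[OF assms(3)]) (use insert.prems in auto)
    ultimately show ?case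
      using insert by simp
  qed (simp_all add: linear_maps_zero[OF assms(1-3)])
qed

lemma linear_maps_comp:
  assumes "f \<in> linear_maps K M N" "g \<in> linear_maps K N P"
  shows "(\<lambda>x. g (f x)) \<in> linear_maps K M P"
  by (rule linear_mapsI)
    (simp_all add: linear_maps_closed[OF assms(1)] linear_maps_closed[OF assms(2)]
      linear_maps_add[OF assms(1)] linear_maps_add[OF assms(2)]
      linear_maps_smult[OF assms(1)] linear_maps_smult[OF assms(2)])

text \<open>\<open>linear_maps\<close> constrains a function on the carrier only, so agreement there
  is enough. Closure of the carrier under the operations is what the module hypothesis
  contributes.\<close>

lemma linear_maps_cong:
  assumes "module K M" "f \<in> linear_maps K M N" "\<And>x. x \<in> carrier M \<Longrightarrow> f x = g x"
  shows "g \<in> linear_maps K M N"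
proof -
  interpret M: module K M by fact
  show ?thesis
    by (rule linear_mapsI)
      (simp_all add: assms(3)[symmetric] linear_maps_closed[OF assms(2)]
        linear_maps_add[OF assms(2)] linear_maps_smult[OF assms(2)])
qed

lemma linear_maps_plus:
  assumes "module K N" "f \<in> linear_maps K M N" "g \<in> linear_maps K M N"
  shows "(\<lambda>x. f x \<oplus>\<^bsub>N\<^esub> g x) \<in> linear_maps K M N"
proof -
  interpret N: module K N by fact
  note [simp] = linear_maps_closed[OF assms(2)] linear_maps_closed[OF assms(3)]
  show ?thesis
    by (rule linear_mapsI)
      (simp_all add: linear_maps_add[OF assms(2)] linear_maps_smult[OF assms(2)]
        linear_maps_add[OF assms(3)] linear_maps_smult[OF assms(3)] N.smult_r_distr
        N.add.m_ac)
qed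

lemma linear_maps_const_zero:
  assumes "module K N"
  shows "(\<lambda>x. \<zero>\<^bsub>N\<^esub>) \<in> linear_maps K M N"
proof -
  interpret N: module K N by fact
  show ?thesis by (rule linear_mapsI) simp_all
qed

lemma linear_maps_smult_const:
  assumes "module K N" "k \<in> carrier K" "f \<in> linear_maps K M N"
  shows "(\<lambda>x. k \<odot>\<^bsub>N\<^esub> f x) \<in> linear_maps K M N"
proof -
  interpret N: module K N by fact
  note [simp] = linear_maps_closed[OF assms(3)]
  show ?thesis
    by (rule linear_mapsI)
      (simp_all add: assms(2) linear_maps_add[OF assms(3)] linear_maps_smult[OF assms(3)]
        N.smult_r_distr N.smult_assoc1[symmetric] N.R.m_comm)
qed

lemma linear_maps_minus_const:
  assumes "module K N" "f \<in> linear_maps K M N"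
  shows "(\<lambda>x. \<ominus>\<^bsub>N\<^esub> f x) \<in> linear_maps K M N"
proof -
  interpret N: module K N by fact
  note [simp] = linear_maps_closed[OF assms(2)]
  show ?thesis
    by (rule linear_mapsI)
      (simp_all add: linear_maps_add[OF assms(2)] linear_maps_smult[OF assms(2)]
        N.smult_r_minus N.minus_add)
qed

lemma linear_maps_sgn_pow_const:
  assumes "module K N" "f \<in> linear_maps K M N"
  shows "(\<lambda>x. sgn_pow N n (f x)) \<in> linear_maps K M N"
  unfolding sgn_pow_def using linear_maps_minus_const[OF assms] assms(2) by (cases "even n") simp_all

lemma linear_maps_finsum_const:
  assumes "module K N" "\<And>i. i \<in> A \<Longrightarrow> f i \<in> linear_maps K M N"
  shows "(\<lambda>x. \<Oplus>\<^bsub>N\<^esub>i\<in>A. f i x) \<in> linear_maps K M N"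
proof (cases "finite A")
  case True
  interpret N: module K N by fact
  note [simp] = linear_maps_closed[OF assms(2)]
  have [simp]: "(\<lambda>i. f i x) \<in> A \<rightarrow> carrier N" if "x \<in> carrier M" for x
    using that by auto
  show ?thesis
  proof (rule linear_mapsI)
    fix x y assume [simp]: "x \<in> carrier M" "y \<in> carrier M"
    have "(\<Oplus>\<^bsub>N\<^esub>i\<in>A. f i (x \<oplus>\<^bsub>M\<^esub> y)) = (\<Oplus>\<^bsub>N\<^esub>i\<in>A. f i x \<oplus>\<^bsub>N\<^esub> f i y)"
      by (rule N.finsum_cong') (auto simp: linear_maps_add[OF assms(2)])
    then show "(\<Oplus>\<^bsub>N\<^esub>i\<in>A. f i (x \<oplus>\<^bsub>M\<^esub> y)) = (\<Oplus>\<^bsub>N\<^esub>i\<in>A. f i x) \<oplus>\<^bsub>N\<^esub> (\<Oplus>\<^bsub>N\<^esub>i\<in>A. f i y)"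
      by (simp add: N.finsum_addf)
  next
    fix k x assume [simp]: "k \<in> carrier K" "x \<in> carrier M"
    have "(\<Oplus>\<^bsub>N\<^esub>i\<in>A. f i (k \<odot>\<^bsub>M\<^esub> x)) = (\<Oplus>\<^bsub>N\<^esub>i\<in>A. k \<odot>\<^bsub>N\<^esub> f i x)"
      by (rule N.finsum_cong') (auto simp: linear_maps_smult[OF assms(2)])
    then show "(\<Oplus>\<^bsub>N\<^esub>i\<in>A. f i (k \<odot>\<^bsub>M\<^esub> x)) = k \<odot>\<^bsub>N\<^esub> (\<Oplus>\<^bsub>N\<^esub>i\<in>A. f i x)"
      by (simp add: N.finsum_smult_ldistr True)
  qed simp
next
  \<comment> \<open>A \<open>finsum\<close> over an infinite index set is zero by convention, so the
    claim is about the zero map.\<close>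
  case False
  interpret N: module K N by fact
  show ?thesis
    using False by (simp add: N.finsum_infinite linear_maps_const_zero[OF assms(1)])
qed

section \<open>Bilinear maps\<close>

lemma bilinear_mapI:
  assumes "\<And>x. x \<in> carrier M \<Longrightarrow> b x \<in> linear_maps K N P"
    and "\<And>y. y \<in> carrier N \<Longrightarrow> (\<lambda>x. b x y) \<in> linear_maps K M P"
  shows "bilinear_map K M N P b"
  using assms unfolding bilinear_map_def by blast

lemma bilinear_map_left: "\<lbrakk>bilinear_map K M N P b; y \<in> carrier N\<rbrakk> \<Longrightarrow> (\<lambda>x. b x y) \<in> linear_maps K M P"
  unfolding bilinear_map_def by blast

lemma bilinear_map_right: "\<lbrakk>bilinear_map K M N P b; x \<in> carrier M\<rbrakk> \<Longrightarrow> b x \<in> linear_maps K N P"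
  unfolding bilinear_map_def by blast

lemma bilinear_map_closed:
  "\<lbrakk>bilinear_map K M N P b; x \<in> carrier M; y \<in> carrier N\<rbrakk> \<Longrightarrow> b x y \<in> carrier P"
  by (rule linear_maps_closed[OF bilinear_map_right])

lemma bilinear_map_cong:
  assumes "module K M" "module K N" "bilinear_map K M N P b"
    and "\<And>x y. \<lbrakk>x \<in> carrier M; y \<in> carrier N\<rbrakk> \<Longrightarrow> b x y = b' x y"
  shows "bilinear_map K M N P b'"
proof (rule bilinear_mapI)
  show "b' x \<in> linear_maps K N P" if "x \<in> carrier M" for x
    by (rule linear_maps_cong[OF assms(2) bilinear_map_right[OF assms(3) that]])
      (use assms(4) that in auto)
  show "(\<lambda>x. b' x y) \<in> linear_maps K M P" if "y \<in> carrier N" for y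
    by (rule linear_maps_cong[OF assms(1) bilinear_map_left[OF assms(3) that]])
      (use assms(4) that in auto)
qed

section \<open>Submodules, spans and quotients\<close>

lemma preimage_submodule:
  assumes "module K M" "module K N" "f \<in> linear_maps K M N" "submodule H K N"
  shows "submodule {x \<in> carrier M. f x \<in> H} K M"
proof -
  interpret M: module K M by fact
  interpret N: module K N by fact
  note N.submoduleE[OF assms(4)]
  moreover have "\<zero>\<^bsub>N\<^esub> \<in> H"
    using subgroup.one_closed[OF submodule.axioms(1)[OF assms(4)]] by simp
  ultimately show ?thesis
    by (intro M.submoduleI)
      (auto simp: linear_maps_zero[OF assms(1-3)] linear_maps_uminus[OF assms(1-3)]
        linear_maps_add[OF assms(3)] linear_maps_smult[OF assms(3)])
qed

lemma zero_submodule: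
  assumes "module K M"
  shows "submodule {\<zero>\<^bsub>M\<^esub>} K M"
proof -
  interpret M: module K M by fact
  show ?thesis by (rule M.submoduleI) auto
qed

lemma module_span_submodule:
  assumes "module K M" "S \<subseteq> carrier M"
  shows "submodule (module_span K M S) K M"
proof -
  interpret M: module K M by fact
  have sub: "x \<in> H \<Longrightarrow> x \<in> carrier M" if "submodule H K M" for H x
    using M.submoduleE(1)[OF that] by blast
  have zero: "\<zero>\<^bsub>M\<^esub> \<in> H" if "submodule H K M" for H
    using subgroup.one_closed[OF submodule.axioms(1)[OF that]] by simp
  show ?thesis
    unfolding module_span_def
  proof (rule M.submoduleI, goal_cases)
    \<comment> \<open>The family that is intersected contains the carrier, because
      \<open>S \<subseteq> carrier M\<close>. An empty family would have the whole type as its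
      intersection.\<close>
    case 1
    then show ?case using M.carrier_is_submodule assms(2) by blast
  next
    case 2
    then show ?case using zero by blast
  next
    case (3 a)
    then show ?case using M.submoduleE(3) by blast
  next
    case (4 a b)
    then show ?case using M.submoduleE(5) by blast
  next
    case (5 a x)
    then show ?case using M.submoduleE(4) by blast
  qed
qed

lemma module_span_superset: "S \<subseteq> module_span K M S"
  unfolding module_span_def by blast

lemma module_span_least: "\<lbrakk>submodule H K M; S \<subseteq> H\<rbrakk> \<Longrightarrow> module_span K M S \<subseteq> H"
  unfolding module_span_def by blast

text \<open>Apart from the existence of negatives the module axioms are equations and closure
  statements, and all of them pass along a surjection that respects the operations. \<open>N\<close>
  is not yet a group, so f(0) = 0 cannot be derived and is assumed. The projection gives quotient
  modules; the identity moves the axioms between records that differ in extra fields, as in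
  \<open>tensor_is_module\<close> and \<open>hom_dg_is_module\<close>.\<close>

lemma module_surj_image:
  assumes "module K M" and f: "f \<in> linear_maps K M N"
    and surj: "f ` carrier M = carrier N" and zero: "f \<zero>\<^bsub>M\<^esub> = \<zero>\<^bsub>N\<^esub>"
  shows "module K N"
proof -
  interpret M: module K M by fact
  note add = linear_maps_add[OF f, symmetric] and smult = linear_maps_smult[OF f, symmetric]
  have ex: "\<exists>x\<in>carrier M. y = f x" if "y \<in> carrier N" for y
    using that surj by blast
  have cl: "f x \<in> carrier N" if "x \<in> carrier M" for x
    using that surj by blast
  show ?thesis
  proof (rule moduleI)
    show "abelian_group N"
    proof (rule abelian_groupI)
      fix x assume "x \<in> carrier N"
      then obtain a where a: "a \<in> carrier M" "x = f a" using ex by blast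
      then have "f (\<ominus>\<^bsub>M\<^esub> a) \<oplus>\<^bsub>N\<^esub> x = \<zero>\<^bsub>N\<^esub>"
        by (simp add: add M.l_neg zero)
      then show "\<exists>y\<in>carrier N. y \<oplus>\<^bsub>N\<^esub> x = \<zero>\<^bsub>N\<^esub>"
        using a cl by (meson M.a_inv_closed)
    qed (use zero in \<open>auto dest!: ex intro!: cl simp: add M.add.m_ac zero[symmetric]\<close>)
  qed (auto dest!: ex intro!: cl simp: add smult M.smult_l_distr M.smult_r_distr M.smult_assoc1 M.is_cring)
qed

lemma quotient_module_proj:
  assumes "module K M" "submodule H K M"
  shows "(\<lambda>x. H +>\<^bsub>M\<^esub> x) \<in> linear_maps K M (quotient_module M H)"
    and "(\<lambda>x. H +>\<^bsub>M\<^esub> x) ` carrier M = carrier (quotient_module M H)"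
    and "H +>\<^bsub>M\<^esub> \<zero>\<^bsub>M\<^esub> = \<zero>\<^bsub>quotient_module M H\<^esub>"
proof -
  interpret M: module K M by fact
  have sub: "subgroup H (add_monoid M)"
    by (rule submodule.axioms(1)[OF assms(2)])
  interpret H: abelian_subgroup H M
    by (rule abelian_subgroupI3) (auto intro: additive_subgroupI sub M.abelian_group_axioms)
  have Hsub: "H \<subseteq> carrier M" by (rule H.a_subset)
  show im: "(\<lambda>x. H +>\<^bsub>M\<^esub> x) ` carrier M = carrier (quotient_module M H)"
    by (auto simp: quotient_module_def A_RCOSETS_def')
  show "H +>\<^bsub>M\<^esub> \<zero>\<^bsub>M\<^esub> = \<zero>\<^bsub>quotient_module M H\<^esub>"
    using Hsub by (simp add: quotient_module_def)
  show "(\<lambda>x. H +>\<^bsub>M\<^esub> x) \<in> linear_maps K M (quotient_module M H)"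
  proof (rule linear_mapsI)
    fix k x assume k: "k \<in> carrier K" and x: "x \<in> carrier M"
    have Hk: "k \<odot>\<^bsub>M\<^esub> h \<in> H" if "h \<in> H" for h
      by (rule submodule.smult_closed[OF assms(2) k that])
    \<comment> \<open>Scaling the coset H + x yields only kH + kx, which may be smaller than a
      coset. The summand \<open>H\<close> in the scalar multiplication of
      \<open>quotient_module\<close> fills it up.\<close>
    have "H <+>\<^bsub>M\<^esub> ((\<lambda>x. k \<odot>\<^bsub>M\<^esub> x) ` (H +>\<^bsub>M\<^esub> x)) = H +>\<^bsub>M\<^esub> (k \<odot>\<^bsub>M\<^esub> x)"
    proof (intro equalityI subsetI)
      fix y assume "y \<in> H <+>\<^bsub>M\<^esub> ((\<lambda>x. k \<odot>\<^bsub>M\<^esub> x) ` (H +>\<^bsub>M\<^esub> x))"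
      then obtain h h' where h: "h \<in> H" "h' \<in> H" and y: "y = h \<oplus>\<^bsub>M\<^esub> k \<odot>\<^bsub>M\<^esub> (h' \<oplus>\<^bsub>M\<^esub> x)"
        by (auto simp: set_add_def' a_r_coset_def')
      have "y = (h \<oplus>\<^bsub>M\<^esub> k \<odot>\<^bsub>M\<^esub> h') \<oplus>\<^bsub>M\<^esub> k \<odot>\<^bsub>M\<^esub> x"
        using y h k x Hsub by (simp add: M.smult_r_distr M.a_assoc subset_iff)
      moreover have "h \<oplus>\<^bsub>M\<^esub> k \<odot>\<^bsub>M\<^esub> h' \<in> H"
        using h Hk by (simp add: H.a_closed)
      ultimately show "y \<in> H +>\<^bsub>M\<^esub> (k \<odot>\<^bsub>M\<^esub> x)"
        by (auto simp: a_r_coset_def')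
    next
      fix y assume "y \<in> H +>\<^bsub>M\<^esub> (k \<odot>\<^bsub>M\<^esub> x)"
      then obtain h where h: "h \<in> H" "y = h \<oplus>\<^bsub>M\<^esub> k \<odot>\<^bsub>M\<^esub> x"
        by (auto simp: a_r_coset_def')
      \<comment> \<open>The zero of \<open>H\<close> is inserted so that the scaled factor is
        visibly an element of the coset of \<open>x\<close>.\<close>
      then have "y = h \<oplus>\<^bsub>M\<^esub> k \<odot>\<^bsub>M\<^esub> (\<zero>\<^bsub>M\<^esub> \<oplus>\<^bsub>M\<^esub> x)"
        using x by simp
      then show "y \<in> H <+>\<^bsub>M\<^esub> ((\<lambda>x. k \<odot>\<^bsub>M\<^esub> x) ` (H +>\<^bsub>M\<^esub> x))"
        unfolding set_add_def' a_r_coset_def' using h(1) H.zero_closed by blast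
    qed
    then show "H +>\<^bsub>M\<^esub> (k \<odot>\<^bsub>M\<^esub> x) = k \<odot>\<^bsub>quotient_module M H\<^esub> (H +>\<^bsub>M\<^esub> x)"
      by (simp add: quotient_module_def)
  qed (use im in \<open>auto simp: quotient_module_def H.a_rcos_sum\<close>)
qed

lemma quotient_module_module:
  assumes "module K M" "submodule H K M"
  shows "module K (quotient_module M H)"
  by (rule module_surj_image[OF assms(1) quotient_module_proj[OF assms]])

lemma quotient_module_eqI:
  assumes "module K M" "submodule H K M" "x \<in> carrier M" "y \<in> carrier M" "x \<ominus>\<^bsub>M\<^esub> y \<in> H"
  shows "H +>\<^bsub>M\<^esub> x = H +>\<^bsub>M\<^esub> y"
proof -
  interpret M: module K M by fact
  have sub: "subgroup H (add_monoid M)"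
    by (rule submodule.axioms(1)[OF assms(2)])
  have "x = (x \<ominus>\<^bsub>M\<^esub> y) \<oplus>\<^bsub>M\<^esub> y"
    using assms by (simp add: a_minus_def M.a_assoc M.l_neg)
  then have "x \<in> H +>\<^bsub>M\<^esub> y"
    using assms(5) unfolding a_r_coset_def' by blast
  then show ?thesis
    using M.a_repr_independence[OF _ assms(4) sub] by simp
qed

section \<open>Free modules and tensor products\<close>

lemma free_module_carrierI:
  assumes "\<And>s. s \<in> S \<Longrightarrow> f s \<in> carrier K" "\<And>s. s \<notin> S \<Longrightarrow> f s = \<zero>\<^bsub>K\<^esub>" "finite {s. f s \<noteq> \<zero>\<^bsub>K\<^esub>}"
  shows "f \<in> carrier (free_module K S)"
  using assms unfolding free_module_def by auto

lemma free_module_carrierD: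
  assumes "f \<in> carrier (free_module K S)"
  shows "s \<in> S \<Longrightarrow> f s \<in> carrier K" "s \<notin> S \<Longrightarrow> f s = \<zero>\<^bsub>K\<^esub>" "finite {s. f s \<noteq> \<zero>\<^bsub>K\<^esub>}"
  using assms unfolding free_module_def by auto

lemma free_module_carrier_eval:
  assumes "cring K" "f \<in> carrier (free_module K S)"
  shows "f s \<in> carrier K"
proof -
  interpret K: cring K by fact
  show ?thesis using free_module_carrierD(1,2)[OF assms(2), of s] by (cases "s \<in> S") simp_all
qed

lemma free_module_simps:
  "\<zero>\<^bsub>free_module K S\<^esub> = (\<lambda>s. \<zero>\<^bsub>K\<^esub>)"
  "f \<oplus>\<^bsub>free_module K S\<^esub> g = (\<lambda>s. f s \<oplus>\<^bsub>K\<^esub> g s)"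
  "k \<odot>\<^bsub>free_module K S\<^esub> f = (\<lambda>s. k \<otimes>\<^bsub>K\<^esub> f s)"
  by (simp_all add: free_module_def)

lemma free_module_module:
  assumes "cring K"
  shows "module K (free_module K S)"
proof -
  interpret K: cring K by fact
  let ?F = "free_module K S"
  have ev: "\<forall>s. f s \<in> carrier K" if "f \<in> carrier ?F" for f
    using free_module_carrier_eval[OF assms that] by blast
  have add: "(\<lambda>s. f s \<oplus>\<^bsub>K\<^esub> g s) \<in> carrier ?F" if "f \<in> carrier ?F" "g \<in> carrier ?F" for f g
  proof (rule free_module_carrierI)
    show "finite {s. f s \<oplus>\<^bsub>K\<^esub> g s \<noteq> \<zero>\<^bsub>K\<^esub>}"
      by (rule finite_subset[of _ "{s. f s \<noteq> \<zero>\<^bsub>K\<^esub>} \<union> {s. g s \<noteq> \<zero>\<^bsub>K\<^esub>}"])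
        (use that in \<open>auto simp: free_module_carrierD(3)\<close>)
  qed (use that ev[OF that(1)] ev[OF that(2)] in \<open>auto simp: free_module_carrierD(2)[OF that(1)] free_module_carrierD(2)[OF that(2)]\<close>)
  have smult: "(\<lambda>s. k \<otimes>\<^bsub>K\<^esub> f s) \<in> carrier ?F" if "k \<in> carrier K" "f \<in> carrier ?F" for k f
  proof (rule free_module_carrierI)
    show "finite {s. k \<otimes>\<^bsub>K\<^esub> f s \<noteq> \<zero>\<^bsub>K\<^esub>}"
      by (rule finite_subset[OF _ free_module_carrierD(3)[OF that(2)]]) (use that in auto)
  qed (use that ev[OF that(2)] in \<open>auto simp: free_module_carrierD(2)[OF that(2)]\<close>)
  have uminus: "(\<lambda>s. \<ominus>\<^bsub>K\<^esub> f s) \<in> carrier ?F" if "f \<in> carrier ?F" for f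
  proof (rule free_module_carrierI)
    show "finite {s. \<ominus>\<^bsub>K\<^esub> f s \<noteq> \<zero>\<^bsub>K\<^esub>}"
      by (rule finite_subset[OF _ free_module_carrierD(3)[OF that]]) (use that in auto)
  qed (use that ev[OF that] in \<open>auto simp: free_module_carrierD(2)[OF that]\<close>)
  show ?thesis
  proof (rule moduleI)
    show "abelian_group ?F"
    proof (rule abelian_groupI)
      fix f assume f: "f \<in> carrier ?F"
      show "\<exists>g\<in>carrier ?F. g \<oplus>\<^bsub>?F\<^esub> f = \<zero>\<^bsub>?F\<^esub>"
        by (rule bexI[OF _ uminus[OF f]]) (use ev[OF f] in \<open>simp add: free_module_simps K.l_neg\<close>)
      show "\<zero>\<^bsub>?F\<^esub> \<oplus>\<^bsub>?F\<^esub> f = f"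
        using ev[OF f] by (simp add: free_module_simps)
    next
      show "\<zero>\<^bsub>?F\<^esub> \<in> carrier ?F"
        unfolding free_module_simps by (rule free_module_carrierI) auto
    next
      fix f g assume f: "f \<in> carrier ?F" and g: "g \<in> carrier ?F"
      show "f \<oplus>\<^bsub>?F\<^esub> g \<in> carrier ?F"
        using add[OF f g] by (simp add: free_module_simps)
      show "f \<oplus>\<^bsub>?F\<^esub> g = g \<oplus>\<^bsub>?F\<^esub> f"
        using ev[OF f] ev[OF g] by (simp add: free_module_simps K.a_comm)
      fix h assume h: "h \<in> carrier ?F"
      show "f \<oplus>\<^bsub>?F\<^esub> g \<oplus>\<^bsub>?F\<^esub> h = f \<oplus>\<^bsub>?F\<^esub> (g \<oplus>\<^bsub>?F\<^esub> h)"
        using ev[OF f] ev[OF g] ev[OF h] by (simp add: free_module_simps K.a_assoc)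
    qed
  next
    fix k f assume k: "k \<in> carrier K" and f: "f \<in> carrier ?F"
    show "k \<odot>\<^bsub>?F\<^esub> f \<in> carrier ?F"
      using smult[OF k f] by (simp add: free_module_simps)
    fix l assume l: "l \<in> carrier K"
    show "(k \<oplus>\<^bsub>K\<^esub> l) \<odot>\<^bsub>?F\<^esub> f = k \<odot>\<^bsub>?F\<^esub> f \<oplus>\<^bsub>?F\<^esub> l \<odot>\<^bsub>?F\<^esub> f"
      using k l ev[OF f] by (simp add: free_module_simps K.l_distr)
    show "k \<otimes>\<^bsub>K\<^esub> l \<odot>\<^bsub>?F\<^esub> f = k \<odot>\<^bsub>?F\<^esub> (l \<odot>\<^bsub>?F\<^esub> f)"
      using k l ev[OF f] by (simp add: free_module_simps K.m_assoc)
  next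
    fix k f g assume k: "k \<in> carrier K" and f: "f \<in> carrier ?F" and g: "g \<in> carrier ?F"
    show "k \<odot>\<^bsub>?F\<^esub> (f \<oplus>\<^bsub>?F\<^esub> g) = k \<odot>\<^bsub>?F\<^esub> f \<oplus>\<^bsub>?F\<^esub> k \<odot>\<^bsub>?F\<^esub> g"
      using k ev[OF f] ev[OF g] by (simp add: free_module_simps K.r_distr)
  next
    fix f assume f: "f \<in> carrier ?F"
    show "\<one>\<^bsub>K\<^esub> \<odot>\<^bsub>?F\<^esub> f = f"
      using ev[OF f] by (simp add: free_module_simps)
  qed (rule assms)
qed

lemma free_gen_closed:
  assumes "cring K" "s \<in> S"
  shows "free_gen K s \<in> carrier (free_module K S)"
proof -
  interpret K: cring K by fact
  show ?thesis
  proof (rule free_module_carrierI)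
    show "finite {t. free_gen K s t \<noteq> \<zero>\<^bsub>K\<^esub>}"
      by (rule finite_subset[of _ "{s}"]) (auto simp: free_gen_def)
  qed (use assms(2) in \<open>auto simp: free_gen_def\<close>)
qed

lemma free_module_induct [consumes 2, case_names zero add]:
  assumes "cring K" "f \<in> carrier (free_module K S)"
    and zero: "P \<zero>\<^bsub>free_module K S\<^esub>"
    and add: "\<And>f k s. \<lbrakk>f \<in> carrier (free_module K S); P f; k \<in> carrier K; s \<in> S\<rbrakk> \<Longrightarrow>
      P (f \<oplus>\<^bsub>free_module K S\<^esub> (k \<odot>\<^bsub>free_module K S\<^esub> free_gen K s))"
  shows "P f"
proof -
  interpret K: cring K by fact
  note ev = free_module_carrier_eval[OF assms(1)]
  \<comment> \<open>The induction runs over a finite superset \<open>A\<close> of the support, not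
    over the support itself: erasing the coefficient at one point of \<open>A\<close> then always
    leaves a function supported in the smaller set.\<close>
  have "P f" if "finite A" "f \<in> carrier (free_module K S)" "{s. f s \<noteq> \<zero>\<^bsub>K\<^esub>} \<subseteq> A" for A f
    using that
  proof (induction A arbitrary: f rule: finite_induct)
    case empty
    then have "f = (\<lambda>s. \<zero>\<^bsub>K\<^esub>)" by auto
    then show ?case using zero by (simp add: free_module_simps)
  next
    case (insert s A)
    show ?case
    proof (cases "s \<in> S")
      case True
      let ?g = "f(s := \<zero>\<^bsub>K\<^esub>)"
      have g: "?g \<in> carrier (free_module K S)"
      proof (rule free_module_carrierI)
        show "finite {t. ?g t \<noteq> \<zero>\<^bsub>K\<^esub>}"
          by (rule finite_subset[OF _ free_module_carrierD(3)[OF insert.prems(1)]]) auto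
      qed (use insert.prems(1) ev[OF insert.prems(1)] in \<open>auto simp: free_module_carrierD(2)[OF insert.prems(1)]\<close>)
      have "P ?g"
        by (rule insert.IH[OF g]) (use insert.prems(2) in auto)
      moreover have "f = ?g \<oplus>\<^bsub>free_module K S\<^esub> (f s \<odot>\<^bsub>free_module K S\<^esub> free_gen K s)"
        using ev[OF insert.prems(1)] by (auto simp: free_module_simps free_gen_def)
      ultimately show ?thesis
        using add[OF g _ ev[OF insert.prems(1)] True, of s] by simp
    next
      \<comment> \<open>A point outside \<open>S\<close> already has coefficient zero, so the
        smaller set still contains the support.\<close>
      case False
      then have "f s = \<zero>\<^bsub>K\<^esub>"
        by (rule free_module_carrierD(2)[OF insert.prems(1)])
      then show ?thesis
        by (intro insert.IH) (use insert.prems in auto)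
    qed
  qed
  from this[OF free_module_carrierD(3)[OF assms(2)] assms(2)] show ?thesis by simp
qed

section \<open>The universal property of free modules\<close>

definition free_lift :: "('k, 'c) ring_scheme \<Rightarrow> ('k, 'p, 'd) module_scheme \<Rightarrow> ('s \<Rightarrow> 'p) \<Rightarrow> ('s \<Rightarrow> 'k) \<Rightarrow> 'p"
  where "free_lift K P g f = (\<Oplus>\<^bsub>P\<^esub>s\<in>{s. f s \<noteq> \<zero>\<^bsub>K\<^esub>}. f s \<odot>\<^bsub>P\<^esub> g s)"

text \<open>The defining sum runs over the exact support, which changes under addition and scaling
  because of cancellation and zero divisors. Linearity can only be checked after all sums have been
  brought to one common index set.\<close>

lemma free_lift_superset:
  assumes "module K P" "\<And>s. s \<in> S \<Longrightarrow> g s \<in> carrier P" "f \<in> carrier (free_module K S)"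
    and "finite A" "{s. f s \<noteq> \<zero>\<^bsub>K\<^esub>} \<subseteq> A" "A \<subseteq> S"
  shows "free_lift K P g f = (\<Oplus>\<^bsub>P\<^esub>s\<in>A. f s \<odot>\<^bsub>P\<^esub> g s)"
proof -
  interpret P: module K P by fact
  show ?thesis
    unfolding free_lift_def
    by (rule P.add.finprod_mono_neutral_cong_left)
      (use assms in \<open>auto simp: free_module_carrier_eval[OF P.is_cring assms(3)]\<close>)
qed

lemma free_lift_linear:
  assumes "module K P" "\<And>s. s \<in> S \<Longrightarrow> g s \<in> carrier P"
  shows "free_lift K P g \<in> linear_maps K (free_module K S) P"
proof -
  interpret P: module K P by fact
  interpret F: module K "free_module K S" by (rule free_module_module[OF P.is_cring])
  note ev = free_module_carrier_eval[OF P.is_cring]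
  have supp: "finite {s. f s \<noteq> \<zero>\<^bsub>K\<^esub>}" "{s. f s \<noteq> \<zero>\<^bsub>K\<^esub>} \<subseteq> S"
    if "f \<in> carrier (free_module K S)" for f
    using free_module_carrierD[OF that] by auto
  show ?thesis
  proof (rule linear_mapsI)
    fix f assume f: "f \<in> carrier (free_module K S)"
    show "free_lift K P g f \<in> carrier P"
      unfolding free_lift_def
      by (rule P.finsum_closed) (use ev[OF f] assms(2) supp(2)[OF f] in auto)
  next
    fix f h assume f: "f \<in> carrier (free_module K S)" and h: "h \<in> carrier (free_module K S)"
    let ?A = "{s. f s \<noteq> \<zero>\<^bsub>K\<^esub>} \<union> {s. h s \<noteq> \<zero>\<^bsub>K\<^esub>}"
    have A: "finite ?A" "?A \<subseteq> S" using supp[OF f] supp[OF h] by auto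
    have gA: "g s \<in> carrier P" if "s \<in> ?A" for s using A(2) assms(2) that by blast
    have "free_lift K P g (f \<oplus>\<^bsub>free_module K S\<^esub> h)
        = (\<Oplus>\<^bsub>P\<^esub>s\<in>?A. (f \<oplus>\<^bsub>free_module K S\<^esub> h) s \<odot>\<^bsub>P\<^esub> g s)"
      by (rule free_lift_superset[OF assms(1) assms(2) F.a_closed[OF f h] A(1) _ A(2)])
        (use ev[OF f] ev[OF h] in \<open>auto simp: free_module_simps\<close>)
    also have "\<dots> = (\<Oplus>\<^bsub>P\<^esub>s\<in>?A. f s \<odot>\<^bsub>P\<^esub> g s \<oplus>\<^bsub>P\<^esub> h s \<odot>\<^bsub>P\<^esub> g s)"
      by (rule P.finsum_cong') (use gA ev[OF f] ev[OF h] in \<open>auto simp: free_module_simps P.smult_l_distr\<close>)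
    also have "\<dots> = (\<Oplus>\<^bsub>P\<^esub>s\<in>?A. f s \<odot>\<^bsub>P\<^esub> g s) \<oplus>\<^bsub>P\<^esub> (\<Oplus>\<^bsub>P\<^esub>s\<in>?A. h s \<odot>\<^bsub>P\<^esub> g s)"
      by (rule P.finsum_addf) (use gA ev[OF f] ev[OF h] in auto)
    also have "(\<Oplus>\<^bsub>P\<^esub>s\<in>?A. f s \<odot>\<^bsub>P\<^esub> g s) = free_lift K P g f"
      by (rule free_lift_superset[symmetric, OF assms(1) assms(2) f A(1) _ A(2)]) auto
    also have "(\<Oplus>\<^bsub>P\<^esub>s\<in>?A. h s \<odot>\<^bsub>P\<^esub> g s) = free_lift K P g h"
      by (rule free_lift_superset[symmetric, OF assms(1) assms(2) h A(1) _ A(2)]) auto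
    finally show "free_lift K P g (f \<oplus>\<^bsub>free_module K S\<^esub> h) = free_lift K P g f \<oplus>\<^bsub>P\<^esub> free_lift K P g h" .
  next
    fix k f assume k: "k \<in> carrier K" and f: "f \<in> carrier (free_module K S)"
    let ?A = "{s. f s \<noteq> \<zero>\<^bsub>K\<^esub>}"
    have gA: "g s \<in> carrier P" if "s \<in> ?A" for s using supp(2)[OF f] assms(2) that by blast
    have "free_lift K P g (k \<odot>\<^bsub>free_module K S\<^esub> f)
        = (\<Oplus>\<^bsub>P\<^esub>s\<in>?A. (k \<odot>\<^bsub>free_module K S\<^esub> f) s \<odot>\<^bsub>P\<^esub> g s)"
      by (rule free_lift_superset[OF assms(1) assms(2) F.smult_closed[OF k f] supp(1)[OF f] _ supp(2)[OF f]])
        (use k in \<open>auto simp: free_module_simps\<close>)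
    also have "\<dots> = (\<Oplus>\<^bsub>P\<^esub>s\<in>?A. k \<odot>\<^bsub>P\<^esub> (f s \<odot>\<^bsub>P\<^esub> g s))"
      by (rule P.finsum_cong') (use gA ev[OF f] k in \<open>auto simp: free_module_simps P.smult_assoc1\<close>)
    also have "\<dots> = k \<odot>\<^bsub>P\<^esub> free_lift K P g f"
      unfolding free_lift_def
      by (rule P.finsum_smult_ldistr[symmetric]) (use gA ev[OF f] k supp[OF f] in auto)
    finally show "free_lift K P g (k \<odot>\<^bsub>free_module K S\<^esub> f) = k \<odot>\<^bsub>P\<^esub> free_lift K P g f" .
  qed
qed

lemma free_lift_gen:
  assumes "module K P" "\<And>s. s \<in> S \<Longrightarrow> g s \<in> carrier P" "s \<in> S"
  shows "free_lift K P g (free_gen K s) = g s"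
proof -
  interpret P: module K P by fact
  have "free_lift K P g (free_gen K s) = (\<Oplus>\<^bsub>P\<^esub>t\<in>{s}. free_gen K s t \<odot>\<^bsub>P\<^esub> g t)"
    by (rule free_lift_superset[OF assms(1,2) free_gen_closed[OF P.is_cring assms(3)]])
      (use assms(3) in \<open>auto simp: free_gen_def\<close>)
  then show ?thesis using assms(2,3) by (simp add: free_gen_def)
qed

section \<open>The universal property of the tensor product\<close>

lemma tensor_relations_submodule:
  assumes "module K M" "module K N"
  shows "submodule (tensor_relations K M N) K (free_module K (carrier M \<times> carrier N))"
proof -
  interpret M: module K M by fact
  interpret N: module K N by fact
  interpret F: module K "free_module K (carrier M \<times> carrier N)"
    by (rule free_module_module[OF M.is_cring])
  have [simp]: "free_gen K (x, y) \<in> carrier (free_module K (carrier M \<times> carrier N))"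
    if "x \<in> carrier M" "y \<in> carrier N" for x y
    by (rule free_gen_closed[OF M.is_cring]) (use that in simp)
  show ?thesis
    unfolding tensor_relations_def Let_def
    by (rule module_span_submodule[OF F.module_axioms]) auto
qed

lemma tensor_relations_mem:
  assumes "module K M" "module K N"
  defines "F \<equiv> free_module K (carrier M \<times> carrier N)"
  shows "\<lbrakk>x \<in> carrier M; x' \<in> carrier M; y \<in> carrier N\<rbrakk> \<Longrightarrow>
      free_gen K (x \<oplus>\<^bsub>M\<^esub> x', y) \<ominus>\<^bsub>F\<^esub> (free_gen K (x, y) \<oplus>\<^bsub>F\<^esub> free_gen K (x', y)) \<in> tensor_relations K M N"
    and "\<lbrakk>x \<in> carrier M; y \<in> carrier N; y' \<in> carrier N\<rbrakk> \<Longrightarrow>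
      free_gen K (x, y \<oplus>\<^bsub>N\<^esub> y') \<ominus>\<^bsub>F\<^esub> (free_gen K (x, y) \<oplus>\<^bsub>F\<^esub> free_gen K (x, y')) \<in> tensor_relations K M N"
    and "\<lbrakk>k \<in> carrier K; x \<in> carrier M; y \<in> carrier N\<rbrakk> \<Longrightarrow>
      free_gen K (k \<odot>\<^bsub>M\<^esub> x, y) \<ominus>\<^bsub>F\<^esub> k \<odot>\<^bsub>F\<^esub> free_gen K (x, y) \<in> tensor_relations K M N"
    and "\<lbrakk>k \<in> carrier K; x \<in> carrier M; y \<in> carrier N\<rbrakk> \<Longrightarrow>
      free_gen K (x, k \<odot>\<^bsub>N\<^esub> y) \<ominus>\<^bsub>F\<^esub> k \<odot>\<^bsub>F\<^esub> free_gen K (x, y) \<in> tensor_relations K M N"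
  unfolding tensor_relations_def Let_def F_def
  by (rule module_span_superset[THEN subsetD], blast)+

lemma tensor_relations_least:
  assumes "submodule H K (free_module K (carrier M \<times> carrier N))"
  defines "F \<equiv> free_module K (carrier M \<times> carrier N)"
  assumes "\<And>x x' y. \<lbrakk>x \<in> carrier M; x' \<in> carrier M; y \<in> carrier N\<rbrakk> \<Longrightarrow>
      free_gen K (x \<oplus>\<^bsub>M\<^esub> x', y) \<ominus>\<^bsub>F\<^esub> (free_gen K (x, y) \<oplus>\<^bsub>F\<^esub> free_gen K (x', y)) \<in> H"
    and "\<And>x y y'. \<lbrakk>x \<in> carrier M; y \<in> carrier N; y' \<in> carrier N\<rbrakk> \<Longrightarrow>
      free_gen K (x, y \<oplus>\<^bsub>N\<^esub> y') \<ominus>\<^bsub>F\<^esub> (free_gen K (x, y) \<oplus>\<^bsub>F\<^esub> free_gen K (x, y')) \<in> H"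
    and "\<And>k x y. \<lbrakk>k \<in> carrier K; x \<in> carrier M; y \<in> carrier N\<rbrakk> \<Longrightarrow>
      free_gen K (k \<odot>\<^bsub>M\<^esub> x, y) \<ominus>\<^bsub>F\<^esub> k \<odot>\<^bsub>F\<^esub> free_gen K (x, y) \<in> H"
    and "\<And>k x y. \<lbrakk>k \<in> carrier K; x \<in> carrier M; y \<in> carrier N\<rbrakk> \<Longrightarrow>
      free_gen K (x, k \<odot>\<^bsub>N\<^esub> y) \<ominus>\<^bsub>F\<^esub> k \<odot>\<^bsub>F\<^esub> free_gen K (x, y) \<in> H"
  shows "tensor_relations K M N \<subseteq> H"
  unfolding tensor_relations_def Let_def
  by (rule module_span_least[OF assms(1)], intro Un_least subsetI)
    (use assms(3-) in \<open>auto simp: F_def\<close>)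

lemma tensor_module_module:
  assumes "module K M" "module K N"
  shows "module K (tensor_module K M N)"
  unfolding tensor_module_def
  by (rule quotient_module_module[OF free_module_module tensor_relations_submodule])
    (use assms in \<open>auto simp: module_def\<close>)

lemma pure_tensor_bilinear:
  assumes "module K M" "module K N"
  shows "bilinear_map K M N (tensor_module K M N) (pure_tensor K M N)"
proof -
  interpret M: module K M by fact
  interpret N: module K N by fact
  let ?F = "free_module K (carrier M \<times> carrier N)" and ?R = "tensor_relations K M N"
  interpret F: module K ?F by (rule free_module_module[OF M.is_cring])
  note sub = tensor_relations_submodule[OF assms]
  note proj = quotient_module_proj[OF F.module_axioms sub, folded tensor_module_def]
  note eqI = quotient_module_eqI[OF F.module_axioms sub]
  have gen [simp]: "free_gen K (x, y) \<in> carrier ?F" if "x \<in> carrier M" "y \<in> carrier N" for x y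
    by (rule free_gen_closed[OF M.is_cring]) (use that in simp)
  have cl: "pure_tensor K M N x y \<in> carrier (tensor_module K M N)"
    if "x \<in> carrier M" "y \<in> carrier N" for x y
    unfolding pure_tensor_def by (rule linear_maps_closed[OF proj(1)]) (use that in simp)
  show ?thesis
  proof (intro bilinear_mapI linear_mapsI)
    fix x y y' assume *: "x \<in> carrier M" "y \<in> carrier N" "y' \<in> carrier N"
    show "pure_tensor K M N x (y \<oplus>\<^bsub>N\<^esub> y')
        = pure_tensor K M N x y \<oplus>\<^bsub>tensor_module K M N\<^esub> pure_tensor K M N x y'"
      unfolding pure_tensor_def
      using eqI[OF _ _ tensor_relations_mem(2)[OF assms *]] * by (simp add: linear_maps_add[OF proj(1)])
  next
    fix x k y assume *: "k \<in> carrier K" "x \<in> carrier M" "y \<in> carrier N"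
    show "pure_tensor K M N x (k \<odot>\<^bsub>N\<^esub> y) = k \<odot>\<^bsub>tensor_module K M N\<^esub> pure_tensor K M N x y"
      unfolding pure_tensor_def
      using eqI[OF _ _ tensor_relations_mem(4)[OF assms *]] * by (simp add: linear_maps_smult[OF proj(1)])
    show "pure_tensor K M N (k \<odot>\<^bsub>M\<^esub> x) y = k \<odot>\<^bsub>tensor_module K M N\<^esub> pure_tensor K M N x y"
      unfolding pure_tensor_def
      using eqI[OF _ _ tensor_relations_mem(3)[OF assms *]] * by (simp add: linear_maps_smult[OF proj(1)])
  next
    fix y x x' assume *: "y \<in> carrier N" "x \<in> carrier M" "x' \<in> carrier M"
    show "pure_tensor K M N (x \<oplus>\<^bsub>M\<^esub> x') y
        = pure_tensor K M N x y \<oplus>\<^bsub>tensor_module K M N\<^esub> pure_tensor K M N x' y"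
      unfolding pure_tensor_def
      using eqI[OF _ _ tensor_relations_mem(1)[OF assms *(2,3,1)]] * by (simp add: linear_maps_add[OF proj(1)])
  qed (simp_all add: cl)
qed

text \<open>The projection from the free module is onto and sends generators to pure tensors, so
  \<open>free_module_induct\<close> descends. The scalar \<open>k\<close> in the step is a
  coefficient of the representative.\<close>

lemma tensor_induct [consumes 3, case_names zero add]:
  assumes "module K M" "module K N" "X \<in> carrier (tensor_module K M N)"
    and zero: "P \<zero>\<^bsub>tensor_module K M N\<^esub>"
    and add: "\<And>X k x y. \<lbrakk>X \<in> carrier (tensor_module K M N); P X; k \<in> carrier K; x \<in> carrier M; y \<in> carrier N\<rbrakk>
      \<Longrightarrow> P (X \<oplus>\<^bsub>tensor_module K M N\<^esub> (k \<odot>\<^bsub>tensor_module K M N\<^esub> pure_tensor K M N x y))"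
  shows "P X"
proof -
  interpret M: module K M by fact
  let ?F = "free_module K (carrier M \<times> carrier N)" and ?R = "tensor_relations K M N"
  interpret F: module K ?F by (rule free_module_module[OF M.is_cring])
  note sub = tensor_relations_submodule[OF assms(1,2)]
  note proj = quotient_module_proj[OF F.module_axioms sub, folded tensor_module_def]
  obtain f where f: "f \<in> carrier ?F" "X = ?R +>\<^bsub>?F\<^esub> f"
    using assms(3) proj(2) by blast
  have "P (?R +>\<^bsub>?F\<^esub> f)"
    using M.is_cring f(1)
  proof (induction f rule: free_module_induct)
    case zero
    then show ?case using assms(4) proj(3) by simp
  next
    case (add f k s)
    obtain x y where s: "s = (x, y)" by (cases s)
    have gen: "free_gen K s \<in> carrier ?F" by (rule free_gen_closed[OF M.is_cring add.hyps(3)])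
    have "?R +>\<^bsub>?F\<^esub> (f \<oplus>\<^bsub>?F\<^esub> k \<odot>\<^bsub>?F\<^esub> free_gen K s)
        = (?R +>\<^bsub>?F\<^esub> f) \<oplus>\<^bsub>tensor_module K M N\<^esub> (k \<odot>\<^bsub>tensor_module K M N\<^esub> pure_tensor K M N x y)"
      using add gen by (simp add: linear_maps_add[OF proj(1)] linear_maps_smult[OF proj(1)] pure_tensor_def s)
    then show ?case
      using assms(5)[OF linear_maps_closed[OF proj(1) add.hyps(1)] add.IH add.hyps(2), of x y] add.hyps(3)
      by (simp add: s)
  qed
  then show ?thesis using f(2) by simp
qed

text \<open>Pure tensors generate. This is the uniqueness half of the universal property;
  \<open>tensor_lift_linear\<close> and \<open>tensor_lift_pure\<close> form the existence
  half.\<close>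

lemma tensor_linear_eqI:
  assumes "module K M" "module K N" "module K P"
    and f: "f \<in> linear_maps K (tensor_module K M N) P" and g: "g \<in> linear_maps K (tensor_module K M N) P"
    and eq: "\<And>x y. \<lbrakk>x \<in> carrier M; y \<in> carrier N\<rbrakk> \<Longrightarrow> f (pure_tensor K M N x y) = g (pure_tensor K M N x y)"
    and X: "X \<in> carrier (tensor_module K M N)"
  shows "f X = g X"
proof -
  interpret T: module K "tensor_module K M N" by (rule tensor_module_module[OF assms(1,2)])
  note cl = bilinear_map_closed[OF pure_tensor_bilinear[OF assms(1,2)]]
  show ?thesis
    using assms(1,2) X
  proof (induction X rule: tensor_induct)
    case zero
    then show ?case
      by (simp add: linear_maps_zero[OF T.module_axioms assms(3) f] linear_maps_zero[OF T.module_axioms assms(3) g])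
  next
    case (add X k x y)
    then show ?case
      by (simp add: linear_maps_add[OF f] linear_maps_add[OF g] linear_maps_smult[OF f]
          linear_maps_smult[OF g] cl eq)
  qed
qed

text \<open>Bilinearity of \<open>b\<close> makes its linear extension to the free module vanish on
  the relations. The extension is then constant on each coset, so the representative chosen by
  \<open>SOME\<close> gives the same value as \<open>f\<close>.\<close>

lemma tensor_lift_coset:
  assumes "module K M" "module K N" "module K P" "bilinear_map K M N P b"
    and f: "f \<in> carrier (free_module K (carrier M \<times> carrier N))"
  shows "tensor_lift K P b (tensor_relations K M N +>\<^bsub>free_module K (carrier M \<times> carrier N)\<^esub> f)
    = free_lift K P (\<lambda>p. b (fst p) (snd p)) f"
proof -
  interpret M: module K M by fact
  interpret N: module K N by fact
  interpret P: module K P by fact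
  let ?S = "carrier M \<times> carrier N"
  let ?F = "free_module K ?S" and ?R = "tensor_relations K M N"
  let ?L = "free_lift K P (\<lambda>p. b (fst p) (snd p))"
  interpret F: module K ?F by (rule free_module_module[OF M.is_cring])
  note sub = tensor_relations_submodule[OF assms(1,2)]
  have bcl: "b (fst p) (snd p) \<in> carrier P" if "p \<in> ?S" for p
    using that bilinear_map_closed[OF assms(4)] by auto
  note lin = free_lift_linear[OF assms(3) bcl]
  have gen [simp]: "free_gen K (x, y) \<in> carrier ?F" if "x \<in> carrier M" "y \<in> carrier N" for x y
    by (rule free_gen_closed[OF M.is_cring]) (use that in simp)
  have Lgen [simp]: "?L (free_gen K (x, y)) = b x y" if "x \<in> carrier M" "y \<in> carrier N" for x y
    by (subst free_lift_gen[OF assms(3) bcl]) (use that in auto)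
  note [simp] = linear_maps_add[OF lin] linear_maps_smult[OF lin]
    linear_maps_uminus[OF F.module_axioms assms(3) lin] bilinear_map_closed[OF assms(4)]
    linear_maps_add[OF bilinear_map_right[OF assms(4)]] linear_maps_smult[OF bilinear_map_right[OF assms(4)]]
    linear_maps_add[OF bilinear_map_left[OF assms(4)]] linear_maps_smult[OF bilinear_map_left[OF assms(4)]]
  \<comment> \<open>The kernel is a submodule, as the preimage of the zero submodule, so only the
    four families of generating relations have to be checked.\<close>
  have ker: "?R \<subseteq> {g \<in> carrier ?F. ?L g \<in> {\<zero>\<^bsub>P\<^esub>}}"
    by (rule tensor_relations_least[OF preimage_submodule[OF F.module_axioms assms(3) lin zero_submodule[OF assms(3)]]])
      (simp_all add: a_minus_def P.r_neg)
  have L: "?L g = ?L f" if g: "g \<in> ?R +>\<^bsub>?F\<^esub> f" for g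
  proof -
    obtain r where r: "r \<in> ?R" "g = r \<oplus>\<^bsub>?F\<^esub> f"
      using g unfolding a_r_coset_def' by auto
    then show ?thesis
      using ker f linear_maps_closed[OF lin f] by auto
  qed
  have "\<zero>\<^bsub>?F\<^esub> \<in> ?R"
    using subgroup.one_closed[OF submodule.axioms(1)[OF sub]] by simp
  \<comment> \<open>Nonemptiness of the coset, without which \<open>SOME\<close> would say nothing
    about its choice.\<close>
  then have "\<zero>\<^bsub>?F\<^esub> \<oplus>\<^bsub>?F\<^esub> f \<in> ?R +>\<^bsub>?F\<^esub> f"
    unfolding a_r_coset_def' by blast
  then have "(SOME g. g \<in> ?R +>\<^bsub>?F\<^esub> f) \<in> ?R +>\<^bsub>?F\<^esub> f"
    by (rule someI[of "\<lambda>g. g \<in> ?R +>\<^bsub>?F\<^esub> f"])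
  from L[OF this] show ?thesis
    unfolding tensor_lift_def Let_def free_lift_def by simp
qed

lemma tensor_lift_linear:
  assumes "module K M" "module K N" "module K P" "bilinear_map K M N P b"
  shows "tensor_lift K P b \<in> linear_maps K (tensor_module K M N) P"
proof -
  interpret M: module K M by fact
  interpret P: module K P by fact
  let ?S = "carrier M \<times> carrier N"
  let ?F = "free_module K ?S" and ?R = "tensor_relations K M N"
  interpret F: module K ?F by (rule free_module_module[OF M.is_cring])
  note sub = tensor_relations_submodule[OF assms(1,2)]
  note proj = quotient_module_proj[OF F.module_axioms sub, folded tensor_module_def]
  have bcl: "b (fst p) (snd p) \<in> carrier P" if "p \<in> ?S" for p
    using that bilinear_map_closed[OF assms(4)] by auto
  note lin = free_lift_linear[OF assms(3) bcl]
  have ex: "\<exists>f\<in>carrier ?F. X = ?R +>\<^bsub>?F\<^esub> f" if "X \<in> carrier (tensor_module K M N)" for X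
    using that proj(2) by blast
  show ?thesis
    by (rule linear_mapsI)
      (auto dest!: ex simp: linear_maps_add[OF proj(1), symmetric] linear_maps_smult[OF proj(1), symmetric]
        tensor_lift_coset[OF assms] linear_maps_add[OF lin] linear_maps_smult[OF lin] linear_maps_closed[OF lin])
qed

lemma tensor_lift_pure:
  assumes "module K M" "module K N" "module K P" "bilinear_map K M N P b"
    and "x \<in> carrier M" "y \<in> carrier N"
  shows "tensor_lift K P b (pure_tensor K M N x y) = b x y"
proof -
  interpret M: module K M by fact
  have bcl: "b (fst p) (snd p) \<in> carrier P" if "p \<in> carrier M \<times> carrier N" for p
    using that bilinear_map_closed[OF assms(4)] by auto
  have "free_gen K (x, y) \<in> carrier (free_module K (carrier M \<times> carrier N))"
    by (rule free_gen_closed[OF M.is_cring]) (use assms(5,6) in simp)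
  from tensor_lift_coset[OF assms(1-4) this] show ?thesis
    unfolding pure_tensor_def by (subst (asm) free_lift_gen[OF assms(3) bcl]) (use assms(5,6) in auto)
qed

section \<open>Gradings and extension from homogeneous elements\<close>

context gr_module
begin

lemma grade_closed: "x \<in> grade M n \<Longrightarrow> x \<in> carrier M"
  using submoduleE(1)[OF grade_submodule] by blast

lemma grade_zero: "\<zero>\<^bsub>M\<^esub> \<in> grade M n"
  using subgroup.one_closed[OF submodule.axioms(1)[OF grade_submodule]] by simp

lemma grade_add: "\<lbrakk>x \<in> grade M n; y \<in> grade M n\<rbrakk> \<Longrightarrow> x \<oplus>\<^bsub>M\<^esub> y \<in> grade M n"
  by (rule submoduleE(5)[OF grade_submodule])

lemma grade_smult: "\<lbrakk>k \<in> carrier K; x \<in> grade M n\<rbrakk> \<Longrightarrow> k \<odot>\<^bsub>M\<^esub> x \<in> grade M n"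
  by (rule submoduleE(4)[OF grade_submodule])

lemma grade_uminus: "x \<in> grade M n \<Longrightarrow> \<ominus>\<^bsub>M\<^esub> x \<in> grade M n"
  by (rule submoduleE(3)[OF grade_submodule])

lemma grade_sgn_pow: "x \<in> grade M n \<Longrightarrow> sgn_pow M k x \<in> grade M n"
  by (simp add: sgn_pow_def grade_uminus)

text \<open>\<open>decomposes\<close> sums over the exact support. Allowing any finite
  \<open>S\<close> outside which \<open>c\<close> vanishes absorbs the cancellations that occur when
  decompositions are added, scaled or projected.\<close>

lemma decomposesI:
  assumes "finite S" "\<And>i. c i \<in> grade M i" "\<And>i. i \<notin> S \<Longrightarrow> c i = \<zero>\<^bsub>M\<^esub>" "x = (\<Oplus>\<^bsub>M\<^esub>i\<in>S. c i)"
  shows "decomposes M x c"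
proof -
  have sub: "{n. c n \<noteq> \<zero>\<^bsub>M\<^esub>} \<subseteq> S" using assms(3) by blast
  have cl: "c i \<in> carrier M" for i by (rule grade_closed[OF assms(2)])
  have "(\<Oplus>\<^bsub>M\<^esub>n\<in>{n. c n \<noteq> \<zero>\<^bsub>M\<^esub>}. c n) = (\<Oplus>\<^bsub>M\<^esub>i\<in>S. c i)"
    by (rule M.add.finprod_mono_neutral_cong_left) (use assms(1) sub cl in auto)
  then show ?thesis
    unfolding decomposes_def using assms finite_subset[OF sub] by simp
qed

lemma component_decomposes: "x \<in> carrier M \<Longrightarrow> decomposes M x (gr_component M x)"
  unfolding gr_component_def by (rule theI'[OF direct_sum])

lemma component_unique: "\<lbrakk>decomposes M x c; x \<in> carrier M\<rbrakk> \<Longrightarrow> gr_component M x = c"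
  using direct_sum component_decomposes by blast

lemma component_grade: "x \<in> carrier M \<Longrightarrow> gr_component M x i \<in> grade M i"
  using component_decomposes unfolding decomposes_def by blast

lemma component_finite: "x \<in> carrier M \<Longrightarrow> finite {i. gr_component M x i \<noteq> \<zero>\<^bsub>M\<^esub>}"
  using component_decomposes unfolding decomposes_def by blast

lemma component_sum:
  assumes "x \<in> carrier M" "finite S" "{i. gr_component M x i \<noteq> \<zero>\<^bsub>M\<^esub>} \<subseteq> S"
  shows "(\<Oplus>\<^bsub>M\<^esub>i\<in>S. gr_component M x i) = x"
proof -
  have "(\<Oplus>\<^bsub>M\<^esub>i\<in>{i. gr_component M x i \<noteq> \<zero>\<^bsub>M\<^esub>}. gr_component M x i) = (\<Oplus>\<^bsub>M\<^esub>i\<in>S. gr_component M x i)"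
    by (rule M.add.finprod_mono_neutral_cong_left)
      (use assms component_grade[OF assms(1)] grade_closed in auto)
  then show ?thesis
    using component_decomposes[OF assms(1)] unfolding decomposes_def by simp
qed

lemma component_homogeneous:
  assumes "x \<in> grade M n"
  shows "gr_component M x = (\<lambda>i. if i = n then x else \<zero>\<^bsub>M\<^esub>)"
proof (rule component_unique)
  show "decomposes M x (\<lambda>i. if i = n then x else \<zero>\<^bsub>M\<^esub>)"
    by (rule decomposesI[of "{n}"]) (use assms grade_closed in \<open>auto simp: grade_zero\<close>)
qed (rule grade_closed[OF assms])

text \<open>Adding the two decompositions entrywise gives a decomposition of the sum, and directness
  of the sum makes it the only one. Scalar multiples work in the same way.\<close>

lemma component_add:
  assumes x: "x \<in> carrier M" and y: "y \<in> carrier M"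
  shows "gr_component M (x \<oplus>\<^bsub>M\<^esub> y) = (\<lambda>i. gr_component M x i \<oplus>\<^bsub>M\<^esub> gr_component M y i)"
proof (rule component_unique)
  let ?S = "{i. gr_component M x i \<noteq> \<zero>\<^bsub>M\<^esub>} \<union> {i. gr_component M y i \<noteq> \<zero>\<^bsub>M\<^esub>}"
  have fin: "finite ?S" using component_finite x y by simp
  show "decomposes M (x \<oplus>\<^bsub>M\<^esub> y) (\<lambda>i. gr_component M x i \<oplus>\<^bsub>M\<^esub> gr_component M y i)"
  proof (rule decomposesI[OF fin])
    have "(\<Oplus>\<^bsub>M\<^esub>i\<in>?S. gr_component M x i \<oplus>\<^bsub>M\<^esub> gr_component M y i)
        = (\<Oplus>\<^bsub>M\<^esub>i\<in>?S. gr_component M x i) \<oplus>\<^bsub>M\<^esub> (\<Oplus>\<^bsub>M\<^esub>i\<in>?S. gr_component M y i)"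
      by (rule M.finsum_addf) (use component_grade x y grade_closed in blast)+
    also have "\<dots> = x \<oplus>\<^bsub>M\<^esub> y"
      using component_sum[OF x fin] component_sum[OF y fin] by simp
    finally show "x \<oplus>\<^bsub>M\<^esub> y = (\<Oplus>\<^bsub>M\<^esub>i\<in>?S. gr_component M x i \<oplus>\<^bsub>M\<^esub> gr_component M y i)" by simp
  qed (use x y in \<open>auto simp: grade_add component_grade\<close>)
qed (use x y in simp)

lemma component_smult:
  assumes k: "k \<in> carrier K" and x: "x \<in> carrier M"
  shows "gr_component M (k \<odot>\<^bsub>M\<^esub> x) = (\<lambda>i. k \<odot>\<^bsub>M\<^esub> gr_component M x i)"
proof (rule component_unique)
  let ?S = "{i. gr_component M x i \<noteq> \<zero>\<^bsub>M\<^esub>}"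
  have fin: "finite ?S" using component_finite x by simp
  show "decomposes M (k \<odot>\<^bsub>M\<^esub> x) (\<lambda>i. k \<odot>\<^bsub>M\<^esub> gr_component M x i)"
  proof (rule decomposesI[OF fin])
    have "(\<Oplus>\<^bsub>M\<^esub>i\<in>?S. k \<odot>\<^bsub>M\<^esub> gr_component M x i) = k \<odot>\<^bsub>M\<^esub> (\<Oplus>\<^bsub>M\<^esub>i\<in>?S. gr_component M x i)"
      by (rule finsum_smult_ldistr[symmetric, OF fin k]) (use component_grade x grade_closed in blast)
    then show "k \<odot>\<^bsub>M\<^esub> x = (\<Oplus>\<^bsub>M\<^esub>i\<in>?S. k \<odot>\<^bsub>M\<^esub> gr_component M x i)"
      using component_sum[OF x fin] by simp
  qed (use k x in \<open>auto simp: grade_smult component_grade\<close>)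
qed (use k x in simp)

lemma homogeneous_induct [consumes 1, case_names zero add homogeneous]:
  assumes x: "x \<in> carrier M"
    and "P \<zero>\<^bsub>M\<^esub>"
    and "\<And>x y. \<lbrakk>x \<in> carrier M; y \<in> carrier M; P x; P y\<rbrakk> \<Longrightarrow> P (x \<oplus>\<^bsub>M\<^esub> y)"
    and "\<And>n x. x \<in> grade M n \<Longrightarrow> P x"
  shows "P x"
proof -
  have "P (\<Oplus>\<^bsub>M\<^esub>i\<in>S. gr_component M x i)" if "finite S" for S
    using that
  proof (induction S rule: finite_induct)
    case empty
    then show ?case using assms(2) by simp
  next
    case (insert i S)
    have cl: "gr_component M x \<in> S \<rightarrow> carrier M" "gr_component M x i \<in> carrier M"
      using component_grade[OF x] grade_closed by blast+
    then have "P (gr_component M x i \<oplus>\<^bsub>M\<^esub> (\<Oplus>\<^bsub>M\<^esub>i\<in>S. gr_component M x i))"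
      using insert.IH assms(4)[OF component_grade[OF x]] by (intro assms(3)) auto
    then show ?case
      using insert cl by simp
  qed
  from this[OF component_finite[OF x]] show ?thesis
    using component_sum[OF x component_finite[OF x]] by simp
qed

lemma linear_eq_on_grades:
  assumes "module K N" and f: "f \<in> linear_maps K M N" and g: "g \<in> linear_maps K M N"
    and eq: "\<And>n x. x \<in> grade M n \<Longrightarrow> f x = g x"
    and x: "x \<in> carrier M"
  shows "f x = g x"
  using x
proof (induction x rule: homogeneous_induct)
  case zero
  then show ?case
    by (simp add: linear_maps_zero[OF module_axioms assms(1) f] linear_maps_zero[OF module_axioms assms(1) g])
qed (simp_all add: linear_maps_add[OF f] linear_maps_add[OF g] eq)

text \<open>Each \<open>f i\<close> is used on elements of degree \<open>i\<close> only, but its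
  linearity makes it vanish at zero. That is what allows the index set to grow beyond the support of
  \<open>x\<close>.\<close>

lemma linear_ext_superset:
  assumes "module K P" "\<And>i. f i \<in> linear_maps K M P" "x \<in> carrier M"
    and "finite S" "{i. gr_component M x i \<noteq> \<zero>\<^bsub>M\<^esub>} \<subseteq> S"
  shows "linear_ext M P f x = (\<Oplus>\<^bsub>P\<^esub>i\<in>S. f i (gr_component M x i))"
proof -
  interpret P: module K P by fact
  have "f i (gr_component M x i) \<in> carrier P" for i
    by (rule linear_maps_closed[OF assms(2) grade_closed[OF component_grade[OF assms(3)]]])
  then show ?thesis
    unfolding linear_ext_def
    by (intro P.add.finprod_mono_neutral_cong_left)
      (use assms(4,5) in \<open>auto simp: linear_maps_zero[OF module_axioms assms(1,2)]\<close>)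
qed

lemma linear_ext_linear:
  assumes "module K P" "\<And>i. f i \<in> linear_maps K M P"
  shows "linear_ext M P f \<in> linear_maps K M P"
proof -
  interpret P: module K P by fact
  note sup = linear_ext_superset[OF assms]
  have comp: "gr_component M x i \<in> carrier M" if "x \<in> carrier M" for x i
    by (rule grade_closed[OF component_grade[OF that]])
  have cl: "f i (gr_component M x i) \<in> carrier P" if "x \<in> carrier M" for x i
    by (rule linear_maps_closed[OF assms(2) comp[OF that]])
  show ?thesis
  proof (rule linear_mapsI)
    fix x assume "x \<in> carrier M"
    then show "linear_ext M P f x \<in> carrier P"
      unfolding linear_ext_def by (intro P.finsum_closed) (use cl in auto)
  next
    fix x y assume x: "x \<in> carrier M" and y: "y \<in> carrier M"
    let ?S = "{i. gr_component M x i \<noteq> \<zero>\<^bsub>M\<^esub>} \<union> {i. gr_component M y i \<noteq> \<zero>\<^bsub>M\<^esub>}"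
    have fin: "finite ?S" using component_finite x y by simp
    have "linear_ext M P f (x \<oplus>\<^bsub>M\<^esub> y) = (\<Oplus>\<^bsub>P\<^esub>i\<in>?S. f i (gr_component M (x \<oplus>\<^bsub>M\<^esub> y) i))"
      by (rule sup[OF _ fin]) (use x y in \<open>auto simp: component_add\<close>)
    also have "\<dots> = (\<Oplus>\<^bsub>P\<^esub>i\<in>?S. f i (gr_component M x i) \<oplus>\<^bsub>P\<^esub> f i (gr_component M y i))"
      by (rule P.finsum_cong')
        (use x y cl in \<open>auto simp: component_add linear_maps_add[OF assms(2)] comp\<close>)
    also have "\<dots> = (\<Oplus>\<^bsub>P\<^esub>i\<in>?S. f i (gr_component M x i)) \<oplus>\<^bsub>P\<^esub> (\<Oplus>\<^bsub>P\<^esub>i\<in>?S. f i (gr_component M y i))"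
      by (rule P.finsum_addf) (use x y cl in auto)
    also have "\<dots> = linear_ext M P f x \<oplus>\<^bsub>P\<^esub> linear_ext M P f y"
      using sup[OF x fin] sup[OF y fin] by simp
    finally show "linear_ext M P f (x \<oplus>\<^bsub>M\<^esub> y) = linear_ext M P f x \<oplus>\<^bsub>P\<^esub> linear_ext M P f y" .
  next
    fix k x assume k: "k \<in> carrier K" and x: "x \<in> carrier M"
    let ?S = "{i. gr_component M x i \<noteq> \<zero>\<^bsub>M\<^esub>}"
    have fin: "finite ?S" using component_finite x by simp
    have "linear_ext M P f (k \<odot>\<^bsub>M\<^esub> x) = (\<Oplus>\<^bsub>P\<^esub>i\<in>?S. f i (gr_component M (k \<odot>\<^bsub>M\<^esub> x) i))"
      by (rule sup[OF _ fin]) (use k x in \<open>auto simp: component_smult\<close>)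
    also have "\<dots> = (\<Oplus>\<^bsub>P\<^esub>i\<in>?S. k \<odot>\<^bsub>P\<^esub> f i (gr_component M x i))"
      by (rule P.finsum_cong')
        (use k x cl in \<open>auto simp: component_smult linear_maps_smult[OF assms(2)] comp\<close>)
    also have "\<dots> = k \<odot>\<^bsub>P\<^esub> linear_ext M P f x"
      unfolding linear_ext_def by (rule P.finsum_smult_ldistr[symmetric, OF fin k]) (use x cl in auto)
    finally show "linear_ext M P f (k \<odot>\<^bsub>M\<^esub> x) = k \<odot>\<^bsub>P\<^esub> linear_ext M P f x" .
  qed
qed

lemma linear_ext_homogeneous:
  assumes "module K P" "\<And>i. f i \<in> linear_maps K M P" "x \<in> grade M n"
  shows "linear_ext M P f x = f n x"
proof -
  interpret P: module K P by fact
  have "linear_ext M P f x = (\<Oplus>\<^bsub>P\<^esub>i\<in>{n}. f i (gr_component M x i))"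
    by (rule linear_ext_superset[OF assms(1,2) grade_closed[OF assms(3)]])
      (auto simp: component_homogeneous[OF assms(3)])
  then show ?thesis
    using linear_maps_closed[OF assms(2) grade_closed[OF assms(3)]]
    by (simp add: component_homogeneous[OF assms(3)])
qed

text \<open>The index set and the components depend on \<open>x\<close> alone. With \<open>x\<close>
  fixed, the extension is a fixed sum of maps that are linear in the parameter.\<close>

lemma linear_ext_parameter:
  assumes "module K P" "\<And>i x. x \<in> carrier M \<Longrightarrow> (\<lambda>y. f y i x) \<in> linear_maps K N P"
    and "x \<in> carrier M"
  shows "(\<lambda>y. linear_ext M P (f y) x) \<in> linear_maps K N P"
  unfolding linear_ext_def
  by (rule linear_maps_finsum_const[OF assms(1)], rule assms(2),
      rule grade_closed[OF component_grade[OF assms(3)]])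

end

section \<open>Bilinear extension and operations on bilinear maps\<close>

lemma bilinear_ext_bilinear:
  assumes "gr_module K M" "gr_module K N" "module K P" "\<And>i j. bilinear_map K M N P (f i j)"
  shows "bilinear_map K M N P (bilinear_ext M N P f)"
proof -
  interpret M: gr_module K M by fact
  interpret N: gr_module K N by fact
  have r: "linear_ext N P (\<lambda>j. f i j x) \<in> linear_maps K N P" if "x \<in> carrier M" for i x
    by (rule N.linear_ext_linear[OF assms(3) bilinear_map_right[OF assms(4) that]])
  have l: "(\<lambda>x. linear_ext N P (\<lambda>j. f i j x) y) \<in> linear_maps K M P" if "y \<in> carrier N" for i y
    by (rule N.linear_ext_parameter[OF assms(3) bilinear_map_left[OF assms(4)] that])
  show ?thesis
  proof (rule bilinear_mapI)
    fix x assume x: "x \<in> carrier M"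
    show "bilinear_ext M N P f x \<in> linear_maps K N P"
      using M.linear_ext_parameter[OF assms(3) r x] unfolding bilinear_ext_def by simp
  next
    fix y assume y: "y \<in> carrier N"
    show "(\<lambda>x. bilinear_ext M N P f x y) \<in> linear_maps K M P"
      using M.linear_ext_linear[OF assms(3) l[OF y]] unfolding bilinear_ext_def by simp
  qed
qed

lemma bilinear_ext_homogeneous:
  assumes "gr_module K M" "gr_module K N" "module K P" "\<And>i j. bilinear_map K M N P (f i j)"
    and "x \<in> grade M i" "y \<in> grade N j"
  shows "bilinear_ext M N P f x y = f i j x y"
proof -
  interpret M: gr_module K M by fact
  interpret N: gr_module K N by fact
  have y: "y \<in> carrier N" by (rule N.grade_closed[OF assms(6)])
  have "bilinear_ext M N P f x y = linear_ext N P (\<lambda>j. f i j x) y"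
    unfolding bilinear_ext_def
    by (rule M.linear_ext_homogeneous[OF assms(3) N.linear_ext_parameter[OF assms(3) bilinear_map_left[OF assms(4)] y] assms(5)])
  also have "\<dots> = f i j x y"
    by (rule N.linear_ext_homogeneous[OF assms(3) bilinear_map_right[OF assms(4) M.grade_closed[OF assms(5)]] assms(6)])
  finally show ?thesis .
qed

lemma bilinear_map_sgn_pow:
  assumes "module K P" "bilinear_map K M N P b"
  shows "bilinear_map K M N P (\<lambda>x y. sgn_pow P n (b x y))"
  by (rule bilinear_mapI)
    (rule linear_maps_sgn_pow_const[OF assms(1)],
      erule bilinear_map_right[OF assms(2)] bilinear_map_left[OF assms(2)])+

lemma bilinear_map_plus:
  assumes "module K P" "bilinear_map K M N P b" "bilinear_map K M N P b'"
  shows "bilinear_map K M N P (\<lambda>x y. b x y \<oplus>\<^bsub>P\<^esub> b' x y)"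
  by (intro bilinear_mapI linear_maps_plus[OF assms(1)] bilinear_map_right[OF assms(2)]
      bilinear_map_right[OF assms(3)] bilinear_map_left[OF assms(2)] bilinear_map_left[OF assms(3)])

lemma bilinear_map_comp:
  assumes "bilinear_map K M' N' P b" "f \<in> linear_maps K M M'" "g \<in> linear_maps K N N'"
  shows "bilinear_map K M N P (\<lambda>x y. b (f x) (g y))"
  by (intro bilinear_mapI linear_maps_comp[OF assms(2) bilinear_map_left[OF assms(1)]]
      linear_maps_comp[OF assms(3) bilinear_map_right[OF assms(1)]]
      linear_maps_closed[OF assms(2)] linear_maps_closed[OF assms(3)])

lemma linear_maps_id: "(\<lambda>x. x) \<in> linear_maps K M M"
  by (rule linear_mapsI) simp_all

lemma bilinear_map_post_comp:
  assumes "bilinear_map K M N P b" "f \<in> linear_maps K P Q"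
  shows "bilinear_map K M N Q (\<lambda>x y. f (b x y))"
  by (intro bilinear_mapI linear_maps_comp[OF _ assms(2)] bilinear_map_left[OF assms(1)]
      bilinear_map_right[OF assms(1)])

section \<open>Signs\<close>

lemma sgn_pow_sgn_pow:
  assumes "module K P" "x \<in> carrier P"
  shows "sgn_pow P i (sgn_pow P j x) = sgn_pow P (i + j) x"
proof -
  interpret P: module K P by fact
  show ?thesis using assms(2) by (simp add: sgn_pow_def)
qed

lemma sgn_pow_closed:
  assumes "module K P" "x \<in> carrier P"
  shows "sgn_pow P i x \<in> carrier P"
proof -
  interpret P: module K P by fact
  show ?thesis using assms(2) by (simp add: sgn_pow_def)
qed

text \<open>The sign comparisons for the right action end here, as parity checks on integer
  exponents.\<close>

lemma sgn_pow_cong: "even i = even j \<Longrightarrow> sgn_pow P i x = sgn_pow P j x"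
  by (simp add: sgn_pow_def)

lemma sgn_pow_linear:
  assumes "module K P"
  shows "sgn_pow P i \<in> linear_maps K P P"
  using linear_maps_sgn_pow_const[OF assms linear_maps_id, of i] by simp

section \<open>The dg structure of tensor products\<close>

text \<open>\<open>tensor\<close> and \<open>tensor_module\<close> are records of different types
  with the same module structure. These equations, with \<open>linear_maps_tensor\<close>, carry the
  universal property from one to the other.\<close>

lemma tensor_simps:
  "carrier (tensor K M N) = carrier (tensor_module K M N)"
  "zero (tensor K M N) = zero (tensor_module K M N)"
  "add (tensor K M N) = add (tensor_module K M N)"
  "smult (tensor K M N) = smult (tensor_module K M N)"
  by (simp_all add: tensor_def Let_def add_dif_def add_grading_def)

lemma linear_maps_tensor:
  "linear_maps K (tensor K M N) P = linear_maps K (tensor_module K M N) P"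
  "linear_maps K P (tensor K M N) = linear_maps K P (tensor_module K M N)"
  by (simp_all add: linear_maps_def tensor_simps)

lemma bilinear_map_tensor: "bilinear_map K P Q (tensor K M N) = bilinear_map K P Q (tensor_module K M N)"
  by (simp add: fun_eq_iff bilinear_map_def linear_maps_tensor)

lemma tensor_is_module:
  assumes "module K M" "module K N"
  shows "module K (tensor K M N)"
  by (rule module_surj_image[OF tensor_module_module[OF assms], where f = "\<lambda>x. x"])
    (simp_all add: linear_maps_tensor linear_maps_id tensor_simps)

text \<open>The sign in the differential depends on the degree of \<open>x\<close> only, so the
  formula is extended from homogeneous \<open>x\<close> while \<open>y\<close> stays arbitrary.
  Linearity in \<open>y\<close> is then the parameter case of \<open>linear_ext\<close>.\<close>

lemma tensor_dif_bilinear: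
  assumes "dg_module K M" "dg_module K N"
  defines "P \<equiv> tensor_module K M N" and "pt \<equiv> pure_tensor K M N"
  shows "\<And>y i. y \<in> carrier N \<Longrightarrow>
      (\<lambda>x. pt (dif M x) y \<oplus>\<^bsub>P\<^esub> sgn_pow P i (pt x (dif N y))) \<in> linear_maps K M P"
    and "bilinear_map K M N P (\<lambda>x y.
      linear_ext M P (\<lambda>i x'. pt (dif M x') y \<oplus>\<^bsub>P\<^esub> sgn_pow P i (pt x' (dif N y))) x)"
proof -
  interpret M: dg_module K M by fact
  interpret N: dg_module K N by fact
  have P: "module K P"
    unfolding P_def by (rule tensor_module_module[OF M.module_axioms N.module_axioms])
  have pt: "bilinear_map K M N P pt"
    unfolding P_def pt_def by (rule pure_tensor_bilinear[OF M.module_axioms N.module_axioms])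
  have b: "bilinear_map K M N P (\<lambda>x y. pt (dif M x) y \<oplus>\<^bsub>P\<^esub> sgn_pow P i (pt x (dif N y)))" for i
    by (intro bilinear_map_plus[OF P] bilinear_map_sgn_pow[OF P]
        bilinear_map_comp[OF pt M.dif_linear linear_maps_id] bilinear_map_comp[OF pt linear_maps_id N.dif_linear])
  show "(\<lambda>x. pt (dif M x) y \<oplus>\<^bsub>P\<^esub> sgn_pow P i (pt x (dif N y))) \<in> linear_maps K M P"
    if "y \<in> carrier N" for y i
    by (rule bilinear_map_left[OF b that])
  show "bilinear_map K M N P (\<lambda>x y.
      linear_ext M P (\<lambda>i x'. pt (dif M x') y \<oplus>\<^bsub>P\<^esub> sgn_pow P i (pt x' (dif N y))) x)"
    by (rule bilinear_mapI)
      (use M.linear_ext_parameter[OF P bilinear_map_right[OF b]]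
        M.linear_ext_linear[OF P bilinear_map_left[OF b]] in auto)
qed

lemma tensor_dif_linear:
  assumes "dg_module K M" "dg_module K N"
  shows "dif (tensor K M N) \<in> linear_maps K (tensor_module K M N) (tensor_module K M N)"
proof -
  interpret M: dg_module K M by fact
  interpret N: dg_module K N by fact
  show ?thesis
    using tensor_lift_linear[OF M.module_axioms N.module_axioms
        tensor_module_module[OF M.module_axioms N.module_axioms] tensor_dif_bilinear(2)[OF assms]]
    by (simp add: tensor_def Let_def add_dif_def add_grading_def)
qed

lemma tensor_dif_pure:
  assumes "dg_module K M" "dg_module K N" "x \<in> grade M i" "y \<in> carrier N"
  shows "dif (tensor K M N) (pure_tensor K M N x y) =
    pure_tensor K M N (dif M x) y \<oplus>\<^bsub>tensor_module K M N\<^esub>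
      sgn_pow (tensor_module K M N) i (pure_tensor K M N x (dif N y))"
proof -
  interpret M: dg_module K M by fact
  interpret N: dg_module K N by fact
  note P = tensor_module_module[OF M.module_axioms N.module_axioms]
  have "dif (tensor K M N) (pure_tensor K M N x y) = linear_ext M (tensor_module K M N)
      (\<lambda>i x'. pure_tensor K M N (dif M x') y \<oplus>\<^bsub>tensor_module K M N\<^esub>
        sgn_pow (tensor_module K M N) i (pure_tensor K M N x' (dif N y))) x"
    using tensor_lift_pure[OF M.module_axioms N.module_axioms P tensor_dif_bilinear(2)[OF assms(1,2)]
        M.grade_closed[OF assms(3)] assms(4)]
    by (simp add: tensor_def Let_def add_dif_def add_grading_def)
  then show ?thesis
    using M.linear_ext_homogeneous[OF P tensor_dif_bilinear(1)[OF assms(1,2,4)] assms(3)] by simp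
qed

lemma tensor_grade:
  "grade (tensor K M N) n = module_span K (tensor_module K M N)
    {pure_tensor K M N x y | x y i j. x \<in> grade M i \<and> y \<in> grade N j \<and> i + j = n}"
  by (simp add: tensor_def Let_def add_dif_def add_grading_def)

lemma tensor_grade_pure:
  assumes "x \<in> grade M i" "y \<in> grade N j"
  shows "pure_tensor K M N x y \<in> grade (tensor K M N) (i + j)"
  unfolding tensor_grade by (rule module_span_superset[THEN subsetD]) (use assms in blast)

lemma dg_morphism_tensor_lift:
  assumes "dg_module K M" "dg_module K N" "dg_module K P" and b: "bilinear_map K M N P b"
    and deg: "\<And>x y i j. \<lbrakk>x \<in> grade M i; y \<in> grade N j\<rbrakk> \<Longrightarrow> b x y \<in> grade P (i + j)"
    and leibniz: "\<And>x y i j. \<lbrakk>x \<in> grade M i; y \<in> grade N j\<rbrakk> \<Longrightarrow>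
      dif P (b x y) = b (dif M x) y \<oplus>\<^bsub>P\<^esub> sgn_pow P i (b x (dif N y))"
  shows "dg_morphism K (tensor K M N) P (tensor_lift K P b)"
proof -
  interpret M: dg_module K M by fact
  interpret N: dg_module K N by fact
  interpret P: dg_module K P by fact
  note mods = M.module_axioms N.module_axioms
  interpret T: module K "tensor_module K M N" by (rule tensor_module_module[OF mods])
  note lin = tensor_lift_linear[OF mods P.module_axioms b]
  note pure = tensor_lift_pure[OF mods P.module_axioms b]
  note cl = bilinear_map_closed[OF pure_tensor_bilinear[OF mods]]
  have "tensor_lift K P b X \<in> grade P n" if "X \<in> grade (tensor K M N) n" for X n
  proof -
    \<comment> \<open>The tensors sent into degree n form a submodule, and degree n of the tensor
      product is spanned by homogeneous pure tensors.\<close>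
    have "grade (tensor K M N) n \<subseteq> {X \<in> carrier (tensor_module K M N). tensor_lift K P b X \<in> grade P n}"
      unfolding tensor_grade
      by (rule module_span_least[OF preimage_submodule[OF T.module_axioms P.module_axioms lin P.grade_submodule]])
        (auto simp: pure M.grade_closed N.grade_closed cl intro: deg)
    then show ?thesis using that by blast
  qed
  moreover have "tensor_lift K P b (dif (tensor K M N) X) = dif P (tensor_lift K P b X)"
    if "X \<in> carrier (tensor_module K M N)" for X
  proof (rule tensor_linear_eqI[OF mods P.module_axioms _ _ _ that])
    show l1: "(\<lambda>X. tensor_lift K P b (dif (tensor K M N) X)) \<in> linear_maps K (tensor_module K M N) P"
      by (rule linear_maps_comp[OF tensor_dif_linear[OF assms(1,2)] lin])
    show l2: "(\<lambda>X. dif P (tensor_lift K P b X)) \<in> linear_maps K (tensor_module K M N) P"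
      by (rule linear_maps_comp[OF lin P.dif_linear])
    note pt = pure_tensor_bilinear[OF mods]
    have hom: "tensor_lift K P b (dif (tensor K M N) (pure_tensor K M N x y)) =
        dif P (tensor_lift K P b (pure_tensor K M N x y))" if x: "x \<in> grade M i" and y: "y \<in> grade N j" for x y i j
    proof -
      note c = M.grade_closed[OF x] N.grade_closed[OF y]
        linear_maps_closed[OF M.dif_linear M.grade_closed[OF x]]
        linear_maps_closed[OF N.dif_linear N.grade_closed[OF y]]
      show ?thesis
        by (simp add: tensor_dif_pure[OF assms(1,2) x] c linear_maps_add[OF lin] cl
            linear_maps_sgn_pow[OF T.module_axioms P.module_axioms lin] sgn_pow_closed[OF T.module_axioms]
            pure leibniz[OF x y])
    qed
    \<comment> \<open>On pure tensors both sides are linear in \<open>x\<close> for fixed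
      \<open>y\<close> and in \<open>y\<close> for fixed \<open>x\<close>, so the arguments are made
      homogeneous one after the other until \<open>hom\<close> applies.\<close>
    fix x y assume x: "x \<in> carrier M" and y: "y \<in> carrier N"
    show "tensor_lift K P b (dif (tensor K M N) (pure_tensor K M N x y)) =
        dif P (tensor_lift K P b (pure_tensor K M N x y))"
    proof (rule M.linear_eq_on_grades[OF P.module_axioms
          linear_maps_comp[OF bilinear_map_left[OF pt y] l1]
          linear_maps_comp[OF bilinear_map_left[OF pt y] l2] _ x])
      fix i x assume x: "x \<in> grade M i"
      show "tensor_lift K P b (dif (tensor K M N) (pure_tensor K M N x y)) =
          dif P (tensor_lift K P b (pure_tensor K M N x y))"
        by (rule N.linear_eq_on_grades[OF P.module_axioms
              linear_maps_comp[OF bilinear_map_right[OF pt M.grade_closed[OF x]] l1]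
              linear_maps_comp[OF bilinear_map_right[OF pt M.grade_closed[OF x]] l2] _ y])
          (rule hom[OF x])
    qed
  qed
  ultimately show ?thesis
    unfolding dg_morphism_def by (auto simp: tensor_simps linear_maps_tensor lin)
qed

lemma dg_morphism_linear: "dg_morphism K M N f \<Longrightarrow> f \<in> linear_maps K M N"
  unfolding dg_morphism_def by blast

text \<open>Converse of \<open>dg_morphism_tensor_lift\<close>: a morphism out of a tensor product
  is turned back into a degree rule and a Leibniz rule. It is applied to composition in the given dg
  categories and to the functor \<open>M\<close>.\<close>

lemma dg_morphism_tensor_pure:
  assumes "dg_module K M" "dg_module K N" "module K P" "dg_morphism K (tensor K M N) P c"
    and x: "x \<in> grade M i" and y: "y \<in> grade N j"
  shows "c (pure_tensor K M N x y) \<in> grade P (i + j)"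
    and "dif P (c (pure_tensor K M N x y)) =
      c (pure_tensor K M N (dif M x) y) \<oplus>\<^bsub>P\<^esub> sgn_pow P i (c (pure_tensor K M N x (dif N y)))"
proof -
  interpret M: dg_module K M by fact
  interpret N: dg_module K N by fact
  note mods = M.module_axioms N.module_axioms
  interpret T: module K "tensor_module K M N" by (rule tensor_module_module[OF mods])
  note cl = bilinear_map_closed[OF pure_tensor_bilinear[OF mods]]
  note c = M.grade_closed[OF x] N.grade_closed[OF y]
    linear_maps_closed[OF M.dif_linear M.grade_closed[OF x]]
    linear_maps_closed[OF N.dif_linear N.grade_closed[OF y]]
  have lin: "c \<in> linear_maps K (tensor_module K M N) P"
    using dg_morphism_linear[OF assms(4)] by (simp add: linear_maps_tensor)
  show "c (pure_tensor K M N x y) \<in> grade P (i + j)"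
    using assms(4) tensor_grade_pure[OF x y] unfolding dg_morphism_def by blast
  have "dif P (c (pure_tensor K M N x y)) = c (dif (tensor K M N) (pure_tensor K M N x y))"
    using assms(4) cl[OF c(1,2)] unfolding dg_morphism_def by (simp add: tensor_simps)
  then show "dif P (c (pure_tensor K M N x y)) =
      c (pure_tensor K M N (dif M x) y) \<oplus>\<^bsub>P\<^esub> sgn_pow P i (c (pure_tensor K M N x (dif N y)))"
    by (simp add: tensor_dif_pure[OF assms(1,2) x] c linear_maps_add[OF lin] cl
        linear_maps_sgn_pow[OF T.module_axioms assms(3) lin] sgn_pow_closed[OF T.module_axioms])
qed

section \<open>Degree and Leibniz rule of composition in a dg category\<close>

context dg_category
begin

text \<open>The morphism that witnesses \<open>Comp_dg_morphism\<close> agrees with composition on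
  pure tensors, and homogeneous pure tensors are where its degree is read off.\<close>

lemma Comp_grade:
  assumes "X \<in> Obj C" "Y \<in> Obj C" "Z \<in> Obj C" "g \<in> grade (Hom C Y Z) i" "f \<in> grade (Hom C X Y) j"
  shows "Comp C X Y Z g f \<in> grade (Hom C X Z) (i + j)"
  using Comp_dg_morphism[OF assms(1-3)]
    dg_morphism_tensor_pure(1)[OF Hom_dg_module[OF assms(2,3)] Hom_dg_module[OF assms(1,2)]
      Hom_module[OF assms(1,3)] _ assms(4,5)]
    gr_module.grade_closed[OF dg_module.axioms(1)[OF Hom_dg_module[OF assms(2,3)]] assms(4)]
    gr_module.grade_closed[OF dg_module.axioms(1)[OF Hom_dg_module[OF assms(1,2)]] assms(5)]
  by fastforce

lemma Comp_dif:
  assumes "X \<in> Obj C" "Y \<in> Obj C" "Z \<in> Obj C" "g \<in> grade (Hom C Y Z) i" "f \<in> grade (Hom C X Y) j"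
  shows "dif (Hom C X Z) (Comp C X Y Z g f) =
    Comp C X Y Z (dif (Hom C Y Z) g) f \<oplus>\<^bsub>Hom C X Z\<^esub>
      sgn_pow (Hom C X Z) i (Comp C X Y Z g (dif (Hom C X Y) f))"
proof -
  interpret YZ: dg_module K "Hom C Y Z" by (rule Hom_dg_module[OF assms(2,3)])
  interpret XY: dg_module K "Hom C X Y" by (rule Hom_dg_module[OF assms(1,2)])
  obtain c where c: "dg_morphism K (tensor K (Hom C Y Z) (Hom C X Y)) (Hom C X Z) c"
    and pure: "\<And>g f. \<lbrakk>g \<in> carrier (Hom C Y Z); f \<in> carrier (Hom C X Y)\<rbrakk> \<Longrightarrow>
      c (pure_tensor K (Hom C Y Z) (Hom C X Y) g f) = Comp C X Y Z g f"
    using Comp_dg_morphism[OF assms(1-3)] by blast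
  show ?thesis
    using dg_morphism_tensor_pure(2)[OF YZ.dg_module_axioms XY.dg_module_axioms Hom_module[OF assms(1,3)] c assms(4,5)]
    by (simp add: pure YZ.grade_closed[OF assms(4)] XY.grade_closed[OF assms(5)]
        linear_maps_closed[OF YZ.dif_linear] linear_maps_closed[OF XY.dif_linear])
qed

text \<open>Comparing degrees in \<open>f = f \<circ> 1\<close> for homogeneous \<open>f\<close> shows that the degree zero component
  of the identity is again a right identity.\<close>

lemma Ide_grade:
  assumes X: "X \<in> Obj C"
  shows "Ide C X \<in> grade (Hom C X X) 0"
proof -
  interpret H: dg_module K "Hom C X X" by (rule Hom_dg_module[OF X X])
  let ?H = "Hom C X X" and ?e = "gr_component (Hom C X X) (Ide C X)"
  note e = Ide_closed[OF X]
  note right = bilinear_map_right[OF Comp_bilinear[OF X X X]]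
  have eg: "?e i \<in> grade ?H i" for i by (rule H.component_grade[OF e])
  have ec: "?e i \<in> carrier ?H" for i by (rule H.grade_closed[OF eg])
  let ?S = "insert 0 {i. ?e i \<noteq> \<zero>\<^bsub>?H\<^esub>}"
  have fin: "finite ?S" using H.component_finite[OF e] by simp
  have hom: "Comp C X X X f (?e 0) = f" if f: "f \<in> grade ?H n" for f n
  proof -
    note fc = H.grade_closed[OF f]
    have "f = Comp C X X X f (\<Oplus>\<^bsub>?H\<^esub>i\<in>?S. ?e i)"
      using H.component_sum[OF e fin subset_insertI] Ide_right[OF X X fc] by simp
    also have "\<dots> = (\<Oplus>\<^bsub>?H\<^esub>i\<in>?S. Comp C X X X f (?e i))"
      by (rule linear_maps_finsum[OF H.module_axioms H.module_axioms right[OF fc]]) (use ec in auto)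
    finally have f_sum: "f = (\<Oplus>\<^bsub>?H\<^esub>i\<in>?S. Comp C X X X f (?e i))" .
    \<comment> \<open>Since \<open>f\<close> has degree n, composing with the component of degree i
      of the identity lands in degree n + i. The piece of \<open>f\<close> in degree m therefore
      comes from component m - n, and the piece in degree n from component 0.\<close>
    have "decomposes ?H f (\<lambda>m. Comp C X X X f (?e (m - n)))"
    proof (rule H.decomposesI)
      show "finite ((\<lambda>i. i + n) ` ?S)" using fin by simp
      show "Comp C X X X f (?e (i - n)) \<in> grade ?H i" for i
        using Comp_grade[OF X X X f eg[of "i - n"]] by simp
      show "Comp C X X X f (?e (i - n)) = \<zero>\<^bsub>?H\<^esub>" if "i \<notin> (\<lambda>i. i + n) ` ?S" for i
      proof -
        have "i - n \<notin> ?S" using that by (metis diff_add_cancel image_eqI)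
        then show ?thesis
          using linear_maps_zero[OF H.module_axioms H.module_axioms right[OF fc]] by simp
      qed
      have "(\<Oplus>\<^bsub>?H\<^esub>i\<in>(\<lambda>i. i + n) ` ?S. Comp C X X X f (?e (i - n)))
          = (\<Oplus>\<^bsub>?H\<^esub>i\<in>?S. Comp C X X X f (?e (i + n - n)))"
        by (rule H.M.finsum_reindex)
          (use linear_maps_closed[OF right[OF fc] ec] in \<open>auto simp: inj_on_def\<close>)
      then show "f = (\<Oplus>\<^bsub>?H\<^esub>i\<in>(\<lambda>i. i + n) ` ?S. Comp C X X X f (?e (i - n)))"
        using f_sum by simp
    qed
    from H.component_unique[OF this fc] H.component_homogeneous[OF f]
    have "(\<lambda>m. Comp C X X X f (?e (m - n))) = (\<lambda>i. if i = n then f else \<zero>\<^bsub>?H\<^esub>)" by simp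
    from fun_cong[OF this, of n] show ?thesis by simp
  qed
  \<comment> \<open>Linearity extends \<open>hom\<close> to the identity itself, so 1 composed with
    its component of degree zero is 1. As 1 is a left identity, the same composite is that
    component, and the two coincide.\<close>
  have "Comp C X X X (Ide C X) (?e 0) = Ide C X"
    by (rule H.linear_eq_on_grades[OF H.module_axioms
          bilinear_map_left[OF Comp_bilinear[OF X X X] ec] linear_maps_id _ e]) (rule hom)
  then show ?thesis
    using Ide_left[OF X X ec[of 0]] eg[of 0] by simp
qed

text \<open>The Leibniz rule for the identity composed with itself gives d(1) = d(1) + d(1); the
  sign is trivial because the identity has degree zero.\<close>

lemma Ide_dif:
  assumes X: "X \<in> Obj C"
  shows "dif (Hom C X X) (Ide C X) = \<zero>\<^bsub>Hom C X X\<^esub>"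
proof -
  interpret H: dg_module K "Hom C X X" by (rule Hom_dg_module[OF X X])
  let ?d = "dif (Hom C X X) (Ide C X)"
  have d: "?d \<in> carrier (Hom C X X)"
    by (rule linear_maps_closed[OF H.dif_linear Ide_closed[OF X]])
  have "?d = ?d \<oplus>\<^bsub>Hom C X X\<^esub> ?d"
    using Comp_dif[OF X X X Ide_grade[OF X] Ide_grade[OF X]] d
    by (simp add: Ide_left[OF X X] Ide_right[OF X X] Ide_closed[OF X] sgn_pow_def)
  then show ?thesis
    using d by (metis H.M.add.r_cancel_one')
qed

end

section \<open>The dg modules \<open>Hom(M, N)\<close>\<close>

locale gr_module_pair = M: gr_module K M + N: gr_module K N
  for K :: "('k, 'c) ring_scheme" and M :: "('k, 'm, 'a) gr_module_scheme"
    and N :: "('k, 'n, 'b) gr_module_scheme"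
begin

abbreviation "H \<equiv> hom_gr_module K M N"

lemma hom_simps:
  "\<zero>\<^bsub>H\<^esub> = (\<lambda>x\<in>carrier M. \<zero>\<^bsub>N\<^esub>)"
  "f \<oplus>\<^bsub>H\<^esub> g = (\<lambda>x\<in>carrier M. f x \<oplus>\<^bsub>N\<^esub> g x)"
  "k \<odot>\<^bsub>H\<^esub> f = (\<lambda>x\<in>carrier M. k \<odot>\<^bsub>N\<^esub> f x)"
  "grade H = hom_degree K M N"
  by (simp_all add: hom_gr_module_def)

lemma restrict_linear:
  assumes "f \<in> linear_maps K M N"
  shows "restrict f (carrier M) \<in> linear_maps K M N"
  by (rule linear_maps_cong[OF M.module_axioms assms]) simp

lemma hom_degreeI:
  assumes "f \<in> linear_maps K M N" "\<And>i x. x \<in> grade M i \<Longrightarrow> f x \<in> grade N (i + n)"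
  shows "restrict f (carrier M) \<in> hom_degree K M N n"
  using assms restrict_linear[OF assms(1)] M.grade_closed unfolding hom_degree_def by auto

lemma hom_degreeD:
  assumes "f \<in> hom_degree K M N n"
  shows "f \<in> linear_maps K M N" "f \<in> extensional (carrier M)" "x \<in> grade M i \<Longrightarrow> f x \<in> grade N (i + n)"
  using assms unfolding hom_degree_def by auto

lemma hom_degree_carrier:
  assumes "f \<in> hom_degree K M N n"
  shows "f \<in> carrier H"
proof -
  have "f = (\<lambda>x\<in>carrier M. \<Oplus>\<^bsub>N\<^esub>i\<in>{n}. f x)"
    using hom_degreeD(2)[OF assms] linear_maps_closed[OF hom_degreeD(1)[OF assms]]
    by (intro extensionalityI[of _ "carrier M"]) auto
  moreover have "finite {n}" "\<forall>i\<in>{n}. f \<in> hom_degree K M N i"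
    using assms by auto
  ultimately show ?thesis
    unfolding hom_gr_module_def by (simp, intro exI[of _ "{n}"] exI[of _ "\<lambda>_. f"]) simp
qed

lemma hom_degree_zero: "(\<lambda>x\<in>carrier M. \<zero>\<^bsub>N\<^esub>) \<in> hom_degree K M N n"
  by (rule hom_degreeI) (simp_all add: linear_maps_const_zero[OF N.module_axioms] N.grade_zero)

text \<open>Elements of the carrier come with summands that are homogeneous on \<open>D\<close>
  only. Replacing the others by zero makes every \<open>g i\<close> homogeneous, so two elements can
  be summed over the union of their index sets.\<close>

lemma hom_carrier_cases:
  assumes "f \<in> carrier H"
  obtains D g where "finite D" "\<And>i. g i \<in> hom_degree K M N i"
    "\<And>i x. \<lbrakk>i \<notin> D; x \<in> carrier M\<rbrakk> \<Longrightarrow> g i x = \<zero>\<^bsub>N\<^esub>" "f = (\<lambda>x\<in>carrier M. \<Oplus>\<^bsub>N\<^esub>i\<in>D. g i x)"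
proof -
  obtain D g where Dg: "finite D" "\<forall>i\<in>D. g i \<in> hom_degree K M N i"
    "f = (\<lambda>x\<in>carrier M. \<Oplus>\<^bsub>N\<^esub>i\<in>D. g i x)"
    using assms unfolding hom_gr_module_def by auto
  let ?g = "\<lambda>i. if i \<in> D then g i else (\<lambda>x\<in>carrier M. \<zero>\<^bsub>N\<^esub>)"
  have "f = (\<lambda>x\<in>carrier M. \<Oplus>\<^bsub>N\<^esub>i\<in>D. ?g i x)"
    unfolding Dg(3)
    by (intro restrict_ext N.M.finsum_cong') (use Dg(2) linear_maps_closed[OF hom_degreeD(1)] in auto)
  moreover have "?g i \<in> hom_degree K M N i" for i
    using Dg(2) hom_degree_zero by simp
  ultimately show thesis
    using that[of D ?g] Dg(1) by simp
qed

lemma hom_carrierI: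
  assumes "finite D" "\<And>i. g i \<in> hom_degree K M N i"
  shows "(\<lambda>x\<in>carrier M. \<Oplus>\<^bsub>N\<^esub>i\<in>D. g i x) \<in> carrier H"
  using assms unfolding hom_gr_module_def by auto

lemma hom_carrier_linear:
  assumes "f \<in> carrier H"
  shows "f \<in> linear_maps K M N"
proof -
  obtain D g where *: "\<And>i. g i \<in> hom_degree K M N i" "f = (\<lambda>x\<in>carrier M. \<Oplus>\<^bsub>N\<^esub>i\<in>D. g i x)"
    using hom_carrier_cases[OF assms] by metis
  show ?thesis
    unfolding *(2) by (intro restrict_linear linear_maps_finsum_const[OF N.module_axioms] hom_degreeD(1)[OF *(1)])
qed

lemma hom_carrier_extensional: "f \<in> carrier H \<Longrightarrow> f \<in> extensional (carrier M)"
  by (erule hom_carrier_cases) simp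

lemma hom_carrier_add:
  assumes f: "f \<in> carrier H" and f': "f' \<in> carrier H"
  shows "f \<oplus>\<^bsub>H\<^esub> f' \<in> carrier H"
proof -
  obtain D g where D: "finite D" and g: "\<And>i. g i \<in> hom_degree K M N i"
    and g0: "\<And>i x. \<lbrakk>i \<notin> D; x \<in> carrier M\<rbrakk> \<Longrightarrow> g i x = \<zero>\<^bsub>N\<^esub>"
    and feq: "f = (\<lambda>x\<in>carrier M. \<Oplus>\<^bsub>N\<^esub>i\<in>D. g i x)"
    using hom_carrier_cases[OF f] by metis
  obtain D' g' where D': "finite D'" and g': "\<And>i. g' i \<in> hom_degree K M N i"
    and g0': "\<And>i x. \<lbrakk>i \<notin> D'; x \<in> carrier M\<rbrakk> \<Longrightarrow> g' i x = \<zero>\<^bsub>N\<^esub>"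
    and feq': "f' = (\<lambda>x\<in>carrier M. \<Oplus>\<^bsub>N\<^esub>i\<in>D'. g' i x)"
    using hom_carrier_cases[OF f'] by metis
  note lin = hom_degreeD(1)[OF g] and lin' = hom_degreeD(1)[OF g']
  have cl: "g i x \<in> carrier N" "g' i x \<in> carrier N" if "x \<in> carrier M" for i x
    using that linear_maps_closed[OF lin] linear_maps_closed[OF lin'] by auto
  have sum: "g i \<oplus>\<^bsub>H\<^esub> g' i \<in> hom_degree K M N i" for i
    unfolding hom_simps
    by (intro hom_degreeI linear_maps_plus[OF N.module_axioms] lin lin' N.grade_add)
      (auto intro: hom_degreeD(3)[OF g] hom_degreeD(3)[OF g'])
  have "(\<Oplus>\<^bsub>N\<^esub>i\<in>D. g i x) \<oplus>\<^bsub>N\<^esub> (\<Oplus>\<^bsub>N\<^esub>i\<in>D'. g' i x) = (\<Oplus>\<^bsub>N\<^esub>i\<in>D \<union> D'. g i x \<oplus>\<^bsub>N\<^esub> g' i x)"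
    if x: "x \<in> carrier M" for x
  proof -
    have "(\<Oplus>\<^bsub>N\<^esub>i\<in>D. g i x) = (\<Oplus>\<^bsub>N\<^esub>i\<in>D \<union> D'. g i x)"
      by (rule N.M.add.finprod_mono_neutral_cong_left) (use D D' g0 x cl in auto)
    moreover have "(\<Oplus>\<^bsub>N\<^esub>i\<in>D'. g' i x) = (\<Oplus>\<^bsub>N\<^esub>i\<in>D \<union> D'. g' i x)"
      by (rule N.M.add.finprod_mono_neutral_cong_left) (use D D' g0' x cl in auto)
    ultimately show ?thesis
      using N.M.finsum_addf[of "\<lambda>i. g i x" "D \<union> D'" "\<lambda>i. g' i x"] cl[OF x] by auto
  qed
  then have "f \<oplus>\<^bsub>H\<^esub> f' = (\<lambda>x\<in>carrier M. \<Oplus>\<^bsub>N\<^esub>i\<in>D \<union> D'. (g i \<oplus>\<^bsub>H\<^esub> g' i) x)"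
    unfolding hom_simps(2) feq feq' by (intro restrict_ext) simp
  then show ?thesis
    using hom_carrierI[OF _ sum, of "D \<union> D'"] D D' by simp
qed

lemma hom_carrier_smult:
  assumes k: "k \<in> carrier K" and f: "f \<in> carrier H"
  shows "k \<odot>\<^bsub>H\<^esub> f \<in> carrier H"
proof -
  obtain D g where D: "finite D" and g: "\<And>i. g i \<in> hom_degree K M N i"
    and feq: "f = (\<lambda>x\<in>carrier M. \<Oplus>\<^bsub>N\<^esub>i\<in>D. g i x)"
    using hom_carrier_cases[OF f] by metis
  note lin = hom_degreeD(1)[OF g]
  have sm: "k \<odot>\<^bsub>H\<^esub> g i \<in> hom_degree K M N i" for i
    unfolding hom_simps
    by (intro hom_degreeI linear_maps_smult_const[OF N.module_axioms k] lin N.grade_smult k hom_degreeD(3)[OF g])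
  have "k \<odot>\<^bsub>H\<^esub> f = (\<lambda>x\<in>carrier M. \<Oplus>\<^bsub>N\<^esub>i\<in>D. (k \<odot>\<^bsub>H\<^esub> g i) x)"
    unfolding hom_simps(3) feq
    by (intro restrict_ext)
      (use N.finsum_smult_ldistr[OF D k] linear_maps_closed[OF lin] in \<open>auto simp: Pi_def\<close>)
  then show ?thesis
    using hom_carrierI[OF D sm] by simp
qed

lemma hom_is_module: "module K H"
proof (rule moduleI)
  note lin = hom_carrier_linear
  have val: "f x \<in> carrier N" if "f \<in> carrier H" "x \<in> carrier M" for f x
    by (rule linear_maps_closed[OF lin[OF that(1)] that(2)])
  have ext: "(\<lambda>x\<in>carrier M. g x) = f"
    if "f \<in> carrier H" "\<And>x. x \<in> carrier M \<Longrightarrow> g x = f x" for f g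
    using hom_carrier_extensional[OF that(1)] that(2) by (intro extensionalityI[of _ "carrier M"]) auto
  have zero: "\<zero>\<^bsub>H\<^esub> \<in> carrier H"
    using hom_degree_carrier[OF hom_degree_zero] by (simp add: hom_simps)
  show "abelian_group H"
  proof (rule abelian_groupI)
    fix f assume f: "f \<in> carrier H"
    \<comment> \<open>The additive inverse is produced as a multiple by -1, because closure under
      scalar multiplication is already available.\<close>
    have "(\<ominus>\<^bsub>K\<^esub> \<one>\<^bsub>K\<^esub>) \<odot>\<^bsub>H\<^esub> f \<oplus>\<^bsub>H\<^esub> f = \<zero>\<^bsub>H\<^esub>"
      unfolding hom_simps by (intro restrict_ext) (simp add: val[OF f] N.smult_l_minus N.M.l_neg)
    then show "\<exists>g\<in>carrier H. g \<oplus>\<^bsub>H\<^esub> f = \<zero>\<^bsub>H\<^esub>"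
      using hom_carrier_smult[OF _ f] by blast
    show "\<zero>\<^bsub>H\<^esub> \<oplus>\<^bsub>H\<^esub> f = f"
      unfolding hom_simps by (rule ext[OF f]) (simp add: val[OF f])
  next
    fix f g assume f: "f \<in> carrier H" and g: "g \<in> carrier H"
    show "f \<oplus>\<^bsub>H\<^esub> g = g \<oplus>\<^bsub>H\<^esub> f"
      unfolding hom_simps by (intro restrict_ext N.M.a_comm val f g)
    fix h assume h: "h \<in> carrier H"
    show "f \<oplus>\<^bsub>H\<^esub> g \<oplus>\<^bsub>H\<^esub> h = f \<oplus>\<^bsub>H\<^esub> (g \<oplus>\<^bsub>H\<^esub> h)"
      unfolding hom_simps by (intro restrict_ext) (simp add: val[OF f] val[OF g] val[OF h] N.M.a_assoc)
  qed (simp_all add: zero hom_carrier_add)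
  fix k f assume k: "k \<in> carrier K" and f: "f \<in> carrier H"
  show "k \<odot>\<^bsub>H\<^esub> f \<in> carrier H" by (rule hom_carrier_smult[OF k f])
  fix g assume g: "g \<in> carrier H"
  show "k \<odot>\<^bsub>H\<^esub> (f \<oplus>\<^bsub>H\<^esub> g) = k \<odot>\<^bsub>H\<^esub> f \<oplus>\<^bsub>H\<^esub> k \<odot>\<^bsub>H\<^esub> g"
    unfolding hom_simps by (intro restrict_ext) (simp add: val[OF f] val[OF g] k N.smult_r_distr)
next
  have val: "f x \<in> carrier N" if "f \<in> carrier H" "x \<in> carrier M" for f x
    by (rule linear_maps_closed[OF hom_carrier_linear[OF that(1)] that(2)])
  fix k l f assume k: "k \<in> carrier K" and l: "l \<in> carrier K" and f: "f \<in> carrier H"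
  show "(k \<oplus>\<^bsub>K\<^esub> l) \<odot>\<^bsub>H\<^esub> f = k \<odot>\<^bsub>H\<^esub> f \<oplus>\<^bsub>H\<^esub> l \<odot>\<^bsub>H\<^esub> f"
    unfolding hom_simps by (intro restrict_ext) (simp add: val[OF f] k l N.smult_l_distr)
  show "k \<otimes>\<^bsub>K\<^esub> l \<odot>\<^bsub>H\<^esub> f = k \<odot>\<^bsub>H\<^esub> (l \<odot>\<^bsub>H\<^esub> f)"
    unfolding hom_simps by (intro restrict_ext) (simp add: val[OF f] k l N.smult_assoc1)
next
  fix f assume f: "f \<in> carrier H"
  show "\<one>\<^bsub>K\<^esub> \<odot>\<^bsub>H\<^esub> f = f"
    unfolding hom_simps using hom_carrier_extensional[OF f] linear_maps_closed[OF hom_carrier_linear[OF f]]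
    by (intro extensionalityI[of _ "carrier M"]) auto
qed (rule M.is_cring)

text \<open>Evaluation at a fixed element turns identities between maps into identities in
  \<open>N\<close>. The uniqueness of decompositions in Hom and all later calculations with values
  of \<open>M\<close> on morphisms pass through it.\<close>

lemma hom_eval_linear:
  assumes "x \<in> carrier M"
  shows "(\<lambda>f. f x) \<in> linear_maps K H N"
  by (rule linear_mapsI)
    (use assms linear_maps_closed[OF hom_carrier_linear] in \<open>auto simp: hom_simps\<close>)

text \<open>This is why the sum of the \<open>hom_degree K M N n\<close> is direct.\<close>

lemma hom_decomposes_eval:
  assumes "decomposes H f c" "x \<in> grade M i"
  shows "gr_component N (f x) = (\<lambda>n. c (n - i) x)"
proof -
  interpret H: module K H by (rule hom_is_module)
  let ?S = "{n. c n \<noteq> \<zero>\<^bsub>H\<^esub>}"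
  have c: "c n \<in> hom_degree K M N n" for n
    using assms(1) unfolding decomposes_def hom_simps by blast
  have fin: "finite ?S" and f: "f = (\<Oplus>\<^bsub>H\<^esub>n\<in>?S. c n)"
    using assms(1) unfolding decomposes_def by auto
  have x: "x \<in> carrier M" by (rule M.grade_closed[OF assms(2)])
  have cl: "c n x \<in> carrier N" for n by (rule linear_maps_closed[OF hom_degreeD(1)[OF c] x])
  have fx: "f x = (\<Oplus>\<^bsub>N\<^esub>n\<in>?S. c n x)"
    unfolding f
    by (rule linear_maps_finsum[OF H.module_axioms N.module_axioms hom_eval_linear[OF x]])
      (use hom_degree_carrier[OF c] in auto)
  show ?thesis
  proof (rule N.component_unique)
    \<comment> \<open>The summand \<open>c n\<close> sends \<open>x\<close> from degree i to degree
      n + i, so what \<open>f x\<close> has in degree n is contributed by index n - i.\<close>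
    show "decomposes N (f x) (\<lambda>n. c (n - i) x)"
    proof (rule N.decomposesI)
      show "finite ((\<lambda>n. n + i) ` ?S)" using fin by simp
      show "c (n - i) x \<in> grade N n" for n
        using hom_degreeD(3)[OF c assms(2), of "n - i"] by simp
      show "c (n - i) x = \<zero>\<^bsub>N\<^esub>" if "n \<notin> (\<lambda>n. n + i) ` ?S" for n
      proof -
        have "n - i \<notin> ?S" using that by (metis diff_add_cancel image_eqI)
        then show ?thesis using x by (simp add: hom_simps)
      qed
      have "(\<Oplus>\<^bsub>N\<^esub>n\<in>(\<lambda>n. n + i) ` ?S. c (n - i) x) = (\<Oplus>\<^bsub>N\<^esub>n\<in>?S. c (n + i - i) x)"
        by (rule N.M.finsum_reindex) (use cl in \<open>auto simp: inj_on_def\<close>)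
      then show "f x = (\<Oplus>\<^bsub>N\<^esub>n\<in>(\<lambda>n. n + i) ` ?S. c (n - i) x)" using fx by simp
    qed
    show "f x \<in> carrier N" unfolding fx by (rule N.M.finsum_closed) (use cl in auto)
  qed
qed

text \<open>\<open>gr_component\<close> is a definite description, so both existence and uniqueness
  are required. The one-term sum gives existence. For uniqueness, \<open>hom_decomposes_eval\<close>
  forces two decompositions of \<open>f\<close> to agree on homogeneous elements, hence everywhere
  by linearity.\<close>

lemma hom_component_homogeneous:
  assumes f: "f \<in> hom_degree K M N n"
  shows "gr_component H f = (\<lambda>i. if i = n then f else \<zero>\<^bsub>H\<^esub>)"
proof -
  interpret H: module K H by (rule hom_is_module)
  let ?c = "\<lambda>i. if i = n then f else \<zero>\<^bsub>H\<^esub>"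
  have fH: "f \<in> carrier H" by (rule hom_degree_carrier[OF f])
  \<comment> \<open>The zero map is separate: its support is empty, so the sum has no term at
    all.\<close>
  have fsum: "(\<Oplus>\<^bsub>H\<^esub>i\<in>{i. ?c i \<noteq> \<zero>\<^bsub>H\<^esub>}. ?c i) = f"
  proof (cases "f = \<zero>\<^bsub>H\<^esub>")
    case False
    then have "{i. ?c i \<noteq> \<zero>\<^bsub>H\<^esub>} = {n}" by auto
    then show ?thesis using fH by simp
  qed simp
  have dec: "decomposes H f ?c"
    unfolding decomposes_def
  proof (intro conjI allI)
    show "?c i \<in> grade H i" for i
      using f hom_degree_zero by (simp add: hom_simps)
    show "finite {i. ?c i \<noteq> \<zero>\<^bsub>H\<^esub>}"
      by (rule finite_subset[of _ "{n}"]) auto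
  qed (simp add: fsum)
  have "c = ?c" if c: "decomposes H f c" for c
  proof
    fix k
    have cd: "d k \<in> hom_degree K M N k" if "decomposes H f d" for d
      using that unfolding decomposes_def hom_simps by blast
    show "c k = ?c k"
    proof (rule extensionalityI[OF hom_degreeD(2)[OF cd[OF c]] hom_degreeD(2)[OF cd[OF dec]]])
      fix x assume x: "x \<in> carrier M"
      show "c k x = ?c k x"
      proof (rule M.linear_eq_on_grades[OF N.module_axioms hom_degreeD(1)[OF cd[OF c]]
            hom_degreeD(1)[OF cd[OF dec]] _ x])
        fix i x assume x: "x \<in> grade M i"
        from hom_decomposes_eval[OF c x] hom_decomposes_eval[OF dec x]
        have "(\<lambda>n. c (n - i) x) = (\<lambda>n. ?c (n - i) x)" by simp
        \<comment> \<open>The summand of index k is visible in degree k + i of the value at an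
          element of degree i.\<close>
        from fun_cong[OF this, of "k + i"] show "c k x = ?c k x" by simp
      qed
    qed
  qed
  then show ?thesis
    unfolding gr_component_def by (intro the_equality dec) auto
qed

end

lemma hom_dg_simps:
  "carrier (hom_dg_module K M N) = carrier (hom_gr_module K M N)"
  "zero (hom_dg_module K M N) = zero (hom_gr_module K M N)"
  "add (hom_dg_module K M N) = add (hom_gr_module K M N)"
  "smult (hom_dg_module K M N) = smult (hom_gr_module K M N)"
  "grade (hom_dg_module K M N) = hom_degree K M N"
  by (simp_all add: hom_dg_module_def Let_def add_dif_def hom_gr_module_def)

lemma linear_maps_hom_dg:
  "linear_maps K P (hom_dg_module K M N) = linear_maps K P (hom_gr_module K M N)"
  "linear_maps K (hom_dg_module K M N) P = linear_maps K (hom_gr_module K M N) P"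
  by (simp_all add: linear_maps_def hom_dg_simps)

locale dg_module_pair = M: dg_module K M + N: dg_module K N
  for K :: "('k, 'c) ring_scheme" and M :: "('k, 'm, 'a) dg_module_scheme"
    and N :: "('k, 'n, 'b) dg_module_scheme"
begin

sublocale gr_module_pair K M N ..

lemma hom_dg_is_module: "module K (hom_dg_module K M N)"
  by (rule module_surj_image[OF hom_is_module, where f = "\<lambda>x. x"])
    (simp_all add: linear_maps_hom_dg linear_maps_id hom_dg_simps)

text \<open>\<open>linear_ext_homogeneous\<close> would ask for a \<open>gr_module\<close> structure
  on Hom and for linearity of the commutator formula. Knowing the components of a homogeneous map
  allows the defining sum to be evaluated directly instead.\<close>

lemma hom_dif_homogeneous:
  assumes f: "f \<in> hom_degree K M N n"
  shows "dif (hom_dg_module K M N) f =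
    (\<lambda>x\<in>carrier M. dif N (f x) \<ominus>\<^bsub>N\<^esub> sgn_pow N n (f (dif M x)))"
proof -
  interpret H: module K H by (rule hom_is_module)
  let ?D = "\<lambda>n f. \<lambda>x\<in>carrier M. dif N (f x) \<ominus>\<^bsub>N\<^esub> sgn_pow N n (f (dif M x))"
  have D: "dif (hom_dg_module K M N) f = linear_ext H H ?D f"
    by (simp add: hom_dg_module_def Let_def add_dif_def)
  note lin = hom_degreeD(1)[OF f]
  have l: "(\<lambda>x. dif N (f x) \<ominus>\<^bsub>N\<^esub> sgn_pow N n (f (dif M x))) \<in> linear_maps K M N"
    unfolding a_minus_def
    by (intro linear_maps_plus[OF N.module_axioms] linear_maps_minus_const[OF N.module_axioms]
        linear_maps_sgn_pow_const[OF N.module_axioms] linear_maps_comp[OF lin N.dif_linear]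
        linear_maps_comp[OF M.dif_linear lin])
  have deg: "dif N (f x) \<ominus>\<^bsub>N\<^esub> sgn_pow N n (f (dif M x)) \<in> grade N (i + (n + 1))"
    if x: "x \<in> grade M i" for x i
  proof -
    have "dif N (f x) \<in> grade N (i + (n + 1))"
      using N.dif_degree[OF hom_degreeD(3)[OF f x]] by (simp add: add.assoc)
    moreover have "f (dif M x) \<in> grade N (i + (n + 1))"
      using hom_degreeD(3)[OF f M.dif_degree[OF x]] by (simp add: add_ac)
    ultimately show ?thesis
      unfolding a_minus_def by (intro N.grade_add N.grade_uminus N.grade_sgn_pow)
  qed
  \<comment> \<open>A one-term \<open>finsum\<close> collapses only when its term lies in the
    carrier of Hom. The graded commutator does, being homogeneous of degree n + 1.\<close>
  have Dc: "?D n f \<in> carrier H"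
    by (rule hom_degree_carrier[OF hom_degreeI[OF l deg]])
  show ?thesis
  \<comment> \<open>The sum in \<open>linear_ext\<close> runs over the support, which is empty for
    the zero map and {n} otherwise. In the first case the commutator has to vanish too.\<close>
  proof (cases "f = \<zero>\<^bsub>H\<^esub>")
    case True
    then have fx: "f x = \<zero>\<^bsub>N\<^esub>" if "x \<in> carrier M" for x
      using that by (simp add: hom_simps)
    have "?D n f = \<zero>\<^bsub>H\<^esub>"
      unfolding hom_simps
      by (intro restrict_ext)
        (simp add: fx linear_maps_closed[OF M.dif_linear] sgn_pow_def a_minus_def
          linear_maps_zero[OF N.module_axioms N.module_axioms N.dif_linear])
    moreover have "linear_ext H H ?D f = \<zero>\<^bsub>H\<^esub>"
      unfolding linear_ext_def hom_component_homogeneous[OF f] using True by simp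
    ultimately show ?thesis using D by simp
  next
    case False
    then have supp: "{i. (if i = n then f else \<zero>\<^bsub>H\<^esub>) \<noteq> \<zero>\<^bsub>H\<^esub>} = {n}" by auto
    show ?thesis
      unfolding D linear_ext_def hom_component_homogeneous[OF f] supp using Dc by simp
  qed
qed

end

section \<open>Composition in opposite and tensor product categories\<close>

lemma opposite_simps:
  "Obj (opposite C) = Obj C" "Hom (opposite C) X Y = Hom C Y X" "Ide (opposite C) X = Ide C X"
  by (simp_all add: opposite_def)

lemma tensor_category_simps:
  "Obj (tensor_category K A B) = Obj A \<times> Obj B"
  "Hom (tensor_category K A B) (X, Y) (X', Y') = tensor K (Hom A X X') (Hom B Y Y')"
  "Ide (tensor_category K A B) (X, Y) = pure_tensor K (Hom A X X) (Hom B Y Y) (Ide A X) (Ide B Y)"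
  by (simp_all add: tensor_category_def)

lemma DgMod_simps:
  "Obj (DgMod K) = {M. dg_module K M}" "Hom (DgMod K) = hom_dg_module K"
  "Comp (DgMod K) X Y Z g f = compose (carrier X) g f" "Ide (DgMod K) X = (\<lambda>x\<in>carrier X. x)"
  by (simp_all add: DgMod_def)

lemma bilinear_map_flip: "bilinear_map K M N P b \<Longrightarrow> bilinear_map K N M P (\<lambda>y x. b x y)"
  unfolding bilinear_map_def by blast

lemma bilinear_ext_parameter:
  assumes "gr_module K M" "gr_module K N" "module K P"
    and "\<And>i j x y. \<lbrakk>x \<in> carrier M; y \<in> carrier N\<rbrakk> \<Longrightarrow> (\<lambda>z. f z i j x y) \<in> linear_maps K Q P"
    and "x \<in> carrier M" "y \<in> carrier N"
  shows "(\<lambda>z. bilinear_ext M N P (f z) x y) \<in> linear_maps K Q P"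
  unfolding bilinear_ext_def
  by (intro gr_module.linear_ext_parameter[OF assms(1,3) _ assms(5)]
      gr_module.linear_ext_parameter[OF assms(2,3) _ assms(6)] assms(4))

context dg_category
begin

lemma opposite_Comp_bilinear:
  assumes "X \<in> Obj C" "Y \<in> Obj C" "Z \<in> Obj C"
  shows "bilinear_map K (Hom C Z Y) (Hom C Y X) (Hom C Z X) (Comp (opposite C) X Y Z)"
    and "\<lbrakk>g \<in> grade (Hom C Z Y) i; f \<in> grade (Hom C Y X) j\<rbrakk> \<Longrightarrow>
      Comp (opposite C) X Y Z g f = sgn_pow (Hom C Z X) (i * j) (Comp C Z Y X f g)"
proof -
  note gr = dg_module.axioms(1)[OF Hom_dg_module[OF assms(3,2)]]
    dg_module.axioms(1)[OF Hom_dg_module[OF assms(2,1)]]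
  note m = Hom_module[OF assms(3,1)]
  have b: "bilinear_map K (Hom C Z Y) (Hom C Y X) (Hom C Z X)
      (\<lambda>g f. sgn_pow (Hom C Z X) (i * j) (Comp C Z Y X f g))" for i j :: int
    by (rule bilinear_map_sgn_pow[OF m bilinear_map_flip[OF Comp_bilinear[OF assms(3,2,1)]]])
  show "bilinear_map K (Hom C Z Y) (Hom C Y X) (Hom C Z X) (Comp (opposite C) X Y Z)"
    using bilinear_ext_bilinear[OF gr m b] by (simp add: opposite_def)
  show "Comp (opposite C) X Y Z g f = sgn_pow (Hom C Z X) (i * j) (Comp C Z Y X f g)"
    if "g \<in> grade (Hom C Z Y) i" "f \<in> grade (Hom C Y X) j"
    using bilinear_ext_homogeneous[OF gr m b that] by (simp add: opposite_def)
qed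

end

text \<open>The sign involves \<open>b\<^sub>2\<close> and \<open>a\<^sub>1\<close> only, so just
  these two are homogeneous. The hypotheses speak of single Hom modules, which makes the formula
  applicable to \<open>opposite \<T>\<close> without first turning it into a dg category.\<close>

lemma tensor_category_Comp_pure:
  assumes AX: "gr_module K (Hom A X X')" "module K (Hom A X' X'')" "module K (Hom A X X'')"
    and BY: "module K (Hom B Y Y')" "gr_module K (Hom B Y' Y'')" "module K (Hom B Y Y'')"
    and cA: "bilinear_map K (Hom A X' X'') (Hom A X X') (Hom A X X'') (Comp A X X' X'')"
    and cB: "bilinear_map K (Hom B Y' Y'') (Hom B Y Y') (Hom B Y Y'') (Comp B Y Y' Y'')"
    and a2: "a\<^sub>2 \<in> carrier (Hom A X' X'')" and b2: "b\<^sub>2 \<in> grade (Hom B Y' Y'') i"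
    and a1: "a\<^sub>1 \<in> grade (Hom A X X') j" and b1: "b\<^sub>1 \<in> carrier (Hom B Y Y')"
  shows "Comp (tensor_category K A B) (X, Y) (X', Y') (X'', Y'')
      (pure_tensor K (Hom A X' X'') (Hom B Y' Y'') a\<^sub>2 b\<^sub>2) (pure_tensor K (Hom A X X') (Hom B Y Y') a\<^sub>1 b\<^sub>1) =
    sgn_pow (tensor K (Hom A X X'') (Hom B Y Y'')) (i * j)
      (pure_tensor K (Hom A X X'') (Hom B Y Y'') (Comp A X X' X'' a\<^sub>2 a\<^sub>1) (Comp B Y Y' Y'' b\<^sub>2 b\<^sub>1))"
proof -
  interpret A: gr_module K "Hom A X X'" by fact
  interpret B: gr_module K "Hom B Y' Y''" by fact
  let ?P = "tensor K (Hom A X X'') (Hom B Y Y'')" and ?pt = "pure_tensor K (Hom A X X'') (Hom B Y Y'')"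
  let ?CA = "Comp A X X' X''" and ?CB = "Comp B Y Y' Y''"
  have P: "module K ?P" by (rule tensor_is_module[OF AX(3) BY(3)])
  have pt: "bilinear_map K (Hom A X X'') (Hom B Y Y'') ?P ?pt"
    unfolding bilinear_map_tensor by (rule pure_tensor_bilinear[OF AX(3) BY(3)])
  define f where "f = (\<lambda>a\<^sub>2 b\<^sub>1 i j b\<^sub>2' a\<^sub>1'. sgn_pow ?P (i * j) (?pt (?CA a\<^sub>2 a\<^sub>1') (?CB b\<^sub>2' b\<^sub>1)))"
  \<comment> \<open>In this function of four arguments \<open>b\<^sub>2\<close> and
    \<open>a\<^sub>1\<close> are treated by the bilinear extension, while \<open>a\<^sub>2\<close>
    and \<open>b\<^sub>1\<close> are parameters of it. Linearity in the latter is what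
    \<open>f_par1\<close> and \<open>f_par2\<close> supply.\<close>
  define \<beta> where "\<beta> = (\<lambda>a\<^sub>2 b\<^sub>2 a\<^sub>1 b\<^sub>1. bilinear_ext (Hom B Y' Y'') (Hom A X X') ?P (f a\<^sub>2 b\<^sub>1) b\<^sub>2 a\<^sub>1)"
  have comp: "Comp (tensor_category K A B) (X, Y) (X', Y') (X'', Y'') q p =
      tensor_lift K ?P (\<lambda>a\<^sub>2 b\<^sub>2. tensor_lift K ?P (\<beta> a\<^sub>2 b\<^sub>2) p) q" for q p
    by (simp add: tensor_category_def \<beta>_def f_def Let_def)
  have f_bil: "bilinear_map K (Hom B Y' Y'') (Hom A X X') ?P (f a\<^sub>2 b\<^sub>1 i j)"
    if "a\<^sub>2 \<in> carrier (Hom A X' X'')" "b\<^sub>1 \<in> carrier (Hom B Y Y')" for a\<^sub>2 b\<^sub>1 i j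
    unfolding f_def
    by (rule bilinear_map_sgn_pow[OF P bilinear_map_flip[OF bilinear_map_comp[OF pt
              bilinear_map_right[OF cA that(1)] bilinear_map_left[OF cB that(2)]]]])
  have f_par1: "(\<lambda>b\<^sub>1. f a\<^sub>2 b\<^sub>1 i j b\<^sub>2 a\<^sub>1) \<in> linear_maps K (Hom B Y Y') ?P"
    if "a\<^sub>2 \<in> carrier (Hom A X' X'')" "b\<^sub>2 \<in> carrier (Hom B Y' Y'')" "a\<^sub>1 \<in> carrier (Hom A X X')"
    for a\<^sub>2 b\<^sub>2 a\<^sub>1 i j
    unfolding f_def
    by (rule linear_maps_sgn_pow_const[OF P linear_maps_comp[OF bilinear_map_right[OF cB that(2)]
            bilinear_map_right[OF pt bilinear_map_closed[OF cA that(1,3)]]]])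
  have f_par2: "(\<lambda>a\<^sub>2. f a\<^sub>2 b\<^sub>1 i j b\<^sub>2 a\<^sub>1) \<in> linear_maps K (Hom A X' X'') ?P"
    if "b\<^sub>1 \<in> carrier (Hom B Y Y')" "b\<^sub>2 \<in> carrier (Hom B Y' Y'')" "a\<^sub>1 \<in> carrier (Hom A X X')"
    for b\<^sub>1 b\<^sub>2 a\<^sub>1 i j
    unfolding f_def
    by (rule linear_maps_sgn_pow_const[OF P linear_maps_comp[OF bilinear_map_left[OF cA that(3)]
            bilinear_map_left[OF pt bilinear_map_closed[OF cB that(2,1)]]]])
  have bil1: "bilinear_map K (Hom A X X') (Hom B Y Y') ?P (\<beta> a\<^sub>2 b\<^sub>2)"
    if "a\<^sub>2 \<in> carrier (Hom A X' X'')" "b\<^sub>2 \<in> carrier (Hom B Y' Y'')" for a\<^sub>2 b\<^sub>2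
  proof (rule bilinear_mapI)
    show "\<beta> a\<^sub>2 b\<^sub>2 a\<^sub>1 \<in> linear_maps K (Hom B Y Y') ?P" if a1: "a\<^sub>1 \<in> carrier (Hom A X X')" for a\<^sub>1
      unfolding \<beta>_def
      by (rule bilinear_ext_parameter[OF BY(2) AX(1) P f_par1 \<open>b\<^sub>2 \<in> _\<close> a1])
        (use \<open>a\<^sub>2 \<in> _\<close> in auto)
    show "(\<lambda>a\<^sub>1. \<beta> a\<^sub>2 b\<^sub>2 a\<^sub>1 b\<^sub>1) \<in> linear_maps K (Hom A X X') ?P" if b1: "b\<^sub>1 \<in> carrier (Hom B Y Y')" for b\<^sub>1
      unfolding \<beta>_def
      by (rule bilinear_map_right[OF bilinear_ext_bilinear[OF BY(2) AX(1) P f_bil[OF \<open>a\<^sub>2 \<in> _\<close> b1]] \<open>b\<^sub>2 \<in> _\<close>])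
  qed
  have a1c: "a\<^sub>1 \<in> carrier (Hom A X X')" by (rule A.grade_closed[OF a1])
  have b2c: "b\<^sub>2 \<in> carrier (Hom B Y' Y'')" by (rule B.grade_closed[OF b2])
  \<comment> \<open>For the outer lift, \<open>a\<^sub>1\<close> and \<open>b\<^sub>1\<close> are
    frozen at the entries of the second pure tensor.\<close>
  have bil2: "bilinear_map K (Hom A X' X'') (Hom B Y' Y'') ?P (\<lambda>a\<^sub>2 b\<^sub>2. \<beta> a\<^sub>2 b\<^sub>2 a\<^sub>1 b\<^sub>1)"
  proof (rule bilinear_mapI)
    show "(\<lambda>b\<^sub>2. \<beta> a\<^sub>2 b\<^sub>2 a\<^sub>1 b\<^sub>1) \<in> linear_maps K (Hom B Y' Y'') ?P" if a2: "a\<^sub>2 \<in> carrier (Hom A X' X'')" for a\<^sub>2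
      unfolding \<beta>_def
      by (rule bilinear_map_left[OF bilinear_ext_bilinear[OF BY(2) AX(1) P f_bil[OF a2 b1]] a1c])
    show "(\<lambda>a\<^sub>2. \<beta> a\<^sub>2 b\<^sub>2 a\<^sub>1 b\<^sub>1) \<in> linear_maps K (Hom A X' X'') ?P" if b2: "b\<^sub>2 \<in> carrier (Hom B Y' Y'')" for b\<^sub>2
      unfolding \<beta>_def
      by (rule bilinear_ext_parameter[OF BY(2) AX(1) P f_par2[OF b1] b2 a1c])
  qed
  let ?p = "pure_tensor K (Hom A X X') (Hom B Y Y') a\<^sub>1 b\<^sub>1"
  have inner: "tensor_lift K ?P (\<beta> a\<^sub>2 b\<^sub>2) ?p = \<beta> a\<^sub>2 b\<^sub>2 a\<^sub>1 b\<^sub>1"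
    if "a\<^sub>2 \<in> carrier (Hom A X' X'')" "b\<^sub>2 \<in> carrier (Hom B Y' Y'')" for a\<^sub>2 b\<^sub>2
    by (rule tensor_lift_pure[OF A.module_axioms BY(1) P bil1[OF that] a1c b1])
  \<comment> \<open>The outer lift contains the inner lift as it stands, so bilinearity is
    transferred from \<open>\<beta>\<close> along \<open>inner\<close>.\<close>
  have "bilinear_map K (Hom A X' X'') (Hom B Y' Y'') ?P (\<lambda>a\<^sub>2 b\<^sub>2. tensor_lift K ?P (\<beta> a\<^sub>2 b\<^sub>2) ?p)"
    by (rule bilinear_map_cong[OF AX(2) B.module_axioms bil2]) (simp add: inner)
  from tensor_lift_pure[OF AX(2) B.module_axioms P this a2 b2c]
  have "Comp (tensor_category K A B) (X, Y) (X', Y') (X'', Y'')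
      (pure_tensor K (Hom A X' X'') (Hom B Y' Y'') a\<^sub>2 b\<^sub>2) ?p = \<beta> a\<^sub>2 b\<^sub>2 a\<^sub>1 b\<^sub>1"
    unfolding comp by (simp add: inner[OF a2 b2c])
  also have "\<dots> = f a\<^sub>2 b\<^sub>1 i j b\<^sub>2 a\<^sub>1"
    unfolding \<beta>_def by (rule bilinear_ext_homogeneous[OF BY(2) AX(1) P f_bil[OF a2 b1] b2 a1])
  finally show ?thesis by (simp add: f_def)
qed

section \<open>Threefold products of dg modules\<close>

text \<open>\<open>L\<close> is described by equations rather than constructed, so the record of
  \<open>triangular_Hom\<close> is an instance whatever its other fields are. Composition of
  matrices uses three instances at once.\<close>

locale dg_product = A: dg_module K A + B: dg_module K B + D: dg_module K D
  for K :: "('k, 'c) ring_scheme" and A :: "('k, 'x, 'a) dg_module_scheme"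
    and B :: "('k, 'y, 'b) dg_module_scheme" and D :: "('k, 'z, 'd) dg_module_scheme" +
  fixes L :: "('k, 'x \<times> 'y \<times> 'z, 'l) dg_module_scheme"
  assumes carrier_L: "carrier L = carrier A \<times> carrier B \<times> carrier D"
    and zero_L: "\<zero>\<^bsub>L\<^esub> = (\<zero>\<^bsub>A\<^esub>, \<zero>\<^bsub>B\<^esub>, \<zero>\<^bsub>D\<^esub>)"
    and add_L: "(a, b, d) \<oplus>\<^bsub>L\<^esub> (a', b', d') = (a \<oplus>\<^bsub>A\<^esub> a', b \<oplus>\<^bsub>B\<^esub> b', d \<oplus>\<^bsub>D\<^esub> d')"
    and smult_L: "k \<odot>\<^bsub>L\<^esub> (a, b, d) = (k \<odot>\<^bsub>A\<^esub> a, k \<odot>\<^bsub>B\<^esub> b, k \<odot>\<^bsub>D\<^esub> d)"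
    and grade_L: "grade L n = grade A n \<times> grade B n \<times> grade D n"
    and dif_L: "dif L (a, b, d) = (dif A a, dif B b, dif D d)"
begin

lemma product_module: "module K L"
proof (rule moduleI)
  show "abelian_group L"
  proof (rule abelian_groupI)
    fix x assume "x \<in> carrier L"
    then obtain a b d where x: "x = (a, b, d)" "a \<in> carrier A" "b \<in> carrier B" "d \<in> carrier D"
      by (auto simp: carrier_L)
    then show "\<exists>y\<in>carrier L. y \<oplus>\<^bsub>L\<^esub> x = \<zero>\<^bsub>L\<^esub>"
      by (intro bexI[of _ "(\<ominus>\<^bsub>A\<^esub> a, \<ominus>\<^bsub>B\<^esub> b, \<ominus>\<^bsub>D\<^esub> d)"])
        (simp_all add: carrier_L zero_L add_L A.M.l_neg B.M.l_neg D.M.l_neg)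
  qed (auto simp: carrier_L zero_L add_L A.M.add.m_ac B.M.add.m_ac D.M.add.m_ac)
qed (auto simp: carrier_L add_L smult_L A.is_cring A.smult_l_distr B.smult_l_distr D.smult_l_distr
    A.smult_r_distr B.smult_r_distr D.smult_r_distr A.smult_assoc1 B.smult_assoc1 D.smult_assoc1)

lemma proj_linear:
  "(\<lambda>x. fst x) \<in> linear_maps K L A"
  "(\<lambda>x. fst (snd x)) \<in> linear_maps K L B"
  "(\<lambda>x. snd (snd x)) \<in> linear_maps K L D"
  by (rule linear_mapsI; auto simp: carrier_L add_L smult_L)+

lemma tuple_linear:
  assumes "f \<in> linear_maps K X A" "g \<in> linear_maps K X B" "h \<in> linear_maps K X D"
  shows "(\<lambda>x. (f x, g x, h x)) \<in> linear_maps K X L"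
  by (rule linear_mapsI)
    (simp_all add: carrier_L add_L smult_L
      linear_maps_closed[OF assms(1)] linear_maps_closed[OF assms(2)] linear_maps_closed[OF assms(3)]
      linear_maps_add[OF assms(1)] linear_maps_add[OF assms(2)] linear_maps_add[OF assms(3)]
      linear_maps_smult[OF assms(1)] linear_maps_smult[OF assms(2)] linear_maps_smult[OF assms(3)])

lemma finsum_L:
  assumes "c \<in> S \<rightarrow> carrier L"
  shows "finsum L c S = (\<Oplus>\<^bsub>A\<^esub>i\<in>S. fst (c i), \<Oplus>\<^bsub>B\<^esub>i\<in>S. fst (snd (c i)), \<Oplus>\<^bsub>D\<^esub>i\<in>S. snd (snd (c i)))"
  by (intro prod_eqI)
    (simp_all add: linear_maps_finsum[OF product_module A.module_axioms proj_linear(1) assms]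
      linear_maps_finsum[OF product_module B.module_axioms proj_linear(2) assms]
      linear_maps_finsum[OF product_module D.module_axioms proj_linear(3) assms])

text \<open>The support of a triple contains the support of each entry and may be strictly larger,
  hence the use of \<open>decomposesI\<close> with the common index set. Uniqueness of
  decompositions in \<open>L\<close> follows entry by entry.\<close>

lemma product_decomposes:
  assumes "decomposes L x c"
  shows "decomposes A (fst x) (\<lambda>i. fst (c i))"
    "decomposes B (fst (snd x)) (\<lambda>i. fst (snd (c i)))"
    "decomposes D (snd (snd x)) (\<lambda>i. snd (snd (c i)))"
proof -
  let ?S = "{n. c n \<noteq> \<zero>\<^bsub>L\<^esub>}"
  have fin: "finite ?S" and g: "c n \<in> grade A n \<times> grade B n \<times> grade D n" for n
    using assms unfolding decomposes_def grade_L by auto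
  have "c n \<in> carrier L" for n
    using g[of n] A.grade_closed B.grade_closed D.grade_closed by (auto simp: carrier_L)
  then have x: "x = (\<Oplus>\<^bsub>A\<^esub>i\<in>?S. fst (c i), \<Oplus>\<^bsub>B\<^esub>i\<in>?S. fst (snd (c i)), \<Oplus>\<^bsub>D\<^esub>i\<in>?S. snd (snd (c i)))"
    using assms finsum_L[of c ?S] unfolding decomposes_def by auto
  have g': "fst (c i) \<in> grade A i" "fst (snd (c i)) \<in> grade B i" "snd (snd (c i)) \<in> grade D i" for i
    using g[of i] by (auto simp: mem_Times_iff)
  show "decomposes A (fst x) (\<lambda>i. fst (c i))"
    by (rule A.decomposesI[OF fin]) (use g' x in \<open>simp_all add: zero_L\<close>)
  show "decomposes B (fst (snd x)) (\<lambda>i. fst (snd (c i)))"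
    by (rule B.decomposesI[OF fin]) (use g' x in \<open>simp_all add: zero_L\<close>)
  show "decomposes D (snd (snd x)) (\<lambda>i. snd (snd (c i)))"
    by (rule D.decomposesI[OF fin]) (use g' x in \<open>simp_all add: zero_L\<close>)
qed

lemma product_dg_module: "dg_module K L"
proof -
  interpret L: module K L by (rule product_module)
  show ?thesis
  proof (intro dg_module.intro gr_module.intro gr_module_axioms.intro dg_module_axioms.intro L.module_axioms)
    fix n
    show "submodule (grade L n) K L"
    proof (rule L.submoduleI)
      fix x assume x: "x \<in> grade L n"
      then have "x \<in> carrier L"
        using A.grade_closed B.grade_closed D.grade_closed by (auto simp: grade_L carrier_L)
      \<comment> \<open>The negative in \<open>L\<close> is defined through its addition. Linearity
        of the projections shows that it is formed entrywise.\<close>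
      then have "\<ominus>\<^bsub>L\<^esub> x = (\<ominus>\<^bsub>A\<^esub> fst x, \<ominus>\<^bsub>B\<^esub> fst (snd x), \<ominus>\<^bsub>D\<^esub> snd (snd x))"
        by (intro prod_eqI)
          (simp_all add: linear_maps_uminus[OF product_module A.module_axioms proj_linear(1)]
            linear_maps_uminus[OF product_module B.module_axioms proj_linear(2)]
            linear_maps_uminus[OF product_module D.module_axioms proj_linear(3)])
      then show "\<ominus>\<^bsub>L\<^esub> x \<in> grade L n"
        using x by (auto simp: grade_L A.grade_uminus B.grade_uminus D.grade_uminus)
    qed (auto simp: grade_L carrier_L zero_L add_L smult_L A.grade_closed B.grade_closed D.grade_closed
        A.grade_zero B.grade_zero D.grade_zero A.grade_add B.grade_add D.grade_add
        A.grade_smult B.grade_smult D.grade_smult)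
  next
    fix x assume xc: "x \<in> carrier L"
    obtain a b d where x: "x = (a, b, d)" by (cases x)
    have abd: "a \<in> carrier A" "b \<in> carrier B" "d \<in> carrier D" using xc by (auto simp: x carrier_L)
    let ?c = "\<lambda>i. (gr_component A a i, gr_component B b i, gr_component D d i)"
    have supp: "{n. ?c n \<noteq> \<zero>\<^bsub>L\<^esub>} = {i. gr_component A a i \<noteq> \<zero>\<^bsub>A\<^esub>} \<union>
        ({i. gr_component B b i \<noteq> \<zero>\<^bsub>B\<^esub>} \<union> {i. gr_component D d i \<noteq> \<zero>\<^bsub>D\<^esub>})" (is "?S = _")
      by (auto simp: zero_L)
    have fin: "finite ?S"
      unfolding supp using A.component_finite B.component_finite D.component_finite abd by simp
    have g: "?c n \<in> grade L n" for n
      using abd by (simp add: grade_L A.component_grade B.component_grade D.component_grade)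
    have "?c \<in> ?S \<rightarrow> carrier L"
      by (simp add: carrier_L abd A.grade_closed[OF A.component_grade]
          B.grade_closed[OF B.component_grade] D.grade_closed[OF D.component_grade])
    moreover have "(\<Oplus>\<^bsub>A\<^esub>i\<in>?S. gr_component A a i) = a"
      by (rule A.component_sum[OF abd(1) fin]) (auto simp: zero_L)
    moreover have "(\<Oplus>\<^bsub>B\<^esub>i\<in>?S. gr_component B b i) = b"
      by (rule B.component_sum[OF abd(2) fin]) (auto simp: zero_L)
    moreover have "(\<Oplus>\<^bsub>D\<^esub>i\<in>?S. gr_component D d i) = d"
      by (rule D.component_sum[OF abd(3) fin]) (auto simp: zero_L)
    ultimately have "x = (\<Oplus>\<^bsub>L\<^esub>n\<in>?S. ?c n)"
      by (simp add: finsum_L x)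
    then have "decomposes L x ?c"
      unfolding decomposes_def using fin g by blast
    moreover have "c = ?c" if "decomposes L x c" for c
      using A.component_unique[OF product_decomposes(1)[OF that]]
        B.component_unique[OF product_decomposes(2)[OF that]]
        D.component_unique[OF product_decomposes(3)[OF that]] abd
      by (simp add: x)
    ultimately show "\<exists>!c. decomposes L x c" by blast
  next
    have "(\<lambda>x. (dif A (fst x), dif B (fst (snd x)), dif D (snd (snd x)))) \<in> linear_maps K L L"
      by (intro tuple_linear linear_maps_comp[OF proj_linear(1) A.dif_linear]
          linear_maps_comp[OF proj_linear(2) B.dif_linear] linear_maps_comp[OF proj_linear(3) D.dif_linear])
    moreover have "(\<lambda>x. (dif A (fst x), dif B (fst (snd x)), dif D (snd (snd x)))) = dif L"
      by (auto simp: dif_L)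
    ultimately show "dif L \<in> linear_maps K L L" by simp
  next
    fix x n assume "x \<in> grade L n"
    then show "dif L x \<in> grade L (n + 1)"
      by (auto simp: grade_L dif_L A.dif_degree B.dif_degree D.dif_degree)
  next
    fix x assume "x \<in> carrier L"
    then show "dif L (dif L x) = \<zero>\<^bsub>L\<^esub>"
      by (auto simp: carrier_L dif_L zero_L A.dif_dif B.dif_dif D.dif_dif)
  qed
qed

lemma sgn_pow_L:
  assumes "a \<in> carrier A" "b \<in> carrier B" "d \<in> carrier D"
  shows "sgn_pow L n (a, b, d) = (sgn_pow A n a, sgn_pow B n b, sgn_pow D n d)"
proof -
  have "(a, b, d) \<in> carrier L" using assms by (simp add: carrier_L)
  from linear_maps_sgn_pow[OF product_module A.module_axioms proj_linear(1) this]
    linear_maps_sgn_pow[OF product_module B.module_axioms proj_linear(2) this]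
    linear_maps_sgn_pow[OF product_module D.module_axioms proj_linear(3) this]
  show ?thesis by (intro prod_eqI) simp_all
qed

end

text \<open>Linearity in each argument separately permits passing from homogeneous to arbitrary
  elements one argument at a time. The associativity laws of the two actions all have this
  shape.\<close>

lemma trilinear_eq_on_grades:
  assumes "gr_module K A" "gr_module K B" "gr_module K D" "module K P"
    and f: "\<And>b d. \<lbrakk>b \<in> carrier B; d \<in> carrier D\<rbrakk> \<Longrightarrow> (\<lambda>a. f a b d) \<in> linear_maps K A P"
      "\<And>a d. \<lbrakk>a \<in> carrier A; d \<in> carrier D\<rbrakk> \<Longrightarrow> (\<lambda>b. f a b d) \<in> linear_maps K B P"
      "\<And>a b. \<lbrakk>a \<in> carrier A; b \<in> carrier B\<rbrakk> \<Longrightarrow> (\<lambda>d. f a b d) \<in> linear_maps K D P"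
    and g: "\<And>b d. \<lbrakk>b \<in> carrier B; d \<in> carrier D\<rbrakk> \<Longrightarrow> (\<lambda>a. g a b d) \<in> linear_maps K A P"
      "\<And>a d. \<lbrakk>a \<in> carrier A; d \<in> carrier D\<rbrakk> \<Longrightarrow> (\<lambda>b. g a b d) \<in> linear_maps K B P"
      "\<And>a b. \<lbrakk>a \<in> carrier A; b \<in> carrier B\<rbrakk> \<Longrightarrow> (\<lambda>d. g a b d) \<in> linear_maps K D P"
    and eq: "\<And>i j k a b d. \<lbrakk>a \<in> grade A i; b \<in> grade B j; d \<in> grade D k\<rbrakk> \<Longrightarrow> f a b d = g a b d"
    and "a \<in> carrier A" "b \<in> carrier B" "d \<in> carrier D"
  shows "f a b d = g a b d"
proof -
  interpret A: gr_module K A by fact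
  interpret B: gr_module K B by fact
  interpret D: gr_module K D by fact
  have 1: "f a b d = g a b d" if a: "a \<in> grade A i" and b: "b \<in> grade B j" and d: "d \<in> carrier D" for i j a b d
    by (rule D.linear_eq_on_grades[OF assms(4) f(3) g(3) _ d, OF A.grade_closed[OF a] B.grade_closed[OF b]
          A.grade_closed[OF a] B.grade_closed[OF b] eq[OF a b]])
  have 2: "f a b d = g a b d" if a: "a \<in> grade A i" and b: "b \<in> carrier B" and d: "d \<in> carrier D" for i a b d
    by (rule B.linear_eq_on_grades[OF assms(4) f(2) g(2) _ b, OF A.grade_closed[OF a] d
          A.grade_closed[OF a] d 1[OF a _ d]])
  show ?thesis
    by (rule A.linear_eq_on_grades[OF assms(4) f(1) g(1) _ assms(12), OF assms(13,14) assms(13,14)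
          2[OF _ assms(13,14)]])
qed

section \<open>The bimodule actions\<close>

locale dg_bimodule = \<T>: dg_category K \<T> + \<U>: dg_category K \<U> +
    M: dg_functor K "tensor_category K \<U> (opposite \<T>)" "DgMod K" M
  for K :: "('k, 'c) ring_scheme" and \<T> :: "('k, 't, 'mt) dg_category"
    and \<U> :: "('k, 'u, 'mu) dg_category"
    and M :: "('u \<times> 't, ('mu \<times> 'mt \<Rightarrow> 'k) set, ('k, 'v) dg_module, 'v \<Rightarrow> 'v) dg_functor"
begin

text \<open>For \<open>u : U \<rightarrow> U'\<close> and \<open>t : T \<rightarrow> T'\<close>, the map \<open>M(u \<otimes> t\<^sup>o\<^sup>p)\<close> goes from \<open>M(U, T')\<close> to \<open>M(U', T)\<close>.\<close>

abbreviation act :: "'u \<Rightarrow> 'u \<Rightarrow> 't \<Rightarrow> 't \<Rightarrow> 'mu \<Rightarrow> 'mt \<Rightarrow> 'v \<Rightarrow> 'v"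
  where "act U U' T T' u t \<equiv> onHom M (U, T') (U', T) (pure_tensor K (Hom \<U> U U') (Hom \<T> T T') u t)"

lemma value_dg_module: "\<lbrakk>U \<in> Obj \<U>; T \<in> Obj \<T>\<rbrakk> \<Longrightarrow> dg_module K (onObj M (U, T))"
  using M.onObj_closed[of "(U, T)"] by (simp add: tensor_category_simps opposite_simps DgMod_simps)

lemma value_gr_module: "\<lbrakk>U \<in> Obj \<U>; T \<in> Obj \<T>\<rbrakk> \<Longrightarrow> gr_module K (onObj M (U, T))"
  by (rule dg_module.axioms(1)[OF value_dg_module])

lemma value_module: "\<lbrakk>U \<in> Obj \<U>; T \<in> Obj \<T>\<rbrakk> \<Longrightarrow> module K (onObj M (U, T))"
  by (rule gr_module.axioms(1)[OF value_gr_module])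

lemma Hom_gr_module:
  "\<lbrakk>T \<in> Obj \<T>; T' \<in> Obj \<T>\<rbrakk> \<Longrightarrow> gr_module K (Hom \<T> T T')"
  "\<lbrakk>U \<in> Obj \<U>; U' \<in> Obj \<U>\<rbrakk> \<Longrightarrow> gr_module K (Hom \<U> U U')"
  by (rule dg_module.axioms(1)[OF \<T>.Hom_dg_module] dg_module.axioms(1)[OF \<U>.Hom_dg_module]; simp)+

section \<open>The maps M(u \<otimes> t^op): linearity, degree and differential\<close>

context
  fixes U U' :: 'u and T T' :: 't
  assumes obj: "U \<in> Obj \<U>" "U' \<in> Obj \<U>" "T \<in> Obj \<T>" "T' \<in> Obj \<T>"
begin

interpretation HU: dg_module K "Hom \<U> U U'" by (rule \<U>.Hom_dg_module[OF obj(1,2)])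
interpretation HT: dg_module K "Hom \<T> T T'" by (rule \<T>.Hom_dg_module[OF obj(3,4)])
interpretation S: dg_module K "onObj M (U, T')" by (rule value_dg_module[OF obj(1,4)])
interpretation R: dg_module K "onObj M (U', T)" by (rule value_dg_module[OF obj(2,3)])
interpretation SR: dg_module_pair K "onObj M (U, T')" "onObj M (U', T)" ..

lemma onHom_morphism:
  "dg_morphism K (tensor K (Hom \<U> U U') (Hom \<T> T T'))
    (hom_dg_module K (onObj M (U, T')) (onObj M (U', T))) (onHom M (U, T') (U', T))"
  using M.onHom_dg_morphism[of "(U, T')" "(U', T)"] obj
  by (simp add: tensor_category_simps opposite_simps DgMod_simps)

lemma act_hom_carrier:
  assumes "u \<in> carrier (Hom \<U> U U')" "t \<in> carrier (Hom \<T> T T')"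
  shows "act U U' T T' u t \<in> carrier SR.H"
proof -
  have "act U U' T T' u t \<in> carrier (hom_dg_module K (onObj M (U, T')) (onObj M (U', T)))"
    by (rule linear_maps_closed[OF dg_morphism_linear[OF onHom_morphism]])
      (simp add: tensor_simps bilinear_map_closed[OF pure_tensor_bilinear[OF HU.module_axioms HT.module_axioms]] assms)
  then show ?thesis by (simp add: hom_dg_simps)
qed

lemma act_linear:
  "\<lbrakk>u \<in> carrier (Hom \<U> U U'); t \<in> carrier (Hom \<T> T T')\<rbrakk> \<Longrightarrow>
    act U U' T T' u t \<in> linear_maps K (onObj M (U, T')) (onObj M (U', T))"
  by (rule SR.hom_carrier_linear[OF act_hom_carrier])

text \<open>The functor is linear on the tensor product of the Hom modules. Following it by
  evaluation at \<open>m\<close>, and preceding it by the bilinear map that forms pure tensors,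
  gives the claim.\<close>

lemma act_bilinear:
  assumes "m \<in> carrier (onObj M (U, T'))"
  shows "bilinear_map K (Hom \<U> U U') (Hom \<T> T T') (onObj M (U', T)) (\<lambda>u t. act U U' T T' u t m)"
proof -
  have "onHom M (U, T') (U', T) \<in> linear_maps K (tensor_module K (Hom \<U> U U') (Hom \<T> T T')) SR.H"
    using dg_morphism_linear[OF onHom_morphism] by (simp add: linear_maps_tensor linear_maps_hom_dg)
  from linear_maps_comp[OF this SR.hom_eval_linear[OF assms]]
  show ?thesis
    by (rule bilinear_map_post_comp[OF pure_tensor_bilinear[OF HU.module_axioms HT.module_axioms]])
qed

lemma act_closed:
  "\<lbrakk>u \<in> carrier (Hom \<U> U U'); t \<in> carrier (Hom \<T> T T'); m \<in> carrier (onObj M (U, T'))\<rbrakk> \<Longrightarrow>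
    act U U' T T' u t m \<in> carrier (onObj M (U', T))"
  by (rule linear_maps_closed[OF act_linear])

lemma act_degree:
  assumes "u \<in> grade (Hom \<U> U U') i" "t \<in> grade (Hom \<T> T T') j"
  shows "act U U' T T' u t \<in> hom_degree K (onObj M (U, T')) (onObj M (U', T)) (i + j)"
  using dg_morphism_tensor_pure(1)[OF HU.dg_module_axioms HT.dg_module_axioms SR.hom_dg_is_module
      onHom_morphism assms] by (simp add: hom_dg_simps)

lemma act_grade:
  assumes "u \<in> grade (Hom \<U> U U') i" "t \<in> grade (Hom \<T> T T') j" "m \<in> grade (onObj M (U, T')) k"
  shows "act U U' T T' u t m \<in> grade (onObj M (U', T)) (k + (i + j))"
  by (rule SR.hom_degreeD(3)[OF act_degree[OF assms(1,2)] assms(3)])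

text \<open>The differential of a(u, t) in Hom has two descriptions: as a graded commutator, since
  a(u, t) has degree i + j, and as the image of d(u \<otimes> t) under \<open>M\<close>. Evaluating
  both at \<open>m\<close> and solving for d(a(u, t)(m)) gives three terms.\<close>

lemma act_dif:
  assumes u: "u \<in> grade (Hom \<U> U U') i" and t: "t \<in> grade (Hom \<T> T T') j"
    and m: "m \<in> carrier (onObj M (U, T'))"
  shows "dif (onObj M (U', T)) (act U U' T T' u t m) =
    (act U U' T T' (dif (Hom \<U> U U') u) t m \<oplus>\<^bsub>onObj M (U', T)\<^esub>
      sgn_pow (onObj M (U', T)) i (act U U' T T' u (dif (Hom \<T> T T') t) m)) \<oplus>\<^bsub>onObj M (U', T)\<^esub>
    sgn_pow (onObj M (U', T)) (i + j) (act U U' T T' u t (dif (onObj M (U, T')) m))"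
proof -
  let ?H = "hom_dg_module K (onObj M (U, T')) (onObj M (U', T))"
  interpret H: module K ?H by (rule SR.hom_dg_is_module)
  note c = HU.grade_closed[OF u] HT.grade_closed[OF t]
    linear_maps_closed[OF HU.dif_linear HU.grade_closed[OF u]]
    linear_maps_closed[OF HT.dif_linear HT.grade_closed[OF t]]
    linear_maps_closed[OF S.dif_linear m]
  have cH: "act U U' T T' u t \<in> carrier ?H"
    if "u \<in> carrier (Hom \<U> U U')" "t \<in> carrier (Hom \<T> T T')" for u t
    using act_hom_carrier[OF that] by (simp add: hom_dg_simps)
  have ev: "(\<lambda>f. f m) \<in> linear_maps K ?H (onObj M (U', T))"
    using SR.hom_eval_linear[OF m] by (simp add: linear_maps_hom_dg)
  note h = act_degree[OF u t]
  have "dif (onObj M (U', T)) (act U U' T T' u t m) \<ominus>\<^bsub>onObj M (U', T)\<^esub>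
      sgn_pow (onObj M (U', T)) (i + j) (act U U' T T' u t (dif (onObj M (U, T')) m))
    = dif ?H (act U U' T T' u t) m"
    using m by (simp add: SR.hom_dif_homogeneous[OF h])
  also have "\<dots> = (act U U' T T' (dif (Hom \<U> U U') u) t \<oplus>\<^bsub>?H\<^esub>
      sgn_pow ?H i (act U U' T T' u (dif (Hom \<T> T T') t))) m"
    using dg_morphism_tensor_pure(2)[OF HU.dg_module_axioms HT.dg_module_axioms H.module_axioms onHom_morphism u t]
    by simp
  also have "\<dots> = act U U' T T' (dif (Hom \<U> U U') u) t m \<oplus>\<^bsub>onObj M (U', T)\<^esub>
      sgn_pow (onObj M (U', T)) i (act U U' T T' u (dif (Hom \<T> T T') t) m)"
    using linear_maps_add[OF ev cH[OF c(3,2)] sgn_pow_closed[OF H.module_axioms cH[OF c(1,4)]]]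
      linear_maps_sgn_pow[OF H.module_axioms R.module_axioms ev cH[OF c(1,4)]] by simp
  finally have eq: "dif (onObj M (U', T)) (act U U' T T' u t m) \<ominus>\<^bsub>onObj M (U', T)\<^esub>
      sgn_pow (onObj M (U', T)) (i + j) (act U U' T T' u t (dif (onObj M (U, T')) m)) = \<dots>" .
  have "dif (onObj M (U', T)) (act U U' T T' u t m) \<in> carrier (onObj M (U', T))"
    by (rule linear_maps_closed[OF R.dif_linear act_closed[OF c(1,2) m]])
  moreover have "sgn_pow (onObj M (U', T)) (i + j) (act U U' T T' u t (dif (onObj M (U, T')) m)) \<in> carrier (onObj M (U', T))"
    by (rule sgn_pow_closed[OF R.module_axioms act_closed[OF c(1,2,5)]])
  ultimately show ?thesis
    unfolding eq[symmetric] by (simp add: a_minus_def R.M.a_assoc R.M.l_neg)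
qed

end

section \<open>Functoriality of the maps M(u \<otimes> t^op)\<close>

lemma act_Ide:
  assumes "U \<in> Obj \<U>" "T \<in> Obj \<T>" "m \<in> carrier (onObj M (U, T))"
  shows "act U U T T (Ide \<U> U) (Ide \<T> T) m = m"
  using M.onHom_Ide[of "(U, T)"] assms by (simp add: tensor_category_simps opposite_simps DgMod_simps)

lemma act_act:
  assumes obj: "U \<in> Obj \<U>" "U' \<in> Obj \<U>" "U'' \<in> Obj \<U>" "T \<in> Obj \<T>" "T' \<in> Obj \<T>" "T'' \<in> Obj \<T>"
    and u2: "u\<^sub>2 \<in> carrier (Hom \<U> U' U'')" and t2: "t\<^sub>2 \<in> grade (Hom \<T> T T') j\<^sub>2"
    and u1: "u\<^sub>1 \<in> grade (Hom \<U> U U') i\<^sub>1" and t1: "t\<^sub>1 \<in> grade (Hom \<T> T' T'') j\<^sub>1"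
    and m: "m \<in> carrier (onObj M (U, T''))"
  shows "act U' U'' T T' u\<^sub>2 t\<^sub>2 (act U U' T' T'' u\<^sub>1 t\<^sub>1 m) =
    sgn_pow (onObj M (U'', T)) (j\<^sub>2 * (i\<^sub>1 + j\<^sub>1))
      (act U U'' T T'' (Comp \<U> U U' U'' u\<^sub>2 u\<^sub>1) (Comp \<T> T T' T'' t\<^sub>1 t\<^sub>2) m)"
proof -
  note gm = Hom_gr_module and mU = \<U>.Hom_module and mT = \<T>.Hom_module
  let ?pt = "pure_tensor K (Hom \<U> U U'') (Hom \<T> T T'')"
  let ?C = "tensor_category K \<U> (opposite \<T>)"
  let ?p2 = "pure_tensor K (Hom \<U> U' U'') (Hom \<T> T T') u\<^sub>2 t\<^sub>2"
  let ?p1 = "pure_tensor K (Hom \<U> U U') (Hom \<T> T' T'') u\<^sub>1 t\<^sub>1"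
  let ?N = "onObj M (U'', T)"
  have N: "module K ?N" by (rule value_module[OF obj(3,4)])
  note c = gr_module.grade_closed[OF gm(2)[OF obj(1,2)] u1] gr_module.grade_closed[OF gm(1)[OF obj(4,5)] t2]
    gr_module.grade_closed[OF gm(1)[OF obj(5,6)] t1]
  have cu: "Comp \<U> U U' U'' u\<^sub>2 u\<^sub>1 \<in> carrier (Hom \<U> U U'')"
    by (rule bilinear_map_closed[OF \<U>.Comp_bilinear[OF obj(1,2,3)] u2 c(1)])
  have ct: "Comp \<T> T T' T'' t\<^sub>1 t\<^sub>2 \<in> carrier (Hom \<T> T T'')"
    by (rule bilinear_map_closed[OF \<T>.Comp_bilinear[OF obj(4,5,6)] c(3,2)])
  have P: "module K (tensor_module K (Hom \<U> U U'') (Hom \<T> T T''))"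
    by (rule tensor_module_module[OF mU[OF obj(1,3)] mT[OF obj(4,6)]])
  have PP: "module K (tensor K (Hom \<U> U U'') (Hom \<T> T T''))"
    by (rule tensor_is_module[OF mU[OF obj(1,3)] mT[OF obj(4,6)]])
  have pure: "pure_tensor K (Hom \<U> V V') (Hom \<T> S S') u t \<in> carrier (tensor K (Hom \<U> V V') (Hom \<T> S S'))"
    if "V \<in> Obj \<U>" "V' \<in> Obj \<U>" "S \<in> Obj \<T>" "S' \<in> Obj \<T>" "u \<in> carrier (Hom \<U> V V')" "t \<in> carrier (Hom \<T> S S')"
    for V V' S S' u t
    unfolding tensor_simps
    by (rule bilinear_map_closed[OF pure_tensor_bilinear[OF mU[OF that(1,2)] mT[OF that(3,4)]] that(5,6)])
  have "act U' U'' T T' u\<^sub>2 t\<^sub>2 (act U U' T' T'' u\<^sub>1 t\<^sub>1 m)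
      = onHom M (U, T'') (U'', T) (Comp ?C (U, T'') (U', T') (U'', T) ?p2 ?p1) m"
    using M.onHom_Comp[of "(U, T'')" "(U', T')" "(U'', T)" ?p1 ?p2] obj m
      pure[OF obj(2,3,4,5) u2 c(2)] pure[OF obj(1,2,5,6) c(1,3)]
    by (simp add: tensor_category_simps opposite_simps DgMod_simps compose_def)
  \<comment> \<open>First part of the sign: composition in the tensor product category moves
    \<open>t\<^sub>2\<close> past \<open>u\<^sub>1\<close>.\<close>
  also have "Comp ?C (U, T'') (U', T') (U'', T) ?p2 ?p1 =
      sgn_pow (tensor K (Hom \<U> U U'') (Hom \<T> T T'')) (j\<^sub>2 * i\<^sub>1)
        (?pt (Comp \<U> U U' U'' u\<^sub>2 u\<^sub>1) (Comp (opposite \<T>) T'' T' T t\<^sub>2 t\<^sub>1))"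
    using tensor_category_Comp_pure[of K \<U> U U' U'' "opposite \<T>" T'' T' T, unfolded opposite_simps,
        OF gm(2)[OF obj(1,2)] mU[OF obj(2,3)] mU[OF obj(1,3)] mT[OF obj(5,6)] gm(1)[OF obj(4,5)] mT[OF obj(4,6)]
          \<U>.Comp_bilinear[OF obj(1,2,3)] \<T>.opposite_Comp_bilinear(1)[OF obj(6,5,4)] u2 t2 u1 c(3)] .
  also have "Comp (opposite \<T>) T'' T' T t\<^sub>2 t\<^sub>1 = sgn_pow (Hom \<T> T T'') (j\<^sub>2 * j\<^sub>1) (Comp \<T> T T' T'' t\<^sub>1 t\<^sub>2)"
    by (rule \<T>.opposite_Comp_bilinear(2)[OF obj(6,5,4) t2 t1])
  also have "onHom M (U, T'') (U'', T) (sgn_pow (tensor K (Hom \<U> U U'') (Hom \<T> T T'')) (j\<^sub>2 * i\<^sub>1)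
        (?pt (Comp \<U> U U' U'' u\<^sub>2 u\<^sub>1) (sgn_pow (Hom \<T> T T'') (j\<^sub>2 * j\<^sub>1) (Comp \<T> T T' T'' t\<^sub>1 t\<^sub>2)))) m
    = sgn_pow ?N (j\<^sub>2 * i\<^sub>1) (act U U'' T T'' (Comp \<U> U U' U'' u\<^sub>2 u\<^sub>1)
        (sgn_pow (Hom \<T> T T'') (j\<^sub>2 * j\<^sub>1) (Comp \<T> T T' T'' t\<^sub>1 t\<^sub>2)) m)"
  proof -
    interpret SR: dg_module_pair K "onObj M (U, T'')" ?N
      by (intro dg_module_pair.intro value_dg_module obj)
    have "onHom M (U, T'') (U'', T) \<in> linear_maps K (tensor K (Hom \<U> U U'') (Hom \<T> T T'')) SR.H"
      using dg_morphism_linear[OF onHom_morphism[OF obj(1,3,4,6)]] by (simp add: linear_maps_hom_dg)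
    from linear_maps_sgn_pow[OF PP N linear_maps_comp[OF this SR.hom_eval_linear[OF m]]
        pure[OF obj(1,3,4,6) cu sgn_pow_closed[OF mT[OF obj(4,6)] ct]]]
    show ?thesis .
  qed
  also have "act U U'' T T'' (Comp \<U> U U' U'' u\<^sub>2 u\<^sub>1) (sgn_pow (Hom \<T> T T'') (j\<^sub>2 * j\<^sub>1) (Comp \<T> T T' T'' t\<^sub>1 t\<^sub>2)) m
    = sgn_pow ?N (j\<^sub>2 * j\<^sub>1) (act U U'' T T'' (Comp \<U> U U' U'' u\<^sub>2 u\<^sub>1) (Comp \<T> T T' T'' t\<^sub>1 t\<^sub>2) m)"
    by (rule linear_maps_sgn_pow[OF mT[OF obj(4,6)] N
          bilinear_map_right[OF act_bilinear[OF obj(1,3,4,6) m] cu] ct])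
  also have "sgn_pow ?N (j\<^sub>2 * i\<^sub>1) \<dots> = sgn_pow ?N (j\<^sub>2 * (i\<^sub>1 + j\<^sub>1))
      (act U U'' T T'' (Comp \<U> U U' U'' u\<^sub>2 u\<^sub>1) (Comp \<T> T T' T'' t\<^sub>1 t\<^sub>2) m)"
    by (simp add: sgn_pow_sgn_pow[OF N act_closed[OF obj(1,3,4,6) cu ct m]] distrib_left)
  finally show ?thesis .
qed

end

section \<open>Bilinearity, degrees and Leibniz rules of the two actions\<close>

context dg_bimodule
begin

lemma left_act_eq: "left_act K \<T> \<U> M U U' T u m = act U U' T T u (Ide \<T> T) m"
  by (simp add: left_act_def opposite_simps)

lemma right_act_eq:
  "right_act K \<T> \<U> M U T T' = bilinear_ext (onObj M (U, T')) (Hom \<T> T T') (onObj M (U, T))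
    (\<lambda>i j m t. sgn_pow (onObj M (U, T)) (i * j) (act U U T T' (Ide \<U> U) t m))"
  by (simp add: right_act_def opposite_simps fun_eq_iff)

lemma left_act_bilinear:
  assumes "U \<in> Obj \<U>" "U' \<in> Obj \<U>" "T \<in> Obj \<T>"
  shows "bilinear_map K (Hom \<U> U U') (onObj M (U, T)) (onObj M (U', T)) (left_act K \<T> \<U> M U U' T)"
  unfolding left_act_eq[abs_def]
  by (intro bilinear_mapI act_linear bilinear_map_left[OF act_bilinear] assms \<T>.Ide_closed)

text \<open>\<open>bilinear_ext\<close> requires its formula to be bilinear on the full carriers for
  every pair of degrees, so the sign exponent is an arbitrary \<open>n\<close> here.\<close>

lemma right_act_aux_bilinear:
  assumes "U \<in> Obj \<U>" "T \<in> Obj \<T>" "T' \<in> Obj \<T>"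
  shows "bilinear_map K (onObj M (U, T')) (Hom \<T> T T') (onObj M (U, T))
    (\<lambda>m t. sgn_pow (onObj M (U, T)) n (act U U T T' (Ide \<U> U) t m))"
  by (intro bilinear_map_sgn_pow[OF value_module] bilinear_mapI act_linear
      bilinear_map_right[OF act_bilinear] assms \<U>.Ide_closed)

lemma right_act_bilinear:
  assumes "U \<in> Obj \<U>" "T \<in> Obj \<T>" "T' \<in> Obj \<T>"
  shows "bilinear_map K (onObj M (U, T')) (Hom \<T> T T') (onObj M (U, T)) (right_act K \<T> \<U> M U T T')"
  unfolding right_act_eq
  by (intro bilinear_ext_bilinear value_gr_module value_module Hom_gr_module right_act_aux_bilinear assms)

lemma right_act_homogeneous:
  assumes "U \<in> Obj \<U>" "T \<in> Obj \<T>" "T' \<in> Obj \<T>"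
    and "m \<in> grade (onObj M (U, T')) i" "t \<in> grade (Hom \<T> T T') j"
  shows "right_act K \<T> \<U> M U T T' m t =
    sgn_pow (onObj M (U, T)) (i * j) (act U U T T' (Ide \<U> U) t m)"
  unfolding right_act_eq
  by (rule bilinear_ext_homogeneous[OF value_gr_module Hom_gr_module(1) value_module right_act_aux_bilinear])
    (use assms in auto)

lemma left_act_grade:
  assumes "U \<in> Obj \<U>" "U' \<in> Obj \<U>" "T \<in> Obj \<T>"
    and "u \<in> grade (Hom \<U> U U') i" "m \<in> grade (onObj M (U, T)) j"
  shows "left_act K \<T> \<U> M U U' T u m \<in> grade (onObj M (U', T)) (i + j)"
  using act_grade[OF assms(1,2,3,3,4) \<T>.Ide_grade[OF assms(3)] assms(5)]
  by (simp add: left_act_eq add.commute)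

lemma right_act_grade:
  assumes "U \<in> Obj \<U>" "T \<in> Obj \<T>" "T' \<in> Obj \<T>"
    and "m \<in> grade (onObj M (U, T')) i" "t \<in> grade (Hom \<T> T T') j"
  shows "right_act K \<T> \<U> M U T T' m t \<in> grade (onObj M (U, T)) (i + j)"
  using gr_module.grade_sgn_pow[OF value_gr_module[OF assms(1,2)]
      act_grade[OF assms(1,1,2,3) \<U>.Ide_grade[OF assms(1)] assms(5,4)]]
  by (simp add: right_act_homogeneous[OF assms])

text \<open>In \<open>act_dif\<close> with an identity in the second slot the middle term
  disappears, as identities are closed, and the exponent i + 0 remains for the last one. No sign
  depends on the degree of \<open>m\<close>, so \<open>m\<close> is arbitrary.\<close>

lemma left_act_dif:
  assumes obj: "U \<in> Obj \<U>" "U' \<in> Obj \<U>" "T \<in> Obj \<T>"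
    and u: "u \<in> grade (Hom \<U> U U') i" and m: "m \<in> carrier (onObj M (U, T))"
  shows "dif (onObj M (U', T)) (left_act K \<T> \<U> M U U' T u m) =
    left_act K \<T> \<U> M U U' T (dif (Hom \<U> U U') u) m \<oplus>\<^bsub>onObj M (U', T)\<^esub>
      sgn_pow (onObj M (U', T)) i (left_act K \<T> \<U> M U U' T u (dif (onObj M (U, T)) m))"
proof -
  let ?N = "onObj M (U', T)"
  interpret N: dg_module K ?N by (rule value_dg_module[OF obj(2,3)])
  interpret HU: dg_module K "Hom \<U> U U'" by (rule \<U>.Hom_dg_module[OF obj(1,2)])
  note uc = HU.grade_closed[OF u]
  have zero: "act U U' T T u \<zero>\<^bsub>Hom \<T> T T\<^esub> m = \<zero>\<^bsub>?N\<^esub>"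
    by (rule linear_maps_zero[OF \<T>.Hom_module[OF obj(3,3)] N.module_axioms
          bilinear_map_right[OF act_bilinear[OF obj(1,2,3,3) m] uc]])
  have "act U U' T T (dif (Hom \<U> U U') u) (Ide \<T> T) m \<in> carrier ?N"
    by (rule act_closed[OF obj(1,2,3,3) linear_maps_closed[OF HU.dif_linear uc] \<T>.Ide_closed[OF obj(3)] m])
  then show ?thesis
    using act_dif[OF obj(1,2,3,3) u \<T>.Ide_grade[OF obj(3)] m]
    by (simp add: left_act_eq \<T>.Ide_dif[OF obj(3)] zero
        linear_maps_zero[OF N.module_axioms N.module_axioms sgn_pow_linear[OF N.module_axioms]])
qed

lemma right_act_dif:
  assumes obj: "U \<in> Obj \<U>" "T \<in> Obj \<T>" "T' \<in> Obj \<T>"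
    and m: "m \<in> grade (onObj M (U, T')) i" and t: "t \<in> grade (Hom \<T> T T') j"
  shows "dif (onObj M (U, T)) (right_act K \<T> \<U> M U T T' m t) =
    right_act K \<T> \<U> M U T T' (dif (onObj M (U, T')) m) t \<oplus>\<^bsub>onObj M (U, T)\<^esub>
      sgn_pow (onObj M (U, T)) i (right_act K \<T> \<U> M U T T' m (dif (Hom \<T> T T') t))"
proof -
  let ?N = "onObj M (U, T)" and ?act = "act U U T T' (Ide \<U> U)"
  interpret N: dg_module K ?N by (rule value_dg_module[OF obj(1,2)])
  interpret S: dg_module K "onObj M (U, T')" by (rule value_dg_module[OF obj(1,3)])
  interpret HT: dg_module K "Hom \<T> T T'" by (rule \<T>.Hom_dg_module[OF obj(2,3)])
  note mc = S.grade_closed[OF m] and tc = HT.grade_closed[OF t]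
  note dmc = linear_maps_closed[OF S.dif_linear mc] and dtc = linear_maps_closed[OF HT.dif_linear tc]
  note e = \<U>.Ide_closed[OF obj(1)]
  note cl = act_closed[OF obj(1,1,2,3) e]
  have zero: "act U U T T' \<zero>\<^bsub>Hom \<U> U U\<^esub> t m = \<zero>\<^bsub>?N\<^esub>"
    by (rule linear_maps_zero[OF \<U>.Hom_module[OF obj(1,1)] N.module_axioms
          bilinear_map_left[OF act_bilinear[OF obj(1,1,2,3) mc] tc]])
  have d: "dif ?N (?act t m) = ?act (dif (Hom \<T> T T') t) m \<oplus>\<^bsub>?N\<^esub>
      sgn_pow ?N j (?act t (dif (onObj M (U, T')) m))"
    using act_dif[OF obj(1,1,2,3) \<U>.Ide_grade[OF obj(1)] t mc] cl[OF dtc mc]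
    by (simp add: \<U>.Ide_dif[OF obj(1)] zero) (simp add: sgn_pow_def)
  have "dif ?N (right_act K \<T> \<U> M U T T' m t) = sgn_pow ?N (i * j) (dif ?N (?act t m))"
    unfolding right_act_homogeneous[OF obj m t]
    by (rule linear_maps_sgn_pow[OF N.module_axioms N.module_axioms N.dif_linear cl[OF tc mc]])
  also have "\<dots> = sgn_pow ?N (i * j) (?act (dif (Hom \<T> T T') t) m) \<oplus>\<^bsub>?N\<^esub>
      sgn_pow ?N (i * j + j) (?act t (dif (onObj M (U, T')) m))"
    unfolding d
    using cl[OF dtc mc] cl[OF tc dmc]
    by (simp add: linear_maps_add[OF sgn_pow_linear[OF N.module_axioms]] sgn_pow_closed[OF N.module_axioms]
        sgn_pow_sgn_pow[OF N.module_axioms])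
  \<comment> \<open>Two exponents are adjusted. The one at d(m) is ij + j = (i + 1)j, the sign of
    the right action on d(m), which has degree i + 1. The one at d(t) is ij, which differs from i +
    i(j + 1) by 2i, and d(t) has degree j + 1.\<close>
  also have "\<dots> = sgn_pow ?N ((i + 1) * j) (?act t (dif (onObj M (U, T')) m)) \<oplus>\<^bsub>?N\<^esub>
      sgn_pow ?N i (sgn_pow ?N (i * (j + 1)) (?act (dif (Hom \<T> T T') t) m))"
  proof -
    have "sgn_pow ?N i (sgn_pow ?N (i * (j + 1)) (?act (dif (Hom \<T> T T') t) m)) =
        sgn_pow ?N (i * j) (?act (dif (Hom \<T> T T') t) m)"
      by (subst sgn_pow_sgn_pow[OF N.module_axioms cl[OF dtc mc]], rule sgn_pow_cong) auto
    then show ?thesis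
      using N.M.a_comm sgn_pow_closed[OF N.module_axioms cl[OF dtc mc]]
        sgn_pow_closed[OF N.module_axioms cl[OF tc dmc]] by (simp add: distrib_right)
  qed
  also have "\<dots> = right_act K \<T> \<U> M U T T' (dif (onObj M (U, T')) m) t \<oplus>\<^bsub>?N\<^esub>
      sgn_pow ?N i (right_act K \<T> \<U> M U T T' m (dif (Hom \<T> T T') t))"
    by (simp add: right_act_homogeneous[OF obj S.dif_degree[OF m] t]
        right_act_homogeneous[OF obj m HT.dif_degree[OF t]])
  finally show ?thesis .
qed

section \<open>The bimodule axioms\<close>

lemma left_act_Ide:
  assumes "U \<in> Obj \<U>" "T \<in> Obj \<T>" "m \<in> carrier (onObj M (U, T))"
  shows "left_act K \<T> \<U> M U U T (Ide \<U> U) m = m"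
  unfolding left_act_eq by (rule act_Ide[OF assms])

lemma right_act_Ide:
  assumes obj: "U \<in> Obj \<U>" "T \<in> Obj \<T>" and m: "m \<in> carrier (onObj M (U, T))"
  shows "right_act K \<T> \<U> M U T T m (Ide \<T> T) = m"
proof (rule gr_module.linear_eq_on_grades[OF value_gr_module[OF obj] value_module[OF obj]
      bilinear_map_left[OF right_act_bilinear[OF obj(1,2,2)] \<T>.Ide_closed[OF obj(2)]] linear_maps_id _ m])
  fix i m assume m: "m \<in> grade (onObj M (U, T)) i"
  show "right_act K \<T> \<U> M U T T m (Ide \<T> T) = m"
    using act_Ide[OF obj gr_module.grade_closed[OF value_gr_module[OF obj] m]]
    by (simp add: right_act_homogeneous[OF obj(1,2,2) m \<T>.Ide_grade[OF obj(2)]] sgn_pow_def)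
qed

lemma left_act_left_act:
  assumes obj: "U \<in> Obj \<U>" "U' \<in> Obj \<U>" "U'' \<in> Obj \<U>" "T \<in> Obj \<T>"
    and "u\<^sub>2 \<in> carrier (Hom \<U> U' U'')" "u\<^sub>1 \<in> carrier (Hom \<U> U U')" "m \<in> carrier (onObj M (U, T))"
  shows "left_act K \<T> \<U> M U' U'' T u\<^sub>2 (left_act K \<T> \<U> M U U' T u\<^sub>1 m) =
    left_act K \<T> \<U> M U U'' T (Comp \<U> U U' U'' u\<^sub>2 u\<^sub>1) m"
proof -
  note l1 = left_act_bilinear[OF obj(1,2,4)] and l2 = left_act_bilinear[OF obj(2,3,4)]
    and l3 = left_act_bilinear[OF obj(1,3,4)] and c = \<U>.Comp_bilinear[OF obj(1-3)]
  note N = value_module[OF obj(3,4)]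
  show ?thesis
  proof (rule trilinear_eq_on_grades[OF Hom_gr_module(2)[OF obj(2,3)] Hom_gr_module(2)[OF obj(1,2)]
        value_gr_module[OF obj(1,4)] N _ _ _ _ _ _ _ assms(5-7),
        where f = "\<lambda>u\<^sub>2 u\<^sub>1 m. left_act K \<T> \<U> M U' U'' T u\<^sub>2 (left_act K \<T> \<U> M U U' T u\<^sub>1 m)"
          and g = "\<lambda>u\<^sub>2 u\<^sub>1 m. left_act K \<T> \<U> M U U'' T (Comp \<U> U U' U'' u\<^sub>2 u\<^sub>1) m"],
      goal_cases)
    case (1 u1 m)
    show ?case by (rule bilinear_map_left[OF l2 bilinear_map_closed[OF l1 1]])
  next
    case (2 u2 m)
    show ?case by (rule linear_maps_comp[OF bilinear_map_left[OF l1 2(2)] bilinear_map_right[OF l2 2(1)]])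
  next
    case (3 u2 u1)
    show ?case by (rule linear_maps_comp[OF bilinear_map_right[OF l1 3(2)] bilinear_map_right[OF l2 3(1)]])
  next
    case (4 u1 m)
    show ?case by (rule linear_maps_comp[OF bilinear_map_left[OF c 4(1)] bilinear_map_left[OF l3 4(2)]])
  next
    case (5 u2 m)
    show ?case by (rule linear_maps_comp[OF bilinear_map_right[OF c 5(1)] bilinear_map_left[OF l3 5(2)]])
  next
    case (6 u2 u1)
    show ?case by (rule bilinear_map_right[OF l3 bilinear_map_closed[OF c 6]])
  next
    case (7 i j k u2 u1 m)
    show ?case
      \<comment> \<open>Both entries in the second slot are identities of degree zero, so the
        exponent in \<open>act_act\<close> vanishes.\<close>
      using act_act[OF obj(1-4,4,4) gr_module.grade_closed[OF Hom_gr_module(2)[OF obj(2,3)] 7(1)]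
          \<T>.Ide_grade[OF obj(4)] 7(2) \<T>.Ide_grade[OF obj(4)]
          gr_module.grade_closed[OF value_gr_module[OF obj(1,4)] 7(3)]]
      by (simp add: left_act_eq \<T>.Ide_left[OF obj(4,4) \<T>.Ide_closed[OF obj(4)]] sgn_pow_def)
  qed
qed

lemma right_act_right_act:
  assumes obj: "U \<in> Obj \<U>" "T \<in> Obj \<T>" "T' \<in> Obj \<T>" "T'' \<in> Obj \<T>"
    and "m \<in> carrier (onObj M (U, T''))" "t\<^sub>2 \<in> carrier (Hom \<T> T' T'')" "t\<^sub>1 \<in> carrier (Hom \<T> T T')"
  shows "right_act K \<T> \<U> M U T T' (right_act K \<T> \<U> M U T' T'' m t\<^sub>2) t\<^sub>1 =
    right_act K \<T> \<U> M U T T'' m (Comp \<T> T T' T'' t\<^sub>2 t\<^sub>1)"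
proof -
  note r1 = right_act_bilinear[OF obj(1,2,3)] and r2 = right_act_bilinear[OF obj(1,3,4)]
    and r3 = right_act_bilinear[OF obj(1,2,4)] and c = \<T>.Comp_bilinear[OF obj(2-4)]
  note N = value_module[OF obj(1,2)]
  show ?thesis
  proof (rule trilinear_eq_on_grades[OF value_gr_module[OF obj(1,4)] Hom_gr_module(1)[OF obj(3,4)]
        Hom_gr_module(1)[OF obj(2,3)] N _ _ _ _ _ _ _ assms(5-7),
        where f = "\<lambda>m t\<^sub>2 t\<^sub>1. right_act K \<T> \<U> M U T T' (right_act K \<T> \<U> M U T' T'' m t\<^sub>2) t\<^sub>1"
          and g = "\<lambda>m t\<^sub>2 t\<^sub>1. right_act K \<T> \<U> M U T T'' m (Comp \<T> T T' T'' t\<^sub>2 t\<^sub>1)"],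
      goal_cases)
    case (1 t2 t1)
    show ?case by (rule linear_maps_comp[OF bilinear_map_left[OF r2 1(1)] bilinear_map_left[OF r1 1(2)]])
  next
    case (2 m t1)
    show ?case by (rule linear_maps_comp[OF bilinear_map_right[OF r2 2(1)] bilinear_map_left[OF r1 2(2)]])
  next
    case (3 m t2)
    show ?case by (rule bilinear_map_right[OF r1 bilinear_map_closed[OF r2 3]])
  next
    case (4 t2 t1)
    show ?case by (rule bilinear_map_left[OF r3 bilinear_map_closed[OF c 4]])
  next
    case (5 m t1)
    show ?case by (rule linear_maps_comp[OF bilinear_map_left[OF c 5(2)] bilinear_map_right[OF r3 5(1)]])
  next
    case (6 m t2)
    show ?case by (rule linear_maps_comp[OF bilinear_map_right[OF c 6(2)] bilinear_map_right[OF r3 6(1)]])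
  next
    case (7 i j k m t2 t1)
    interpret S: gr_module K "onObj M (U, T'')" by (rule value_gr_module[OF obj(1,4)])
    let ?a = "act U U T T'' (Ide \<U> U) (Comp \<T> T T' T'' t2 t1) m"
    let ?N = "onObj M (U, T)"
    note e = \<U>.Ide_closed[OF obj(1)]
    note mc = S.grade_closed[OF 7(1)]
    note t2c = gr_module.grade_closed[OF Hom_gr_module(1)[OF obj(3,4)] 7(2)]
    note t1c = gr_module.grade_closed[OF Hom_gr_module(1)[OF obj(2,3)] 7(3)]
    have ac: "?a \<in> carrier ?N"
      by (rule act_closed[OF obj(1,1,2,4) e bilinear_map_closed[OF c t2c t1c] mc])
    have "right_act K \<T> \<U> M U T T' (right_act K \<T> \<U> M U T' T'' m t2) t1
        = sgn_pow ?N ((i + j) * k) (act U U T T' (Ide \<U> U) t1 (right_act K \<T> \<U> M U T' T'' m t2))"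
      by (rule right_act_homogeneous[OF obj(1-3) right_act_grade[OF obj(1,3,4) 7(1,2)] 7(3)])
    also have "act U U T T' (Ide \<U> U) t1 (right_act K \<T> \<U> M U T' T'' m t2)
        = sgn_pow ?N (i * j) (act U U T T' (Ide \<U> U) t1 (act U U T' T'' (Ide \<U> U) t2 m))"
      unfolding right_act_homogeneous[OF obj(1,3,4) 7(1,2)]
      by (rule linear_maps_sgn_pow[OF value_module[OF obj(1,3)] N act_linear[OF obj(1,1,2,3) e t1c]
            act_closed[OF obj(1,1,3,4) e t2c mc]])
    \<comment> \<open>Contravariance in \<open>\<T>\<close>: acting with \<open>t2\<close> and then
      with \<open>t1\<close> is acting with t2 \<circ> t1, at the price of the sign from the
      opposite category.\<close>
    also have "act U U T T' (Ide \<U> U) t1 (act U U T' T'' (Ide \<U> U) t2 m) = sgn_pow ?N (k * j) ?a"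
      using act_act[OF obj(1,1,1,2-4) e 7(3) \<U>.Ide_grade[OF obj(1)] 7(2) mc]
      by (simp add: \<U>.Ide_left[OF obj(1,1) e])
    \<comment> \<open>The exponents add up to (i + j)k + ij + kj = i(j + k) + 2jk, and i(j + k) is
      the sign for acting on \<open>m\<close> with the composite.\<close>
    also have "sgn_pow ?N ((i + j) * k) (sgn_pow ?N (i * j) (sgn_pow ?N (k * j) ?a)) = sgn_pow ?N (i * (j + k)) ?a"
      using ac by (simp add: sgn_pow_sgn_pow[OF N] sgn_pow_closed[OF N])
        (rule sgn_pow_cong, auto)
    also have "\<dots> = right_act K \<T> \<U> M U T T'' m (Comp \<T> T T' T'' t2 t1)"
      by (rule right_act_homogeneous[OF obj(1,2,4) 7(1) \<T>.Comp_grade[OF obj(2-4) 7(2,3)], symmetric])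
    finally show ?case .
  qed
qed

lemma right_act_left_act:
  assumes obj: "U \<in> Obj \<U>" "U' \<in> Obj \<U>" "T \<in> Obj \<T>" "T' \<in> Obj \<T>"
    and "u \<in> carrier (Hom \<U> U U')" "m \<in> carrier (onObj M (U, T'))" "t \<in> carrier (Hom \<T> T T')"
  shows "right_act K \<T> \<U> M U' T T' (left_act K \<T> \<U> M U U' T' u m) t =
    left_act K \<T> \<U> M U U' T u (right_act K \<T> \<U> M U T T' m t)"
proof -
  note l1 = left_act_bilinear[OF obj(1,2,4)] and r1 = right_act_bilinear[OF obj(2,3,4)]
    and r2 = right_act_bilinear[OF obj(1,3,4)] and l2 = left_act_bilinear[OF obj(1,2,3)]
  note N = value_module[OF obj(2,3)]
  show ?thesis
  proof (rule trilinear_eq_on_grades[OF Hom_gr_module(2)[OF obj(1,2)] value_gr_module[OF obj(1,4)]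
        Hom_gr_module(1)[OF obj(3,4)] N _ _ _ _ _ _ _ assms(5-7),
        where f = "\<lambda>u m t. right_act K \<T> \<U> M U' T T' (left_act K \<T> \<U> M U U' T' u m) t"
          and g = "\<lambda>u m t. left_act K \<T> \<U> M U U' T u (right_act K \<T> \<U> M U T T' m t)"],
      goal_cases)
    case (1 m t)
    show ?case by (rule linear_maps_comp[OF bilinear_map_left[OF l1 1(1)] bilinear_map_left[OF r1 1(2)]])
  next
    case (2 u t)
    show ?case by (rule linear_maps_comp[OF bilinear_map_right[OF l1 2(1)] bilinear_map_left[OF r1 2(2)]])
  next
    case (3 u m)
    show ?case by (rule bilinear_map_right[OF r1 bilinear_map_closed[OF l1 3]])
  next
    case (4 m t)
    show ?case by (rule bilinear_map_left[OF l2 bilinear_map_closed[OF r2 4]])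
  next
    case (5 u t)
    show ?case by (rule linear_maps_comp[OF bilinear_map_left[OF r2 5(2)] bilinear_map_right[OF l2 5(1)]])
  next
    case (6 u m)
    show ?case by (rule linear_maps_comp[OF bilinear_map_right[OF r2 6(2)] bilinear_map_right[OF l2 6(1)]])
  next
    case (7 i j k u m t)
    let ?a = "act U U' T T' u t m" and ?N = "onObj M (U', T)"
    note e = \<U>.Ide_closed[OF obj(1)] and e' = \<U>.Ide_closed[OF obj(2)] and f = \<T>.Ide_closed[OF obj(3)]
      and f' = \<T>.Ide_closed[OF obj(4)]
    note uc = gr_module.grade_closed[OF Hom_gr_module(2)[OF obj(1,2)] 7(1)]
    note mc = gr_module.grade_closed[OF value_gr_module[OF obj(1,4)] 7(2)]
    note tc = gr_module.grade_closed[OF Hom_gr_module(1)[OF obj(3,4)] 7(3)]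
    have ac: "?a \<in> carrier ?N" by (rule act_closed[OF obj uc tc mc])
    have "right_act K \<T> \<U> M U' T T' (left_act K \<T> \<U> M U U' T' u m) t
        = sgn_pow ?N ((i + j) * k) (act U' U' T T' (Ide \<U> U') t (act U U' T' T' u (Ide \<T> T') m))"
      using right_act_homogeneous[OF obj(2-4) left_act_grade[OF obj(1,2,4) 7(1,2)] 7(3)]
      by (simp add: left_act_eq)
    \<comment> \<open>Here \<open>t\<close> of degree k is moved past \<open>u\<close> of degree
      i.\<close>
    also have "act U' U' T T' (Ide \<U> U') t (act U U' T' T' u (Ide \<T> T') m) = sgn_pow ?N (k * i) ?a"
      using act_act[OF obj(1,2,2,3,4,4) e' 7(3,1) \<T>.Ide_grade[OF obj(4)] mc]
      by (simp add: \<U>.Ide_left[OF obj(1,2) uc] \<T>.Ide_left[OF obj(3,4) tc])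
    \<comment> \<open>The degree of u \<bullet> m contributes the exponent ik to the right action,
      and the interchange contributes it again; the two cancel and jk is left.\<close>
    also have "sgn_pow ?N ((i + j) * k) (sgn_pow ?N (k * i) ?a) = sgn_pow ?N (j * k) ?a"
      using ac by (simp add: sgn_pow_sgn_pow[OF N]) (rule sgn_pow_cong, auto)
    \<comment> \<open>In the other order the outer map has an identity in the second slot, so no
      sign arises.\<close>
    also have "?a = act U U' T T u (Ide \<T> T) (act U U T T' (Ide \<U> U) t m)"
      using act_act[OF obj(1,1,2,3,3,4) uc \<T>.Ide_grade[OF obj(3)] \<U>.Ide_grade[OF obj(1)] 7(3) mc]
      by (simp add: \<U>.Ide_right[OF obj(1,2) uc] \<T>.Ide_right[OF obj(3,4) tc] sgn_pow_def)
    also have "sgn_pow ?N (j * k) \<dots> = left_act K \<T> \<U> M U U' T u (right_act K \<T> \<U> M U T T' m t)"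
      unfolding right_act_homogeneous[OF obj(1,3,4) 7(2,3)] left_act_eq
      by (rule linear_maps_sgn_pow[OF value_module[OF obj(1,3)] N act_linear[OF obj(1,2,3,3) uc f]
            act_closed[OF obj(1,1,3,4) e tc mc], symmetric])
    finally show ?case .
  qed
qed

section \<open>The triangular matrix category\<close>

abbreviation "\<Lambda> \<equiv> triangular_category K \<T> \<U> M"

text \<open>Composition is stated with projections instead of patterns, so that it unfolds for
  arguments that are not literally triples and can be used under an abstraction when bilinearity is
  proved.\<close>

lemma triangular_simps:
  "Obj \<Lambda> = Obj \<T> \<times> Obj \<U>"
  "Comp \<Lambda> (T, U) (T', U') (T'', U'') x y =
    (Comp \<T> T T' T'' (fst x) (fst y),
     right_act K \<T> \<U> M U'' T T' (fst (snd x)) (fst y) \<oplus>\<^bsub>onObj M (U'', T)\<^esub>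
       left_act K \<T> \<U> M U' U'' T (snd (snd x)) (fst (snd y)),
     Comp \<U> U U' U'' (snd (snd x)) (snd (snd y)))"
  "Ide \<Lambda> (T, U) = (Ide \<T> T, \<zero>\<^bsub>onObj M (U, T)\<^esub>, Ide \<U> U)"
  by (simp_all add: triangular_category_def case_prod_beta)

lemma triangular_product:
  assumes "T \<in> Obj \<T>" "T' \<in> Obj \<T>" "U \<in> Obj \<U>" "U' \<in> Obj \<U>"
  shows "dg_product K (Hom \<T> T T') (onObj M (U', T)) (Hom \<U> U U') (Hom \<Lambda> (T, U) (T', U'))"
  by (intro dg_product.intro dg_product_axioms.intro \<T>.Hom_dg_module \<U>.Hom_dg_module value_dg_module assms)
    (simp_all add: triangular_category_def triangular_Hom_def Let_def)

section \<open>Composition of triangular matrices as a morphism of dg modules\<close>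

context
  fixes T T' T'' :: 't and U U' U'' :: 'u
  assumes T: "T \<in> Obj \<T>" "T' \<in> Obj \<T>" "T'' \<in> Obj \<T>" and U: "U \<in> Obj \<U>" "U' \<in> Obj \<U>" "U'' \<in> Obj \<U>"
begin

interpretation Y: dg_product K "Hom \<T> T' T''" "onObj M (U'', T')" "Hom \<U> U' U''" "Hom \<Lambda> (T', U') (T'', U'')"
  by (rule triangular_product[OF T(2,3) U(2,3)])
interpretation X: dg_product K "Hom \<T> T T'" "onObj M (U', T)" "Hom \<U> U U'" "Hom \<Lambda> (T, U) (T', U')"
  by (rule triangular_product[OF T(1,2) U(1,2)])
interpretation Z: dg_product K "Hom \<T> T T''" "onObj M (U'', T)" "Hom \<U> U U''" "Hom \<Lambda> (T, U) (T'', U'')"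
  by (rule triangular_product[OF T(1,3) U(1,3)])

lemma triangular_Comp_bilinear:
  "bilinear_map K (Hom \<Lambda> (T', U') (T'', U'')) (Hom \<Lambda> (T, U) (T', U')) (Hom \<Lambda> (T, U) (T'', U''))
    (Comp \<Lambda> (T, U) (T', U') (T'', U''))"
proof -
  note t = bilinear_map_comp[OF \<T>.Comp_bilinear[OF T] Y.proj_linear(1) X.proj_linear(1)]
    and r = bilinear_map_comp[OF right_act_bilinear[OF U(3) T(1,2)] Y.proj_linear(2) X.proj_linear(1)]
    and l = bilinear_map_comp[OF left_act_bilinear[OF U(2,3) T(1)] Y.proj_linear(3) X.proj_linear(2)]
    and u = bilinear_map_comp[OF \<U>.Comp_bilinear[OF U] Y.proj_linear(3) X.proj_linear(3)]
  note m = bilinear_map_plus[OF Z.B.module_axioms r l]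
  show ?thesis
    unfolding triangular_simps[abs_def]
    by (intro bilinear_mapI Z.tuple_linear bilinear_map_left[OF t] bilinear_map_left[OF m]
        bilinear_map_left[OF u] bilinear_map_right[OF t] bilinear_map_right[OF m] bilinear_map_right[OF u])
qed

lemma triangular_Comp_grade:
  assumes "y \<in> grade (Hom \<Lambda> (T', U') (T'', U'')) i" "x \<in> grade (Hom \<Lambda> (T, U) (T', U')) j"
  shows "Comp \<Lambda> (T, U) (T', U') (T'', U'') y x \<in> grade (Hom \<Lambda> (T, U) (T'', U'')) (i + j)"
  using assms
  by (auto simp: triangular_simps Y.grade_L X.grade_L Z.grade_L
      intro!: \<T>.Comp_grade \<U>.Comp_grade Z.B.grade_add right_act_grade left_act_grade T U)

text \<open>All entries of \<open>y\<close> have degree i, so the Leibniz rules of both compositions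
  and of both actions carry the same sign. In the corner entry the four resulting terms only need to
  be regrouped: those with a derivative from \<open>y\<close>, and those with one from
  \<open>x\<close>.\<close>

lemma triangular_Comp_dif:
  assumes y: "y \<in> grade (Hom \<Lambda> (T', U') (T'', U'')) i" and x: "x \<in> grade (Hom \<Lambda> (T, U) (T', U')) j"
  shows "dif (Hom \<Lambda> (T, U) (T'', U'')) (Comp \<Lambda> (T, U) (T', U') (T'', U'') y x) =
    Comp \<Lambda> (T, U) (T', U') (T'', U'') (dif (Hom \<Lambda> (T', U') (T'', U'')) y) x \<oplus>\<^bsub>Hom \<Lambda> (T, U) (T'', U'')\<^esub>
    sgn_pow (Hom \<Lambda> (T, U) (T'', U'')) i
      (Comp \<Lambda> (T, U) (T', U') (T'', U'') y (dif (Hom \<Lambda> (T, U) (T', U')) x))"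
proof -
  obtain t2 m2 u2 where y': "y = (t2, m2, u2)" by (cases y)
  obtain t1 m1 u1 where x': "x = (t1, m1, u1)" by (cases x)
  have g: "t2 \<in> grade (Hom \<T> T' T'') i" "m2 \<in> grade (onObj M (U'', T')) i" "u2 \<in> grade (Hom \<U> U' U'') i"
    "t1 \<in> grade (Hom \<T> T T') j" "m1 \<in> grade (onObj M (U', T)) j" "u1 \<in> grade (Hom \<U> U U') j"
    using x y by (simp_all add: x' y' X.grade_L Y.grade_L)
  note c = Y.A.grade_closed[OF g(1)] Y.B.grade_closed[OF g(2)] Y.D.grade_closed[OF g(3)]
    X.A.grade_closed[OF g(4)] X.B.grade_closed[OF g(5)] X.D.grade_closed[OF g(6)]
  note d = linear_maps_closed[OF Y.A.dif_linear c(1)] linear_maps_closed[OF Y.B.dif_linear c(2)]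
    linear_maps_closed[OF Y.D.dif_linear c(3)] linear_maps_closed[OF X.A.dif_linear c(4)]
    linear_maps_closed[OF X.B.dif_linear c(5)] linear_maps_closed[OF X.D.dif_linear c(6)]
  note cl = bilinear_map_closed[OF \<T>.Comp_bilinear[OF T]] bilinear_map_closed[OF \<U>.Comp_bilinear[OF U]]
    bilinear_map_closed[OF right_act_bilinear[OF U(3) T(1,2)]]
    bilinear_map_closed[OF left_act_bilinear[OF U(2,3) T(1)]]
  show ?thesis
    by (simp add: x' y' triangular_simps X.dif_L Y.dif_L Z.dif_L Z.add_L Z.sgn_pow_L c d cl
        \<T>.Comp_dif[OF T g(1,4)] \<U>.Comp_dif[OF U g(3,6)] linear_maps_add[OF Z.B.dif_linear]
        right_act_dif[OF U(3) T(1,2) g(2,4)] left_act_dif[OF U(2,3) T(1) g(3) c(5)]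
        linear_maps_add[OF sgn_pow_linear[OF Z.B.module_axioms]] sgn_pow_closed[OF Z.B.module_axioms]
        Z.B.M.add.m_ac)
qed

lemma triangular_Comp_dg_morphism:
  "dg_morphism K (tensor K (Hom \<Lambda> (T', U') (T'', U'')) (Hom \<Lambda> (T, U) (T', U'))) (Hom \<Lambda> (T, U) (T'', U''))
    (tensor_lift K (Hom \<Lambda> (T, U) (T'', U'')) (Comp \<Lambda> (T, U) (T', U') (T'', U'')))"
  by (rule dg_morphism_tensor_lift[OF Y.product_dg_module X.product_dg_module Z.product_dg_module
        triangular_Comp_bilinear triangular_Comp_grade triangular_Comp_dif])

lemma triangular_Comp_pure:
  "\<lbrakk>y \<in> carrier (Hom \<Lambda> (T', U') (T'', U'')); x \<in> carrier (Hom \<Lambda> (T, U) (T', U'))\<rbrakk> \<Longrightarrow>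
    tensor_lift K (Hom \<Lambda> (T, U) (T'', U'')) (Comp \<Lambda> (T, U) (T', U') (T'', U''))
      (pure_tensor K (Hom \<Lambda> (T', U') (T'', U'')) (Hom \<Lambda> (T, U) (T', U')) y x) =
    Comp \<Lambda> (T, U) (T', U') (T'', U'') y x"
  by (rule tensor_lift_pure[OF Y.product_module X.product_module Z.product_module triangular_Comp_bilinear])

end

section \<open>The category axioms for triangular matrices\<close>

lemma triangular_Hom_carrier:
  assumes "T \<in> Obj \<T>" "T' \<in> Obj \<T>" "U \<in> Obj \<U>" "U' \<in> Obj \<U>"
  shows "carrier (Hom \<Lambda> (T, U) (T', U')) = carrier (Hom \<T> T T') \<times> carrier (onObj M (U', T)) \<times> carrier (Hom \<U> U U')"
  by (rule dg_product.carrier_L[OF triangular_product[OF assms]])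

lemma triangular_Comp_assoc:
  assumes T: "T \<in> Obj \<T>" "T' \<in> Obj \<T>" "T'' \<in> Obj \<T>" "T''' \<in> Obj \<T>"
    and U: "U \<in> Obj \<U>" "U' \<in> Obj \<U>" "U'' \<in> Obj \<U>" "U''' \<in> Obj \<U>"
    and x: "x \<in> carrier (Hom \<Lambda> (T, U) (T', U'))" and y: "y \<in> carrier (Hom \<Lambda> (T', U') (T'', U''))"
    and z: "z \<in> carrier (Hom \<Lambda> (T'', U'') (T''', U'''))"
  shows "Comp \<Lambda> (T, U) (T', U') (T''', U''') (Comp \<Lambda> (T', U') (T'', U'') (T''', U''') z y) x =
    Comp \<Lambda> (T, U) (T'', U'') (T''', U''') z (Comp \<Lambda> (T, U) (T', U') (T'', U'') y x)"
proof -
  obtain t3 m3 u3 where z': "z = (t3, m3, u3)" by (cases z)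
  obtain t2 m2 u2 where y': "y = (t2, m2, u2)" by (cases y)
  obtain t1 m1 u1 where x': "x = (t1, m1, u1)" by (cases x)
  have c: "t3 \<in> carrier (Hom \<T> T'' T''')" "m3 \<in> carrier (onObj M (U''', T''))" "u3 \<in> carrier (Hom \<U> U'' U''')"
    "t2 \<in> carrier (Hom \<T> T' T'')" "m2 \<in> carrier (onObj M (U'', T'))" "u2 \<in> carrier (Hom \<U> U' U'')"
    "t1 \<in> carrier (Hom \<T> T T')" "m1 \<in> carrier (onObj M (U', T))" "u1 \<in> carrier (Hom \<U> U U')"
    using x y z by (simp_all add: x' y' z' triangular_Hom_carrier T U)
  interpret N: module K "onObj M (U''', T)" by (rule value_module[OF U(4) T(1)])
  note rc = bilinear_map_closed[OF right_act_bilinear] and lc = bilinear_map_closed[OF left_act_bilinear]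
  \<comment> \<open>Only the corner entry has content. Both bracketings give m3 \<bullet> (t2 t1) +
    u3 \<bullet> (m2 \<bullet> t1) + (u3 u2) \<bullet> m1; this step expands the left one and the
    next step the right one, each action law being used once.\<close>
  have "right_act K \<T> \<U> M U''' T T'
        (right_act K \<T> \<U> M U''' T' T'' m3 t2 \<oplus>\<^bsub>onObj M (U''', T')\<^esub> left_act K \<T> \<U> M U'' U''' T' u3 m2) t1
      = right_act K \<T> \<U> M U''' T T'' m3 (Comp \<T> T T' T'' t2 t1) \<oplus>\<^bsub>onObj M (U''', T)\<^esub>
        left_act K \<T> \<U> M U'' U''' T u3 (right_act K \<T> \<U> M U'' T T' m2 t1)"
    using linear_maps_add[OF bilinear_map_left[OF right_act_bilinear[OF U(4) T(1,2)] c(7)]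
        rc[OF U(4) T(2,3) c(2,4)] lc[OF U(3,4) T(2) c(3,5)]]
    by (simp add: right_act_right_act[OF U(4) T(1-3) c(2,4,7)] right_act_left_act[OF U(3,4) T(1,2) c(3,5,7)])
  moreover have "left_act K \<T> \<U> M U'' U''' T u3
        (right_act K \<T> \<U> M U'' T T' m2 t1 \<oplus>\<^bsub>onObj M (U'', T)\<^esub> left_act K \<T> \<U> M U' U'' T u2 m1)
      = left_act K \<T> \<U> M U'' U''' T u3 (right_act K \<T> \<U> M U'' T T' m2 t1) \<oplus>\<^bsub>onObj M (U''', T)\<^esub>
        left_act K \<T> \<U> M U' U''' T (Comp \<U> U' U'' U''' u3 u2) m1"
    using linear_maps_add[OF bilinear_map_right[OF left_act_bilinear[OF U(3,4) T(1)] c(3)]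
        rc[OF U(3) T(1,2) c(5,7)] lc[OF U(2,3) T(1) c(6,8)]]
    by (simp add: left_act_left_act[OF U(2-4) T(1) c(3,6,8)])
  moreover have "right_act K \<T> \<U> M U''' T T'' m3 (Comp \<T> T T' T'' t2 t1) \<in> carrier (onObj M (U''', T))"
    by (rule rc[OF U(4) T(1,3) c(2) bilinear_map_closed[OF \<T>.Comp_bilinear[OF T(1-3)] c(4,7)]])
  moreover have "left_act K \<T> \<U> M U'' U''' T u3 (right_act K \<T> \<U> M U'' T T' m2 t1) \<in> carrier (onObj M (U''', T))"
    by (rule lc[OF U(3,4) T(1) c(3) rc[OF U(3) T(1,2) c(5,7)]])
  moreover have "left_act K \<T> \<U> M U' U''' T (Comp \<U> U' U'' U''' u3 u2) m1 \<in> carrier (onObj M (U''', T))"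
    by (rule lc[OF U(2,4) T(1) bilinear_map_closed[OF \<U>.Comp_bilinear[OF U(2-4)] c(3,6)] c(8)])
  ultimately show ?thesis
    by (simp add: x' y' z' triangular_simps \<T>.Comp_assoc[OF T c(7,4,1)] \<U>.Comp_assoc[OF U c(9,6,3)] N.a_assoc)
qed

lemma triangular_dg_category: "dg_category K \<Lambda>"
proof (intro dg_category.intro K_category.intro dg_category_axioms.intro, goal_cases)
  case 1
  show ?case by (rule \<T>.cring_K)
next
  case (2 X Y)
  then show ?case
    by (cases X; cases Y) (auto simp: triangular_simps intro: dg_product.product_module[OF triangular_product])
next
  case (3 X Y Z)
  then show ?case
    by (cases X; cases Y; cases Z) (auto simp: triangular_simps(1) intro: triangular_Comp_bilinear)
next
  case (4 W X Y Z f g h)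
  then show ?case
    by (cases W; cases X; cases Y; cases Z) (auto simp: triangular_simps(1) intro: triangular_Comp_assoc)
next
  case (5 X)
  then obtain T U where X: "X = (T, U)" and T: "T \<in> Obj \<T>" and U: "U \<in> Obj \<U>"
    by (auto simp: triangular_simps(1))
  interpret N: gr_module K "onObj M (U, T)" by (rule value_gr_module[OF U T])
  show ?case
    by (simp add: X triangular_simps triangular_Hom_carrier T U \<T>.Ide_closed \<U>.Ide_closed)
next
  case (6 X Y f)
  then obtain T U T' U' where XY: "X = (T, U)" "Y = (T', U')" and T: "T \<in> Obj \<T>" "T' \<in> Obj \<T>"
    and U: "U \<in> Obj \<U>" "U' \<in> Obj \<U>"
    by (auto simp: triangular_simps(1))
  obtain t m u where f: "f = (t, m, u)" and c: "t \<in> carrier (Hom \<T> T T')" "m \<in> carrier (onObj M (U', T))"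
    "u \<in> carrier (Hom \<U> U U')"
    using 6(3) by (auto simp: XY triangular_Hom_carrier T U)
  interpret N: module K "onObj M (U', T)" by (rule value_module[OF U(2) T(1)])
  \<comment> \<open>The identity matrix has zero in its corner, so the corner of the product is 0
    \<bullet> t + 1 \<bullet> m.\<close>
  have "right_act K \<T> \<U> M U' T T' \<zero>\<^bsub>onObj M (U', T')\<^esub> t = \<zero>\<^bsub>onObj M (U', T)\<^esub>"
    by (rule linear_maps_zero[OF value_module[OF U(2) T(2)] N.module_axioms
          bilinear_map_left[OF right_act_bilinear[OF U(2) T] c(1)]])
  then show ?case
    by (simp add: XY f triangular_simps \<T>.Ide_left[OF T c(1)] \<U>.Ide_left[OF U c(3)]
        left_act_Ide[OF U(2) T(1) c(2)] c)
next
  case (7 X Y f)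
  then obtain T U T' U' where XY: "X = (T, U)" "Y = (T', U')" and T: "T \<in> Obj \<T>" "T' \<in> Obj \<T>"
    and U: "U \<in> Obj \<U>" "U' \<in> Obj \<U>"
    by (auto simp: triangular_simps(1))
  obtain t m u where f: "f = (t, m, u)" and c: "t \<in> carrier (Hom \<T> T T')" "m \<in> carrier (onObj M (U', T))"
    "u \<in> carrier (Hom \<U> U U')"
    using 7(3) by (auto simp: XY triangular_Hom_carrier T U)
  interpret N: module K "onObj M (U', T)" by (rule value_module[OF U(2) T(1)])
  \<comment> \<open>On the other side the corner is m \<bullet> 1 + u \<bullet> 0.\<close>
  have "left_act K \<T> \<U> M U U' T u \<zero>\<^bsub>onObj M (U, T)\<^esub> = \<zero>\<^bsub>onObj M (U', T)\<^esub>"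
    by (rule linear_maps_zero[OF value_module[OF U(1) T(1)] N.module_axioms
          bilinear_map_right[OF left_act_bilinear[OF U T(1)] c(3)]])
  then show ?case
    by (simp add: XY f triangular_simps \<T>.Ide_right[OF T c(1)] \<U>.Ide_right[OF U c(3)]
        right_act_Ide[OF U(2) T(1) c(2)] c)
next
  case (8 X Y)
  then show ?case
    by (cases X; cases Y) (auto simp: triangular_simps intro: dg_product.product_dg_module[OF triangular_product])
next
  case (9 X Y Z)
  then obtain T U T' U' T'' U'' where XYZ: "X = (T, U)" "Y = (T', U')" "Z = (T'', U'')"
    and T: "T \<in> Obj \<T>" "T' \<in> Obj \<T>" "T'' \<in> Obj \<T>" and U: "U \<in> Obj \<U>" "U' \<in> Obj \<U>" "U'' \<in> Obj \<U>"
    by (auto simp: triangular_simps(1))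
  show ?case
    unfolding XYZ using triangular_Comp_dg_morphism[OF T U] triangular_Comp_pure[OF T U] by blast
qed

end

theorem proposition3p11:
  fixes K :: "('k, 'c) ring_scheme"
    and \<T> :: "('k, 't, 'mt) dg_category"
    and \<U> :: "('k, 'u, 'mu) dg_category"
    and M :: "('u \<times> 't, ('mu \<times> 'mt \<Rightarrow> 'k) set, ('k, 'v) dg_module, 'v \<Rightarrow> 'v) dg_functor"
  defines "\<Lambda> \<equiv> triangular_category K \<T> \<U> M"
  assumes "cring K"
    and "dg_category K \<T>"
    and "dg_category K \<U>"
    and "dg_functor K (tensor_category K \<U> (opposite \<T>)) (DgMod K) M"
  shows "(\<forall>T\<in>Obj \<T>. \<forall>T'\<in>Obj \<T>. \<forall>U\<in>Obj \<U>. \<forall>U'\<in>Obj \<U>.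
            dg_module K (Hom \<Lambda> (T, U) (T', U'))) \<and>
         (\<forall>T\<in>Obj \<T>. \<forall>T'\<in>Obj \<T>. \<forall>T''\<in>Obj \<T>. \<forall>U\<in>Obj \<U>. \<forall>U'\<in>Obj \<U>. \<forall>U''\<in>Obj \<U>.
            \<exists>c. dg_morphism K
                  (tensor K (Hom \<Lambda> (T', U') (T'', U'')) (Hom \<Lambda> (T, U) (T', U')))
                  (Hom \<Lambda> (T, U) (T'', U'')) c \<and>
                (\<forall>t\<^sub>2\<in>carrier (Hom \<T> T' T''). \<forall>m\<^sub>2\<in>carrier (onObj M (U'', T')).
                 \<forall>u\<^sub>2\<in>carrier (Hom \<U> U' U'').
                 \<forall>t\<^sub>1\<in>carrier (Hom \<T> T T'). \<forall>m\<^sub>1\<in>carrier (onObj M (U', T)).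
                 \<forall>u\<^sub>1\<in>carrier (Hom \<U> U U').
                   c (pure_tensor K (Hom \<Lambda> (T', U') (T'', U'')) (Hom \<Lambda> (T, U) (T', U'))
                        (t\<^sub>2, m\<^sub>2, u\<^sub>2) (t\<^sub>1, m\<^sub>1, u\<^sub>1)) =
                   (Comp \<T> T T' T'' t\<^sub>2 t\<^sub>1,
                    right_act K \<T> \<U> M U'' T T' m\<^sub>2 t\<^sub>1
                      \<oplus>\<^bsub>onObj M (U'', T)\<^esub> left_act K \<T> \<U> M U' U'' T u\<^sub>2 m\<^sub>1,
                    Comp \<U> U U' U'' u\<^sub>2 u\<^sub>1))) \<and>
         dg_category K \<Lambda>"
proof -
  interpret dg_bimodule K \<T> \<U> M
    using assms(3-5) by (rule dg_bimodule.intro)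
  show ?thesis
    unfolding \<Lambda>_def
  proof (intro conjI ballI triangular_dg_category, goal_cases)
    case (1 T T' U U')
    then show ?case by (rule dg_product.product_dg_module[OF triangular_product])
  next
    case (2 T T' T'' U U' U'')
    \<comment> \<open>The witness is the linear map that the universal property of the tensor
      product attaches to the bilinear composition of matrices.\<close>
    let ?c = "tensor_lift K (Hom (triangular_category K \<T> \<U> M) (T, U) (T'', U''))
      (Comp (triangular_category K \<T> \<U> M) (T, U) (T', U') (T'', U''))"
    show ?case
      by (rule exI[of _ ?c])
        (simp add: triangular_Comp_dg_morphism[OF 2] triangular_Comp_pure[OF 2]
          triangular_Hom_carrier 2 triangular_simps(2))
  qed
qed

end
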